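(* Let $\mathrm{Leb}$ be the Lebesgue measure on $[0,1]$ and fix a positive finite constant $\alpha$. Assume that $\mathcal X=[0,1]$ and that $P^X$ has a density $f$ with respect to $\mathrm{Leb}$ satisfying, for some positive finite constants $c_{\min}$ and $c_{\max}$, $$0<c_{\min}\le f(x)\le c_{\max}<+\infty,\quad x\in[0,1].\qquad(\ast)$$ Consider a linear model $M$ of piecewise polynomials on $[0,1]$ with degree at most $r$, defined on a finite partition $\mathcal P$ of $[0,1]$ made of intervals, that satisfies, for a finite constant $c_{M,\mathrm{Leb}}$, $$\sqrt{|\mathcal P|\inf_{I\in\mathcal P}\mathrm{Leb}(I)}\ge c_{M,\mathrm{Leb}}>0,\qquad(\ast\ast)$$ and let $D=(r+1)|\mathcal P|$ be its dimension. (1) Assume that there is a finite $A>0$ with $|Y_i|\le A$ a.s. and $\|s_M\|_\infty\le A$, and that there is a constant $\sigma_{\min}$ with $0<\sigma_{\min}\le\sigma(X_i)$ a.s. If there exist positive finite constants $A_-$ and $A_+$ such that $$A_-(\ln n)^2\le D\le A_+\frac n{(\ln n)^2},$$ then there exists a positive finite constant $A_0$, depending on $\alpha,A,\sigma_{\min},A_-,A_+,r,c_{M,\mathrm{Leb}},c_{\min}$ and $c_{\max}$, such that, setting $$\varepsilon_n=A_0\max\left\{\left(\frac{\ln n}D\right)^{1/4},\left(\frac{D\ln n}n\right)^{1/4}\right\},$$ one has, for all $n\ge n_0(A_-,A_+,A,r,\sigma_{\min},c_{M,\mathrm{Leb}},c_{\min},c_{\max},\alpha)$, $$\mathbb P\left[(1+\varepsilon_n)\tfrac14\tfrac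 Dn\mathcal K_{1,M}^2\ge P(Ks_n-Ks_M)\ge(1-\varepsilon_n)\tfrac14\tfrac Dn\mathcal K_{1,M}^2\right]\ge1-10n^{-\alpha}$$ and $$\mathbb P\left[(1+\varepsilon_n^2)\tfrac14\tfrac Dn\mathcal K_{1,M}^2\ge P_n(Ks_M-Ks_n)\ge(1-\varepsilon_n^2)\tfrac14\tfrac Dn\mathcal K_{1,M}^2\right]\ge1-5n^{-\alpha}.$$ (2) If $(\ast)$ and $(\ast\ast)$ hold, if there is a finite $A>0$ with $|Y_i|\le A$ a.s. and $\|s_M\|_\infty\le A$, and if $$1\le D\le A_+\frac n{(\ln n)^2}$$ for a positive finite constant $A_+$, then there exists a positive constant $A_u$, depending only on $A_+,A,r,c_{M,\mathrm{Leb}},c_{\min}$ and $\alpha$, such that for all $n\ge n_0(A_+,A,r,c_{\min},c_{\max},c_{M,\mathrm{Leb}},\alpha)$, $$\mathbb P\left[P(Ks_n-Ks_M)\ge A_u\frac{D\vee\ln n}n\right]\le3n^{-\alpha}\quad\text{and}\quad\mathbb P\left[P_n(Ks_M-Ks_n)\ge A_u\frac{D\vee\ln n}n\right]\le3n^{-\alpha}.$$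
   Context: Framework. $\mathcal Z=\mathcal X\times\mathbb R$, and $\xi_i=(X_i,Y_i)\in\mathcal Z$, $i=1,\dots,n$, are i.i.d. with law $P$; $P^X$ is the law of $X_i$; $(X,Y)$ is a generic variable of law $P$ independent of the sample. The data satisfy $Y_i=s_*(X_i)+\sigma(X_i)\varepsilon_i$ with $s_*\in L_2(P^X)$, $\sigma:\mathcal X\to\mathbb R$ a noise level, and $\varepsilon_i$ i.i.d. with mean $0$ and variance $1$ conditionally on $X_i$. $\|s\|_2=(\int s^2dP^X)^{1/2}$; $\|\cdot\|_\infty$ is the sup-norm. The model of piecewise polynomials with degree at most $r$ on $\mathcal P$ is the linear space of functions on $[0,1]$ whose restriction to each $I\in\mathcal P$ is a polynomial of degree at most $r$. $s_M$ is the orthogonal projection of $s_*$ onto $M$ in $L_2(P^X)$. For $g$ on $\mathcal Z$: $Pg=\mathbb E[g(X,Y)]$ and $P_ng=\frac1n\sum_{i=1}^ng(X_i,Y_i)$; when $g$ is random (depends on the sample), $Pg$ is the integral of $g$ with respect to $P$ with the sample held fixed. The contrast is $(Ks)(x,y)=(y-s(x))^2$. The least-squares estimator $s_n$ (possibly non unique) satisfies $s_n\in\arg\min_{s\in M}P_n(Ks)$. $\psi_{1,M}(x,y)=-2(y-s_M(x))$, $(\psi_{1,M}\cdot s)(x,y)=\psi_{1,M}(x,y)s(x)$, and $\mathcal K_{1,M}^2=\frac1D\sum_{k=1}^D\mathrm{Var}(\psi_{1,M}\cdot\varphi_k)$ for any orthonormal basis $(\varphi_k)_{k=1}^D$ of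 $(M,\|\cdot\|_2)$ (the value does not depend on the basis; the variance is under $P$). $a\vee b=\max(a,b)$. Conventions. The model may depend on $n$. "For all $n\ge n_0(a,b,\dots)$" means: there is a positive integer $n_0$ depending only on $a,b,\dots$ such that the assertion holds for all $n\ge n_0$. *)

theory Defs
  imports "HOL-Probability.Probability" "HOL-Computational_Algebra.Polynomial"
begin

definition leb01 :: "real measure"
  where "leb01 = restrict_space lborel {0..1}"

abbreviation data_space :: "(real \<times> real) measure"
  where "data_space \<equiv> leb01 \<Otimes>\<^sub>M (borel :: real measure)"

definition law_X :: "(real \<times> real) measure \<Rightarrow> real measure"
  where "law_X P = distr P leb01 fst"

(* P is the law of (X, Y) with Y = s(X) + sigma(X) * eps; Q is the joint law of (X, eps), and
   the conditioning is on the sigma-algebra generated by X.  The level sigma may vanish, so eps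
   need not be a function of (X, Y). *)
definition regression_law ::
    "(real \<times> real) measure \<Rightarrow> (real \<Rightarrow> real) \<Rightarrow> (real \<Rightarrow> real) \<Rightarrow> bool"
  where "regression_law P s \<sigma> \<longleftrightarrow>
    s \<in> borel_measurable leb01 \<and> \<sigma> \<in> borel_measurable leb01 \<and>
    integrable (law_X P) (\<lambda>x. (s x)\<^sup>2) \<and>
    (\<exists>Q. prob_space Q \<and> sets Q = sets data_space \<and>
         integrable Q (\<lambda>(x, e). e\<^sup>2) \<and>
         (AE z in Q. real_cond_exp Q (vimage_algebra (space Q) fst leb01) (\<lambda>(x, e). e) z = 0) \<and>
         (AE z in Q. real_cond_exp Q (vimage_algebra (space Q) fst leb01) (\<lambda>(x, e). e\<^sup>2) z = 1) \<and>
         P = distr Q data_space (\<lambda>(x, e). (x, s x + \<sigma> x * e)))"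

definition bounded_density :: "real measure \<Rightarrow> real \<Rightarrow> real \<Rightarrow> bool"
  where "bounded_density PX c_min c_max \<longleftrightarrow>
    (\<exists>f. f \<in> borel_measurable leb01 \<and> PX = density leb01 (\<lambda>x. ennreal (f x)) \<and>
         (\<forall>x\<in>{0..1}. c_min \<le> f x \<and> f x \<le> c_max))"

definition interval_partition :: "real set set \<Rightarrow> bool"
  where "interval_partition \<I> \<longleftrightarrow>
    finite \<I> \<and> partition_on {0..1} \<I> \<and> (\<forall>I\<in>\<I>. is_interval I)"

definition lower_regular :: "real set set \<Rightarrow> real \<Rightarrow> bool"
  where "lower_regular \<I> c \<longleftrightarrow> sqrt (real (card \<I>) * (INF I\<in>\<I>. measure leb01 I)) \<ge> c"

(* A function on [0,1] is represented by its extension by 0 to the real line. *)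
definition piecewise_poly :: "real set set \<Rightarrow> nat \<Rightarrow> (real \<Rightarrow> real) set"
  where "piecewise_poly \<I> r =
    {s. (\<forall>I\<in>\<I>. \<exists>p :: real poly. degree p \<le> r \<and> (\<forall>x\<in>I. s x = poly p x)) \<and>
        (\<forall>x. x \<notin> {0..1} \<longrightarrow> s x = 0)}"

definition model_dim :: "real set set \<Rightarrow> nat \<Rightarrow> nat"
  where "model_dim \<I> r = (r + 1) * card \<I>"

definition L2_inner :: "real measure \<Rightarrow> (real \<Rightarrow> real) \<Rightarrow> (real \<Rightarrow> real) \<Rightarrow> real"
  where "L2_inner PX s t = (LINT x|PX. s x * t x)"

definition orth_projection ::
    "real measure \<Rightarrow> (real \<Rightarrow> real) set \<Rightarrow> (real \<Rightarrow> real) \<Rightarrow> (real \<Rightarrow> real) \<Rightarrow> bool"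
  where "orth_projection PX M s s_M \<longleftrightarrow>
    s_M \<in> M \<and> (\<forall>t\<in>M. L2_inner PX (\<lambda>x. s x - s_M x) t = 0)"

definition orthonormal_basis ::
    "real measure \<Rightarrow> (real \<Rightarrow> real) set \<Rightarrow> nat \<Rightarrow> (nat \<Rightarrow> real \<Rightarrow> real) \<Rightarrow> bool"
  where "orthonormal_basis PX M D \<phi> \<longleftrightarrow>
    (\<forall>k<D. \<phi> k \<in> M) \<and>
    (\<forall>j<D. \<forall>k<D. L2_inner PX (\<phi> j) (\<phi> k) = (if j = k then 1 else 0)) \<and>
    (\<forall>s\<in>M. \<exists>c. \<forall>x. s x = (\<Sum>k<D. c k * \<phi> k x))"

definition contrast :: "(real \<Rightarrow> real) \<Rightarrow> real \<times> real \<Rightarrow> real"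
  where "contrast s = (\<lambda>(x, y). (y - s x)\<^sup>2)"

definition empirical :: "nat \<Rightarrow> (nat \<Rightarrow> real \<times> real) \<Rightarrow> (real \<times> real \<Rightarrow> real) \<Rightarrow> real"
  where "empirical n \<xi> g = (\<Sum>i<n. g (\<xi> i)) / real n"

definition sample :: "nat \<Rightarrow> (real \<times> real) measure \<Rightarrow> (nat \<Rightarrow> real \<times> real) measure"
  where "sample n P = Pi\<^sub>M {..<n} (\<lambda>_. P)"

(* An arbitrary measurable choice of minimiser; measurability makes the excess risks below
   random variables. *)
definition least_squares ::
    "nat \<Rightarrow> (real \<times> real) measure \<Rightarrow> (real \<Rightarrow> real) set \<Rightarrow>
      ((nat \<Rightarrow> real \<times> real) \<Rightarrow> real \<Rightarrow> real) \<Rightarrow> bool"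
  where "least_squares n P M s_n \<longleftrightarrow>
    (\<lambda>(\<xi>, x). s_n \<xi> x) \<in> borel_measurable (sample n P \<Otimes>\<^sub>M leb01) \<and>
    (\<forall>\<xi>\<in>space (sample n P).
       is_arg_min (\<lambda>s. empirical n \<xi> (contrast s)) (\<lambda>s. s \<in> M) (s_n \<xi>))"

(* P(Ks - Kt) *)
definition true_excess ::
    "(real \<times> real) measure \<Rightarrow> (real \<Rightarrow> real) \<Rightarrow> (real \<Rightarrow> real) \<Rightarrow> real"
  where "true_excess P s t = (LINT z|P. contrast s z - contrast t z)"

(* P_n(Kt - Ks): the order of the two functions is the opposite of that in the contrasts of
   true_excess, so that both quantities are nonnegative for s = s_n and t = s_M. *)
definition empirical_excess ::
    "nat \<Rightarrow> (nat \<Rightarrow> real \<times> real) \<Rightarrow> (real \<Rightarrow> real) \<Rightarrow> (real \<Rightarrow> real) \<Rightarrow> real"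
  where "empirical_excess n \<xi> s t = empirical n \<xi> (\<lambda>z. contrast t z - contrast s z)"

definition psi1 :: "(real \<Rightarrow> real) \<Rightarrow> real \<times> real \<Rightarrow> real"
  where "psi1 s_M = (\<lambda>(x, y). - 2 * (y - s_M x))"

(* The square of K_{1,M}, computed in the basis phi. *)
definition K1_sq ::
    "(real \<times> real) measure \<Rightarrow> (real \<Rightarrow> real) \<Rightarrow> nat \<Rightarrow> (nat \<Rightarrow> real \<Rightarrow> real) \<Rightarrow> real"
  where "K1_sq P s_M D \<phi> =
    1 / real D * (\<Sum>k<D. prob_space.variance P (\<lambda>(x, y). psi1 s_M (x, y) * \<phi> k x))"

definition eps_n :: "real \<Rightarrow> nat \<Rightarrow> nat \<Rightarrow> real"
  where "eps_n A\<^sub>0 D n =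
    A\<^sub>0 * max ((ln (real n) / real D) powr (1 / 4)) ((real D * ln (real n) / real n) powr (1 / 4))"

definition common_hyps ::
    "real \<Rightarrow> real \<Rightarrow> real \<Rightarrow> real \<Rightarrow> nat \<Rightarrow> nat \<Rightarrow> (real \<times> real) measure \<Rightarrow> (real \<Rightarrow> real) \<Rightarrow>
      (real \<Rightarrow> real) \<Rightarrow> real set set \<Rightarrow> (real \<Rightarrow> real) \<Rightarrow>
      ((nat \<Rightarrow> real \<times> real) \<Rightarrow> real \<Rightarrow> real) \<Rightarrow> bool"
  where "common_hyps A c_M c_min c_max r n P s \<sigma> \<I> s_M s_n \<longleftrightarrow>
    regression_law P s \<sigma> \<and>
    bounded_density (law_X P) c_min c_max \<and>
    interval_partition \<I> \<and> lower_regular \<I> c_M \<and>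
    orth_projection (law_X P) (piecewise_poly \<I> r) s s_M \<and>
    least_squares n P (piecewise_poly \<I> r) s_n \<and>
    (AE (x, y) in P. \<bar>y\<bar> \<le> A) \<and> (\<forall>x\<in>{0..1}. \<bar>s_M x\<bar> \<le> A)"

end

(* With psi = y - s_M(x) and an orthonormal basis (b_j) of M, the vector g_j = P_n(psi b_j) satisfies
   E|g|^2 = (D/4n) K_{1,M}^2, and the normal equations say that the coefficient vector c of s_n - s_M
   solves (empirical Gram matrix) c = g, while P(K s_n - K s_M) = |c|^2 and
   P_n(K s_M - K s_n) = <c, g>.  Two concentration facts therefore suffice.

   Choosing the basis adapted to the partition makes the Gram matrix block diagonal with blocks of
   size r + 1, so that entrywise Bernstein bounds show that it is close to the identity.

   The squared norm of S_n = n g splits into a diagonal sum, handled by Bernstein's inequality, and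
   twice the martingale sum_i <S_{i-1}, F(xi_i)>.  The latter is controlled by an exponential
   inequality for martingales after truncating on the event that |S_{i-1}| is not too large; the
   resulting bound on |S_i| shows in turn that the truncation is never active.  Block structure
   keeps the increments small, because only one block of F(xi_i) is nonzero. *)

theory Submission
  imports Defs "HOL-Real_Asymp.Real_Asymp"
begin

section \<open>An exponential inequality for martingales on product spaces\<close>

text \<open>The obstacle is scale: D may be almost as large as n/(ln n)^2, and |g|^2 is wanted up to
  a relative error that tends to 0, so its D squares cannot be bounded one at a time. Take a
  deviation parameter of order ln n. The martingale has conditional variances of order n E with E =
  max(D, ln n), because the truncation keeps |S_i|^2 below such a bound, and increments of order
  sqrt(n ln n) sqrt(D). Bernstein's inequality gives the deviation n sqrt(E ln n): the condition D
  (ln n)^2 = O(n) is what keeps the linear term sqrt(n D) (ln n)^(3/2) below n sqrt(ln n). Against a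
  mean of order n D, which the lower bound on the noise provides, this is the relative error sqrt(ln
  n / D). The diagonal sum contributes sqrt(ln n / n) and the Gram matrix sqrt(D ln n / n). The
  largest of these is the square of \<open>eps_n\<close> up to a constant, for both excess risks.
  The deviation parameter is exactly (\<alpha> + 3) ln n: the three additional powers of n pay for
  union bounds over the coordinates and over all times m \<le> n.\<close>

abbreviation iid :: "nat \<Rightarrow> 'a measure \<Rightarrow> (nat \<Rightarrow> 'a) measure"
  where "iid n P \<equiv> Pi\<^sub>M {..<n} (\<lambda>_. P)"

lemma exp_le_quadratic:
  fixes u :: real
  assumes "\<bar>u\<bar> \<le> 1"
  shows "exp u \<le> 1 + u + u\<^sup>2"
proof (cases "u \<ge> 0")
  case True
  then show ?thesis using exp_bound[of u] assms by auto
next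
  case False
  define s where "s = - u"
  have s: "0 \<le> s" "s \<le> 1" using False assms by (auto simp: s_def)
  \<comment> \<open>The product equals 1 + s^3, so 1 - s + s^2 is at least 1 / (1 + s), which
    dominates exp (- s).\<close>
  have "1 \<le> (1 - s + s\<^sup>2) * (1 + s)"
    using s by (simp add: algebra_simps power2_eq_square)
  also have "\<dots> \<le> (1 - s + s\<^sup>2) * exp s"
  proof (rule mult_left_mono)
    show "0 \<le> 1 - s + s\<^sup>2" using s by (simp add: add_nonneg_nonneg)
  qed (use exp_ge_add_one_self[of s] in simp)
  finally have "exp (- s) * 1 \<le> exp (- s) * ((1 - s + s\<^sup>2) * exp s)"
    by (intro mult_left_mono) auto
  also have "\<dots> = 1 - s + s\<^sup>2"
    by (simp add: exp_minus field_simps)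
  finally show ?thesis by (simp add: s_def)
qed

lemma (in prob_space) bounded_square_integrable:
  fixes f :: "'a \<Rightarrow> real"
  assumes [measurable]: "f \<in> borel_measurable M" and "AE x in M. \<bar>f x\<bar> \<le> C"
  shows "integrable M (\<lambda>x. (f x)\<^sup>2)"
proof (rule integrable_const_bound[where B = "C\<^sup>2"])
  show "AE x in M. norm ((f x)\<^sup>2) \<le> C\<^sup>2"
    using assms(2) by eventually_elim (metis abs_ge_zero power2_abs power_mono real_norm_def abs_power2)
qed measurable

text \<open>The linear term of \<open>exp_le_quadratic\<close> integrates to 0 and the quadratic one
  to at most l^2 v. The nonnegative integral is used because it can be iterated over the product
  space without integrability conditions.\<close>

lemma (in prob_space) nn_integral_exp_le:
  fixes h :: "'a \<Rightarrow> real"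
  assumes [measurable]: "h \<in> borel_measurable M"
    and bd: "\<And>z. z \<in> space M \<Longrightarrow> \<bar>h z\<bar> \<le> b"
    and mean: "expectation h = 0" and var: "expectation (\<lambda>z. (h z)\<^sup>2) \<le> v"
    and l: "0 \<le> l" "l * b \<le> 1"
  shows "(\<integral>\<^sup>+z. ennreal (exp (l * h z)) \<partial>M) \<le> ennreal (exp (l\<^sup>2 * v))"
proof -
  have hint: "integrable M h"
    by (rule integrable_const_bound[where B = b]) (auto intro: AE_I2 bd)
  have h2int: "integrable M (\<lambda>z. (h z)\<^sup>2)"
    by (rule bounded_square_integrable[where C = b]) (auto intro: AE_I2 bd)
  have pt: "exp (l * h z) \<le> 1 + l * h z + l\<^sup>2 * (h z)\<^sup>2" if "z \<in> space M" for z
  proof -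
    have "\<bar>l * h z\<bar> = l * \<bar>h z\<bar>" using l by (simp add: abs_mult)
    also have "\<dots> \<le> l * b" using bd[OF that] l by (intro mult_left_mono) auto
    finally have "\<bar>l * h z\<bar> \<le> 1" using l by simp
    from exp_le_quadratic[OF this] show ?thesis by (simp add: power_mult_distrib)
  qed
  have "(\<integral>\<^sup>+z. ennreal (exp (l * h z)) \<partial>M) \<le> (\<integral>\<^sup>+z. ennreal (1 + l * h z + l\<^sup>2 * (h z)\<^sup>2) \<partial>M)"
    by (intro nn_integral_mono ennreal_leI pt)
  also have "\<dots> = ennreal (expectation (\<lambda>z. 1 + l * h z + l\<^sup>2 * (h z)\<^sup>2))"
  proof (rule nn_integral_eq_integral)
    show "integrable M (\<lambda>z. 1 + l * h z + l\<^sup>2 * (h z)\<^sup>2)" using hint h2int by auto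
    show "AE z in M. 0 \<le> 1 + l * h z + l\<^sup>2 * (h z)\<^sup>2"
      using order_trans[OF exp_ge_zero pt] by (intro AE_I2) auto
  qed
  also have "expectation (\<lambda>z. 1 + l * h z + l\<^sup>2 * (h z)\<^sup>2) = 1 + l\<^sup>2 * expectation (\<lambda>z. (h z)\<^sup>2)"
    using hint h2int mean by (simp add: prob_space)
  also have "\<dots> \<le> 1 + l\<^sup>2 * v" using var by (simp add: mult_left_mono)
  also have "\<dots> \<le> exp (l\<^sup>2 * v)" by (rule exp_ge_add_one_self)
  finally show ?thesis by (simp add: ennreal_leI)
qed

lemma restricted_term_measurable:
  fixes h :: "nat \<Rightarrow> (nat \<Rightarrow> 'a) \<Rightarrow> 'a \<Rightarrow> real"
  assumes "(\<lambda>(\<xi>, z). h i \<xi> z) \<in> borel_measurable (iid i P \<Otimes>\<^sub>M P)" "i < n"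
  shows "(\<lambda>\<xi>. h i (restrict \<xi> {..<i}) (\<xi> i)) \<in> borel_measurable (iid n P)"
proof -
  have "(\<lambda>\<xi>. (restrict \<xi> {..<i}, \<xi> i)) \<in> iid n P \<rightarrow>\<^sub>M iid i P \<Otimes>\<^sub>M P"
    using assms(2)
    by (intro measurable_Pair measurable_restrict_subset measurable_component_singleton) auto
  from measurable_compose[OF this assms(1)] show ?thesis by (simp add: comp_def)
qed

text \<open>The increment \<open>h i \<xi>\<close> may only depend on the first \<open>i\<close> observations, which is
  expressed by the restriction of \<open>\<xi>\<close> in the sums below.\<close>

locale martingale_increments = P: prob_space P for P :: "'a measure" +
  fixes h :: "nat \<Rightarrow> (nat \<Rightarrow> 'a) \<Rightarrow> 'a \<Rightarrow> real" and b v :: real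
  assumes meas: "\<And>i. (\<lambda>(\<xi>, z). h i \<xi> z) \<in> borel_measurable (iid i P \<Otimes>\<^sub>M P)"
    and bd: "\<And>i \<xi> z. \<xi> \<in> space (iid i P) \<Longrightarrow> z \<in> space P \<Longrightarrow> \<bar>h i \<xi> z\<bar> \<le> b"
    and mean: "\<And>i \<xi>. \<xi> \<in> space (iid i P) \<Longrightarrow> (LINT z|P. h i \<xi> z) = 0"
    and var: "\<And>i \<xi>. \<xi> \<in> space (iid i P) \<Longrightarrow> (LINT z|P. (h i \<xi> z)\<^sup>2) \<le> v"
begin

lemma partial_sum_measurable:
  assumes "m \<le> n"
  shows "(\<lambda>\<xi>. \<Sum>i<m. h i (restrict \<xi> {..<i}) (\<xi> i)) \<in> borel_measurable (iid n P)"
  using assms by (intro borel_measurable_sum restricted_term_measurable meas) auto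

text \<open>The last observation is integrated first: with the earlier ones held fixed,
  \<open>nn_integral_exp_le\<close> bounds the inner integral by a constant, which leaves the same
  claim for n observations.\<close>

lemma nn_integral_exp_martingale:
  assumes l: "0 \<le> l" "l * b \<le> 1"
  shows "(\<integral>\<^sup>+\<xi>. ennreal (exp (l * (\<Sum>i<n. h i (restrict \<xi> {..<i}) (\<xi> i)))) \<partial>iid n P)
    \<le> ennreal (exp (real n * l\<^sup>2 * v))"
proof (induction n)
  case 0
  then show ?case
    using prob_space.emeasure_le_1[OF prob_space_PiM[of "{}" "\<lambda>_. P"]] by simp
next
  case (Suc n)
  interpret PS: product_prob_space "\<lambda>_. P" UNIV by standard
  define Sn where "Sn \<xi> = (\<Sum>i<n. h i (restrict \<xi> {..<i}) (\<xi> i))" for \<xi> :: "nat \<Rightarrow> 'a"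
  have [measurable]: "Sn \<in> borel_measurable (iid n P)"
    unfolding Sn_def by (rule partial_sum_measurable) simp
  have "(\<integral>\<^sup>+\<xi>. ennreal (exp (l * (\<Sum>i<Suc n. h i (restrict \<xi> {..<i}) (\<xi> i)))) \<partial>iid (Suc n) P)
    = (\<integral>\<^sup>+\<xi>. ennreal (exp (l * (\<Sum>i<Suc n. h i (restrict \<xi> {..<i}) (\<xi> i)))) \<partial>Pi\<^sub>M (insert n {..<n}) (\<lambda>_. P))"
    by (simp add: lessThan_Suc)
  also have "\<dots> = (\<integral>\<^sup>+\<xi>. (\<integral>\<^sup>+z. ennreal (exp (l * (\<Sum>i<Suc n. h i (restrict (\<xi>(n := z)) {..<i}) ((\<xi>(n := z)) i)))) \<partial>P)
        \<partial>iid n P)"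
  proof (rule PS.product_nn_integral_insert)
    have "(\<lambda>\<xi>. \<Sum>i<Suc n. h i (restrict \<xi> {..<i}) (\<xi> i)) \<in> borel_measurable (iid (Suc n) P)"
      by (rule partial_sum_measurable) simp
    then show "(\<lambda>\<xi>. ennreal (exp (l * (\<Sum>i<Suc n. h i (restrict \<xi> {..<i}) (\<xi> i)))))
      \<in> borel_measurable (Pi\<^sub>M (insert n {..<n}) (\<lambda>_. P))"
      by (simp add: lessThan_Suc)
  qed auto
  also have "\<dots> = (\<integral>\<^sup>+\<xi>. (\<integral>\<^sup>+z. ennreal (exp (l * Sn \<xi>)) * ennreal (exp (l * h n \<xi> z)) \<partial>P) \<partial>iid n P)"
  proof (intro nn_integral_cong)
    fix \<xi> z assume \<xi>: "\<xi> \<in> space (iid n P)" and z: "z \<in> space P"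
    have r: "restrict (\<xi>(n := z)) {..<i} = restrict \<xi> {..<i}" if "i \<le> n" for i
      using that by (auto simp: restrict_def fun_eq_iff)
    have rn: "restrict \<xi> {..<n} = \<xi>"
      using \<xi> by (auto simp: space_PiM PiE_def extensional_restrict)
    have "(\<Sum>i<Suc n. h i (restrict (\<xi>(n := z)) {..<i}) ((\<xi>(n := z)) i))
      = Sn \<xi> + h n \<xi> z"
      unfolding Sn_def by (simp add: r rn)
    then show "ennreal (exp (l * (\<Sum>i<Suc n. h i (restrict (\<xi>(n := z)) {..<i}) ((\<xi>(n := z)) i))))
       = ennreal (exp (l * Sn \<xi>)) * ennreal (exp (l * h n \<xi> z))"
      by (simp only: distrib_left exp_add ennreal_mult'[OF exp_ge_zero])
  qed
  also have "\<dots> = (\<integral>\<^sup>+\<xi>. ennreal (exp (l * Sn \<xi>)) * (\<integral>\<^sup>+z. ennreal (exp (l * h n \<xi> z)) \<partial>P) \<partial>iid n P)"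
    using measurable_compose[OF measurable_Pair1' meas]
    by (intro nn_integral_cong nn_integral_cmult) (auto simp: comp_def)
  also have "\<dots> \<le> (\<integral>\<^sup>+\<xi>. ennreal (exp (l * Sn \<xi>)) * ennreal (exp (l\<^sup>2 * v)) \<partial>iid n P)"
  proof (intro nn_integral_mono mult_left_mono P.nn_integral_exp_le[where b = b])
    fix \<xi> assume \<xi>: "\<xi> \<in> space (iid n P)"
    show "h n \<xi> \<in> borel_measurable P"
      using measurable_compose[OF measurable_Pair1'[OF \<xi>] meas[of n]] by (simp add: comp_def)
  qed (use bd mean var l in auto)
  also have "\<dots> = (\<integral>\<^sup>+\<xi>. ennreal (exp (l * Sn \<xi>)) \<partial>iid n P) * ennreal (exp (l\<^sup>2 * v))"
    by (intro nn_integral_multc) measurable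
  also have "\<dots> \<le> ennreal (exp (real n * l\<^sup>2 * v)) * ennreal (exp (l\<^sup>2 * v))"
    unfolding Sn_def by (intro mult_right_mono Suc.IH) auto
  also have "\<dots> = ennreal (exp (real (Suc n) * l\<^sup>2 * v))"
    by (simp add: ennreal_mult'[symmetric] exp_add[symmetric] algebra_simps)
  finally show ?case .
qed

lemma martingale_bernstein:
  assumes pos: "0 < b" "0 < v" "0 < x" "0 < n"
  shows "\<P>(\<xi> in iid n P.
      (\<Sum>i<n. h i (restrict \<xi> {..<i}) (\<xi> i)) \<ge> 2 * sqrt (real n * v * x) + b * x) \<le> exp (- x)"
proof -
  interpret PP: prob_space "iid n P" by (intro prob_space_PiM P.prob_space_axioms)
  define H where "H \<xi> = (\<Sum>i<n. h i (restrict \<xi> {..<i}) (\<xi> i))" for \<xi> :: "nat \<Rightarrow> 'a"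
  have [measurable]: "H \<in> borel_measurable (iid n P)"
    unfolding H_def by (rule partial_sum_measurable) simp
  define t where "t = 2 * sqrt (real n * v * x) + b * x"
  define V where "V = real n * v"
  \<comment> \<open>Chernoff's bound needs x \<le> l t - V l^2. The value sqrt (x / V) balances V
    l^2 against x, and the cap 1 / b keeps l b \<le> 1 as the exponential moment bound
    demands.\<close>
  define l where "l = min (1 / b) (sqrt (x / V))"
  have V: "V > 0" using pos by (simp add: V_def)
  have l: "l > 0" "l * b \<le> 1" using pos V by (auto simp: l_def min_def field_simps)
  have t: "t = 2 * sqrt (V * x) + b * x" by (simp add: t_def V_def)
  have key: "x \<le> l * t - V * l\<^sup>2"
  proof (cases "1 / b \<le> sqrt (x / V)")
    case True
    then have l': "l = 1 / b" by (simp add: l_def)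
    have sq: "sqrt (V * x) = V * sqrt (x / V)"
      using V pos by (intro real_sqrt_unique) (auto simp: power_mult_distrib field_simps power2_eq_square)
    \<comment> \<open>When the cap is active, V l^2 = V / b^2 is absorbed by the square root part of
      t, and the part b x supplies exactly x.\<close>
    have "V / b \<le> sqrt (V * x)" unfolding sq using mult_left_mono[OF True, of V] V by simp
    then have "V / b\<^sup>2 \<le> sqrt (V * x) / b" using pos by (simp add: power2_eq_square field_simps)
    moreover have "0 \<le> sqrt (V * x) / b" using V pos by simp
    ultimately have "V / b\<^sup>2 \<le> 2 * sqrt (V * x) / b" by simp
    then show ?thesis using pos unfolding l' t by (simp add: field_simps power2_eq_square)
  next
    case False
    then have l': "l = sqrt (x / V)" by (simp add: l_def)
    have "sqrt (x / V) * sqrt (V * x) = sqrt (x\<^sup>2)"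
      using V by (simp add: real_sqrt_mult[symmetric] power2_eq_square del: real_sqrt_mult_self)
    then have a: "l * sqrt (V * x) = x" using pos l' by simp
    have b: "V * l\<^sup>2 = x" using V pos by (simp add: l')
    have "0 \<le> l * (b * x)" using l pos by simp
    then show ?thesis unfolding t using a b by (simp add: distrib_left)
  qed
  have "emeasure (iid n P) {\<xi> \<in> space (iid n P). t \<le> H \<xi>}
    \<le> emeasure (iid n P) {\<xi> \<in> space (iid n P). 1 \<le> ennreal (exp (- (l * t))) * ennreal (exp (l * H \<xi>))}"
  proof (intro emeasure_mono)
    show "{\<xi> \<in> space (iid n P). t \<le> H \<xi>} \<subseteq>
      {\<xi> \<in> space (iid n P). 1 \<le> ennreal (exp (- (l * t))) * ennreal (exp (l * H \<xi>))}"
      using l by (auto simp: ennreal_mult'[symmetric] exp_add[symmetric] mult_left_mono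
          simp flip: ennreal_1 intro!: ennreal_leI)
  qed measurable
  also have "\<dots> \<le> ennreal (exp (- (l * t))) * (\<integral>\<^sup>+\<xi>. ennreal (exp (l * H \<xi>)) * indicator (space (iid n P)) \<xi> \<partial>iid n P)"
    by (intro order_trans[OF _ nn_integral_Markov_inequality[where c = "ennreal (exp (- (l * t)))"]])
       (auto intro!: emeasure_mono)
  also have "\<dots> = ennreal (exp (- (l * t))) * (\<integral>\<^sup>+\<xi>. ennreal (exp (l * H \<xi>)) \<partial>iid n P)"
    by (intro arg_cong2[where f = "(*)"] nn_integral_cong) auto
  also have "\<dots> \<le> ennreal (exp (- (l * t))) * ennreal (exp (real n * l\<^sup>2 * v))"
    unfolding H_def using l
    by (intro mult_left_mono nn_integral_exp_martingale) auto
  also have "\<dots> = ennreal (exp (- (l * t - V * l\<^sup>2)))"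
    by (simp add: ennreal_mult'[symmetric] exp_add[symmetric] V_def algebra_simps)
  also have "\<dots> \<le> ennreal (exp (- x))" using key by (intro ennreal_leI) simp
  finally have "ennreal (measure (iid n P) {\<xi> \<in> space (iid n P). t \<le> H \<xi>}) \<le> ennreal (exp (- x))"
    by (simp add: PP.emeasure_eq_measure)
  then show ?thesis by (simp add: t_def H_def)
qed

end

text \<open>Setting the increments of index at least m to 0 turns a shorter sum into a full one on
  the n-fold product. All partial sums thus live on one space and share one threshold, as a union
  bound over m requires. The factor c = 1 or c = -1 gives the two tails.\<close>

lemma (in martingale_increments) martingale_bernstein_abs:
  assumes pos: "0 < b" "0 < v" "0 < x" "0 < n" and mn: "m \<le> n"
  shows "\<P>(\<xi> in iid n P.
      \<bar>\<Sum>i<m. h i (restrict \<xi> {..<i}) (\<xi> i)\<bar> \<ge> 2 * sqrt (real n * v * x) + b * x) \<le> 2 * exp (- x)"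
proof -
  interpret PP: prob_space "iid n P" by (intro prob_space_PiM P.prob_space_axioms)
  define t where "t = 2 * sqrt (real n * v * x) + b * x"
  define H where "H \<xi> = (\<Sum>i<m. h i (restrict \<xi> {..<i}) (\<xi> i))" for \<xi> :: "nat \<Rightarrow> 'a"
  have [measurable]: "H \<in> borel_measurable (iid n P)"
    unfolding H_def using mn by (rule partial_sum_measurable)
  have sum_eq: "(\<Sum>i<n. (if i < m then c * h i (restrict \<xi> {..<i}) (\<xi> i) else 0)) = c * H \<xi>" for c \<xi>
  proof -
    have "(\<Sum>i<n. (if i < m then c * h i (restrict \<xi> {..<i}) (\<xi> i) else 0))
      = (\<Sum>i<m. c * h i (restrict \<xi> {..<i}) (\<xi> i))"
      using mn by (intro sum.mono_neutral_cong_right) auto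
    then show ?thesis by (simp add: H_def sum_distrib_left)
  qed
  have one: "\<P>(\<xi> in iid n P. c * H \<xi> \<ge> t) \<le> exp (- x)" if c: "\<bar>c\<bar> = 1" for c :: real
  proof -
    have c2: "c\<^sup>2 = 1" using c by (metis power2_abs one_power2)
    interpret c: martingale_increments P "\<lambda>i \<xi> z. if i < m then c * h i \<xi> z else 0" b v
    proof unfold_locales
      show "(\<lambda>(\<xi>, z). if i < m then c * h i \<xi> z else 0) \<in> borel_measurable (iid i P \<Otimes>\<^sub>M P)" for i
        using borel_measurable_times[OF borel_measurable_const meas[of i], of c]
        by (cases "i < m") (auto simp: case_prod_beta')
      show "(LINT z|P. (if i < m then c * h i \<xi> z else 0)) = 0"
        if "\<xi> \<in> space (iid i P)" for i \<xi>
        using mean[OF that] by (cases "i < m") auto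
      show "(LINT z|P. (if i < m then c * h i \<xi> z else 0)\<^sup>2) \<le> v"
        if "\<xi> \<in> space (iid i P)" for i \<xi>
        using var[OF that] pos by (cases "i < m") (auto simp: power_mult_distrib c2)
    qed (use pos bd c in \<open>auto simp: abs_mult\<close>)
    show ?thesis using c.martingale_bernstein[OF pos] by (simp add: sum_eq t_def)
  qed
  have "\<P>(\<xi> in iid n P. \<bar>H \<xi>\<bar> \<ge> t) \<le>
    measure (iid n P) ({\<xi> \<in> space (iid n P). 1 * H \<xi> \<ge> t} \<union> {\<xi> \<in> space (iid n P). (-1) * H \<xi> \<ge> t})"
    by (intro PP.finite_measure_mono) (auto simp: abs_if split: if_splits)
  also have "\<dots> \<le> measure (iid n P) {\<xi> \<in> space (iid n P). 1 * H \<xi> \<ge> t}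
     + measure (iid n P) {\<xi> \<in> space (iid n P). (-1) * H \<xi> \<ge> t}"
    by (intro measure_Un_le) measurable
  also have "\<dots> \<le> exp (-x) + exp (-x)"
    by (intro add_mono one) auto
  finally show ?thesis by (simp add: H_def t_def)
qed

text \<open>Independent summands are martingale increments that ignore the past. Centring at most
  doubles the sup bound, whence 2 b, and does not increase the second moment.\<close>

lemma bernstein_abs:
  fixes g :: "'a \<Rightarrow> real"
  assumes P: "prob_space P" and g[measurable]: "g \<in> borel_measurable P"
    and bd: "\<And>z. z \<in> space P \<Longrightarrow> \<bar>g z\<bar> \<le> b"
    and var: "(LINT z|P. (g z)\<^sup>2) \<le> v"
    and pos: "0 < b" "0 < v" "0 < x" "0 < n" and mn: "m \<le> n"
  shows "\<P>(\<xi> in iid n P.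
      \<bar>(\<Sum>i<m. g (\<xi> i)) - real m * (LINT z|P. g z)\<bar> \<ge> 2 * sqrt (real n * v * x) + 2 * b * x) \<le> 2 * exp (- x)"
proof -
  interpret P: prob_space P by fact
  define \<mu> where "\<mu> = (LINT z|P. g z)"
  have gint: "integrable P g"
    by (rule P.integrable_const_bound[where B = b]) (auto intro: AE_I2 bd)
  have g2int: "integrable P (\<lambda>z. (g z)\<^sup>2)"
    by (rule P.bounded_square_integrable[where C = b]) (auto intro: AE_I2 bd)
  have mu: "\<bar>\<mu>\<bar> \<le> b"
  proof -
    have "\<bar>\<mu>\<bar> \<le> (LINT z|P. \<bar>g z\<bar>)" unfolding \<mu>_def by (rule integral_abs_bound)
    also have "\<dots> \<le> b" using gint bd by (intro P.integral_le_const AE_I2) auto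
    finally show ?thesis .
  qed
  interpret centred: martingale_increments P "\<lambda>i \<xi> z. g z - \<mu>" "2 * b" v
  proof unfold_locales
    fix \<xi> :: "nat \<Rightarrow> 'a" and i z
    show "\<bar>g z - \<mu>\<bar> \<le> 2 * b" if "z \<in> space P" using bd[OF that] mu by linarith
    show "(LINT z|P. g z - \<mu>) = 0" using gint by (simp add: \<mu>_def P.prob_space)
    have "(LINT z|P. (g z - \<mu>)\<^sup>2) = (LINT z|P. (g z)\<^sup>2) - \<mu>\<^sup>2"
      unfolding \<mu>_def by (rule P.variance_eq[OF gint g2int])
    also have "\<dots> \<le> v" using var by (smt (verit) zero_le_power2)
    finally show "(LINT z|P. (g z - \<mu>)\<^sup>2) \<le> v" .
  qed measurable
  show ?thesis
    using centred.martingale_bernstein_abs[of x n m] pos mn by (simp add: sum_subtractf \<mu>_def)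
qed

section \<open>Concentration of the squared norm of a sum of sparse vectors\<close>

text \<open>Exceptional events are passed on as measurable sets \<open>Bad\<close>. They can be
  united, and everything outside them is deterministic reasoning about a single sample
  point.\<close>

lemma (in prob_space) union_bound:
  assumes "finite A" "\<And>a. a \<in> A \<Longrightarrow> {\<xi> \<in> space M. Q a \<xi>} \<in> sets M"
    and "\<And>a. a \<in> A \<Longrightarrow> \<P>(\<xi> in M. Q a \<xi>) \<le> c"
  shows "\<exists>Bad\<in>sets M. prob Bad \<le> real (card A) * c \<and> (\<forall>\<xi>\<in>space M - Bad. \<forall>a\<in>A. \<not> Q a \<xi>)"
proof (intro bexI conjI)
  let ?Bad = "\<Union>a\<in>A. {\<xi> \<in> space M. Q a \<xi>}"
  show "?Bad \<in> sets M" using assms by (intro sets.finite_UN) auto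
  have "prob ?Bad \<le> (\<Sum>a\<in>A. \<P>(\<xi> in M. Q a \<xi>))" using assms by (intro measure_UNION_le) auto
  also have "\<dots> \<le> (\<Sum>a\<in>A. c)" using assms by (intro sum_mono) auto
  finally show "prob ?Bad \<le> real (card A) * c" by simp
qed auto

text \<open>\<open>F\<close> is a centred random vector indexed by \<open>J\<close>.
  \<open>F_cov\<close> says that its covariance matrix is at most \<open>\<tau>\<close> times the
  identity, and \<open>F_sparse\<close> that each observation touches at most q coordinates, so that
  bounds for sums over \<open>J\<close> involve q instead of the dimension.\<close>

locale sparse_scores = prob_space P for P :: "'z measure" +
  fixes J :: "'j set" and F :: "'j \<Rightarrow> 'z \<Rightarrow> real" and \<beta> \<tau> :: real and q :: nat
  assumes finite_J: "finite J"
    and F_measurable[measurable]: "\<And>j. j \<in> J \<Longrightarrow> F j \<in> borel_measurable P"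
    and F_bound: "\<And>j z. j \<in> J \<Longrightarrow> z \<in> space P \<Longrightarrow> \<bar>F j z\<bar> \<le> \<beta>"
    and F_sparse: "\<And>z. z \<in> space P \<Longrightarrow> card {j \<in> J. F j z \<noteq> 0} \<le> q"
    and F_mean: "\<And>j. j \<in> J \<Longrightarrow> expectation (F j) = 0"
    and F_cov: "\<And>v. expectation (\<lambda>z. (\<Sum>j\<in>J. v j * F j z)\<^sup>2) \<le> \<tau> * (\<Sum>j\<in>J. (v j)\<^sup>2)"
    and \<beta>_pos: "0 < \<beta>" and \<tau>_pos: "0 < \<tau>" and q_pos: "0 < q"
begin

definition S :: "nat \<Rightarrow> (nat \<Rightarrow> 'z) \<Rightarrow> 'j \<Rightarrow> real"
  where "S m \<xi> j = (\<Sum>i<m. F j (\<xi> i))"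

definition Q :: "nat \<Rightarrow> (nat \<Rightarrow> 'z) \<Rightarrow> real"
  where "Q m \<xi> = (\<Sum>j\<in>J. (S m \<xi> j)\<^sup>2)"

definition G :: "'z \<Rightarrow> real"
  where "G z = (\<Sum>j\<in>J. (F j z)\<^sup>2)"

text \<open>The two truncations feed the two parts of Bernstein's inequality: by sparsity, the bound
  R on the coordinates bounds the increment, while the bound K on the squared norm bounds its
  conditional variance. \<open>S i\<close> involves the observations of index below i only, so the
  truncation is decided before observation i.\<close>

definition inc :: "real \<Rightarrow> real \<Rightarrow> nat \<Rightarrow> (nat \<Rightarrow> 'z) \<Rightarrow> 'z \<Rightarrow> real"
  where "inc R K i \<xi> z = (if (\<forall>j\<in>J. \<bar>S i \<xi> j\<bar> < R) \<and> Q i \<xi> \<le> K then \<Sum>j\<in>J. S i \<xi> j * F j z else 0)"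

lemma S_measurable[measurable]:
  assumes "m \<le> n" "j \<in> J"
  shows "(\<lambda>\<xi>. S m \<xi> j) \<in> borel_measurable (iid n P)"
proof -
  have "(\<lambda>\<xi>. F j (\<xi> i)) \<in> borel_measurable (iid n P)" if "i < m" for i
  proof -
    have [measurable]: "(\<lambda>\<xi>. \<xi> i) \<in> iid n P \<rightarrow>\<^sub>M P"
      using that assms by (intro measurable_component_singleton) auto
    show ?thesis using assms by measurable
  qed
  then show ?thesis unfolding S_def by (intro borel_measurable_sum) auto
qed

lemma Q_measurable[measurable]: "m \<le> n \<Longrightarrow> Q m \<in> borel_measurable (iid n P)"
  unfolding Q_def by (intro borel_measurable_sum borel_measurable_power S_measurable)

lemma G_measurable[measurable]: "G \<in> borel_measurable P"
  unfolding G_def by (intro borel_measurable_sum borel_measurable_power F_measurable)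

lemma sparse_sum_le:
  assumes z: "z \<in> space P" and v: "\<And>j. j \<in> J \<Longrightarrow> F j z = 0 \<Longrightarrow> u j = 0"
    "\<And>j. j \<in> J \<Longrightarrow> \<bar>u j\<bar> \<le> c" and c: "0 \<le> c"
  shows "\<bar>\<Sum>j\<in>J. u j\<bar> \<le> real q * c"
proof -
  have "(\<Sum>j\<in>J. u j) = (\<Sum>j\<in>{j\<in>J. F j z \<noteq> 0}. u j)"
    using v(1) finite_J by (intro sum.mono_neutral_right) auto
  also have "\<bar>\<dots>\<bar> \<le> (\<Sum>j\<in>{j\<in>J. F j z \<noteq> 0}. \<bar>u j\<bar>)" by (rule sum_abs)
  also have "\<dots> \<le> real (card {j\<in>J. F j z \<noteq> 0}) * c"
    by (intro sum_bounded_above v) auto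
  also have "\<dots> \<le> real q * c" using F_sparse[OF z] c by (intro mult_right_mono) auto
  finally show ?thesis .
qed

lemma G_bound:
  assumes "z \<in> space P"
  shows "\<bar>G z\<bar> \<le> real q * \<beta>\<^sup>2"
  unfolding G_def
proof (rule sparse_sum_le[OF assms])
  fix j assume "j \<in> J"
  from power_mono[OF F_bound[OF this assms], of 2] show "\<bar>(F j z)\<^sup>2\<bar> \<le> \<beta>\<^sup>2" by simp
qed auto

lemma F_integrable: "j \<in> J \<Longrightarrow> integrable P (F j)"
  by (rule integrable_const_bound[where B = \<beta>]) (auto intro: AE_I2 F_bound)

lemma F_second_moment:
  assumes "j \<in> J"
  shows "expectation (\<lambda>z. (F j z)\<^sup>2) \<le> \<tau>"
proof -
  have "(\<Sum>k\<in>J. (if k = j then 1 else 0) * F k z) = F j z" for z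
    using finite_J assms by (simp add: if_distrib[of "\<lambda>x. x * _"] sum.delta cong: if_cong)
  moreover have "(\<Sum>k\<in>J. (if k = j then 1 else 0 :: real)\<^sup>2) = 1"
    using finite_J assms by (simp add: if_distrib[of "\<lambda>x. x\<^sup>2"] sum.delta cong: if_cong)
  ultimately show ?thesis using F_cov[of "\<lambda>k. if k = j then 1 else 0"] by simp
qed

lemma S_restrict: "i \<le> k \<Longrightarrow> S i (restrict \<xi> {..<k}) j = S i \<xi> j"
  by (auto simp: S_def intro!: sum.cong)

lemma inc_restrict: "inc R K i (restrict \<xi> {..<i}) z = inc R K i \<xi> z"
  by (simp add: inc_def Q_def S_restrict)

text \<open>Every intermediate sum has to be controlled, not just the last one, because the
  truncation in \<open>inc\<close> must be inactive at each step. This is why the union bound runs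
  over \<open>J \<times> {..n}\<close>.\<close>

lemma S_bounded:
  assumes "0 < x" "0 < n"
  defines "R \<equiv> 2 * sqrt (real n * \<tau> * x) + 2 * \<beta> * x"
  shows "\<exists>Bad\<in>sets (iid n P). measure (iid n P) Bad \<le> real (card J) * (real n + 1) * (2 * exp (- x)) \<and>
    (\<forall>\<xi>\<in>space (iid n P) - Bad. \<forall>j\<in>J. \<forall>m\<le>n. \<bar>S m \<xi> j\<bar> < R)"
proof -
  interpret PP: prob_space "iid n P" by (intro prob_space_PiM prob_space_axioms)
  have 1: "{\<xi> \<in> space (iid n P). \<bar>S (snd a) \<xi> (fst a)\<bar> \<ge> R} \<in> sets (iid n P)"
    if "a \<in> J \<times> {..n}" for a
  proof -
    have [measurable]: "(\<lambda>\<xi>. S (snd a) \<xi> (fst a)) \<in> borel_measurable (iid n P)"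
      using that by (intro S_measurable) auto
    show ?thesis by measurable
  qed
  have 2: "\<P>(\<xi> in iid n P. \<bar>S (snd a) \<xi> (fst a)\<bar> \<ge> R) \<le> 2 * exp (- x)"
    if "a \<in> J \<times> {..n}" for a
    using bernstein_abs[OF prob_space_axioms, of "F (fst a)" \<beta> \<tau> x n "snd a"] that
      F_mean F_bound F_second_moment assms \<beta>_pos \<tau>_pos
    by (auto simp: S_def R_def)
  have "finite (J \<times> {..n})" using finite_J by simp
  from PP.union_bound[of _ "\<lambda>a \<xi>. \<bar>S (snd a) \<xi> (fst a)\<bar> \<ge> R", OF this 1 2]
  obtain Bad where "Bad \<in> PP.events" "PP.prob Bad \<le> real (card (J \<times> {..n})) * (2 * exp (- x))"
    and good: "\<And>\<xi> a. \<xi> \<in> space (iid n P) - Bad \<Longrightarrow> a \<in> J \<times> {..n} \<Longrightarrow> \<not> \<bar>S (snd a) \<xi> (fst a)\<bar> \<ge> R"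
    by blast
  moreover have "\<bar>S m \<xi> j\<bar> < R" if "\<xi> \<in> space (iid n P) - Bad" "j \<in> J" "m \<le> n" for \<xi> j m
    using good[OF that(1), of "(j, m)"] that by simp
  ultimately show ?thesis
    by (intro bexI[of _ Bad]) (simp_all add: card_cartesian_product algebra_simps)
qed

lemma inc_measurable:
  "(\<lambda>(\<xi>, z). inc R K i \<xi> z) \<in> borel_measurable (iid i P \<Otimes>\<^sub>M P)"
proof -
  have [measurable]: "(\<lambda>p. S i (fst p) j) \<in> borel_measurable (iid i P \<Otimes>\<^sub>M P)"
    if "j \<in> J" for j
    using that by (intro measurable_compose[OF measurable_fst S_measurable]) auto
  have [measurable]: "(\<lambda>p. F j (snd p)) \<in> borel_measurable (iid i P \<Otimes>\<^sub>M P)"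
    if "j \<in> J" for j
    using that by (intro measurable_compose[OF measurable_snd F_measurable]) auto
  have [measurable]: "(\<lambda>p. Q i (fst p)) \<in> borel_measurable (iid i P \<Otimes>\<^sub>M P)"
    by (intro measurable_compose[OF measurable_fst Q_measurable]) auto
  have [measurable]: "(\<lambda>p. \<Sum>j\<in>J. S i (fst p) j * F j (snd p)) \<in> borel_measurable (iid i P \<Otimes>\<^sub>M P)"
    by (intro borel_measurable_sum) measurable
  have [measurable]: "Measurable.pred (iid i P \<Otimes>\<^sub>M P) (\<lambda>p. \<forall>j\<in>J. \<bar>S i (fst p) j\<bar> < R)"
    using finite_J by measurable
  show ?thesis unfolding inc_def case_prod_beta by measurable
qed

text \<open>Given the past, \<open>S i \<xi>\<close> is a fixed vector v, and \<open>inc\<close> is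
  either 0 or the scalar product of v with \<open>F\<close>. The mean is then 0 by
  \<open>F_mean\<close>, and \<open>F_cov\<close> applied to v bounds the second moment by
  \<open>\<tau> * Q i \<xi>\<close>, hence by \<open>\<tau> * K\<close>.\<close>

lemma inc_sums_bounded:
  assumes "0 < x" "0 < n" "0 < R" "0 < K"
  defines "T \<equiv> 2 * sqrt (real n * (\<tau> * K) * x) + (real q * (R * \<beta>)) * x"
  shows "\<exists>Bad\<in>sets (iid n P). measure (iid n P) Bad \<le> (real n + 1) * (2 * exp (- x)) \<and>
    (\<forall>\<xi>\<in>space (iid n P) - Bad. \<forall>m\<le>n. \<bar>\<Sum>i<m. inc R K i \<xi> (\<xi> i)\<bar> < T)"
proof -
  interpret PP: prob_space "iid n P" by (intro prob_space_PiM prob_space_axioms)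
  interpret inc: martingale_increments P "inc R K" "real q * (R * \<beta>)" "\<tau> * K"
  proof (unfold_locales, fact inc_measurable)
    fix i \<xi> z
    show "\<bar>inc R K i \<xi> z\<bar> \<le> real q * (R * \<beta>)" if z: "z \<in> space P"
    proof (cases "(\<forall>j\<in>J. \<bar>S i \<xi> j\<bar> < R) \<and> Q i \<xi> \<le> K")
      case True
      have "\<bar>\<Sum>j\<in>J. S i \<xi> j * F j z\<bar> \<le> real q * (R * \<beta>)"
      proof (rule sparse_sum_le[OF z])
        fix j assume j: "j \<in> J"
        show "\<bar>S i \<xi> j * F j z\<bar> \<le> R * \<beta>"
          unfolding abs_mult using True j F_bound[OF j z] assms by (intro mult_mono) (auto intro: less_imp_le)
      qed (use \<beta>_pos assms in auto)
      then show ?thesis using True by (simp add: inc_def)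
    next
      case False
      then have "inc R K i \<xi> z = 0" unfolding inc_def by (simp only: if_False)
      then show ?thesis using \<beta>_pos assms by simp
    qed
    show "(LINT z|P. inc R K i \<xi> z) = 0"
      using F_integrable F_mean
      by (cases "(\<forall>j\<in>J. \<bar>S i \<xi> j\<bar> < R) \<and> Q i \<xi> \<le> K") (simp_all only: inc_def if_True if_False, simp_all)
    show "(LINT z|P. (inc R K i \<xi> z)\<^sup>2) \<le> \<tau> * K"
    proof (cases "(\<forall>j\<in>J. \<bar>S i \<xi> j\<bar> < R) \<and> Q i \<xi> \<le> K")
      case True
      have "expectation (\<lambda>z. (\<Sum>j\<in>J. S i \<xi> j * F j z)\<^sup>2) \<le> \<tau> * Q i \<xi>"
        unfolding Q_def by (rule F_cov)
      also have "\<dots> \<le> \<tau> * K" using True \<tau>_pos by (intro mult_left_mono) auto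
      finally show ?thesis using True by (simp add: inc_def)
    next
      case False
      then have "inc R K i \<xi> z = 0" for z unfolding inc_def by (simp only: if_False)
      then show ?thesis using \<tau>_pos assms by simp
    qed
  qed
  have 1: "{\<xi> \<in> space (iid n P). \<bar>\<Sum>i<m. inc R K i \<xi> (\<xi> i)\<bar> \<ge> T} \<in> sets (iid n P)"
    if "m \<in> {..n}" for m
    using inc.partial_sum_measurable[of m n] that by (simp add: inc_restrict)
  have 2: "\<P>(\<xi> in iid n P. \<bar>\<Sum>i<m. inc R K i \<xi> (\<xi> i)\<bar> \<ge> T) \<le> 2 * exp (- x)" if "m \<in> {..n}" for m
    using inc.martingale_bernstein_abs[of x n m] that assms \<beta>_pos \<tau>_pos q_pos by (simp add: inc_restrict T_def)
  from PP.union_bound[of "{..n}" "\<lambda>m \<xi>. \<bar>\<Sum>i<m. inc R K i \<xi> (\<xi> i)\<bar> \<ge> T", OF finite_atMost 1 2]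
  show ?thesis by (simp add: add.commute not_le Ball_def)
qed

lemma Q_Suc: "Q (Suc m) \<xi> = Q m \<xi> + 2 * (\<Sum>j\<in>J. S m \<xi> j * F j (\<xi> m)) + G (\<xi> m)"
proof -
  have "Q (Suc m) \<xi> = (\<Sum>j\<in>J. (S m \<xi> j)\<^sup>2 + 2 * (S m \<xi> j * F j (\<xi> m)) + (F j (\<xi> m))\<^sup>2)"
    unfolding Q_def by (intro sum.cong) (auto simp: S_def power2_eq_square algebra_simps)
  then show ?thesis by (simp add: Q_def G_def sum.distrib sum_distrib_left)
qed

text \<open>Bootstrapping: while the truncation is inactive the partial sums of the truncated martingale
  control \<open>Q\<close>, and this control keeps the truncation inactive at the next step.\<close>

lemma Q_eq_diagonal_plus_martingale:
  assumes \<xi>: "\<And>i. i < n \<Longrightarrow> \<xi> i \<in> space P"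
    and SR: "\<And>j m. j \<in> J \<Longrightarrow> m \<le> n \<Longrightarrow> \<bar>S m \<xi> j\<bar> < R"
    and incT: "\<And>m. m \<le> n \<Longrightarrow> \<bar>\<Sum>i<m. inc R K i \<xi> (\<xi> i)\<bar> < T"
    and K: "real n * (real q * \<beta>\<^sup>2) + 2 * T \<le> K" and "m \<le> n"
  shows "Q m \<xi> = (\<Sum>i<m. G (\<xi> i)) + 2 * (\<Sum>i<m. inc R K i \<xi> (\<xi> i)) \<and> Q m \<xi> \<le> K"
  using \<open>m \<le> n\<close>
proof (induction m)
  case 0
  \<comment> \<open>At m = 0 the sum is empty, so the hypothesis on the partial sums yields the sign
    of T.\<close>
  have "0 < T" using incT[of 0] by simp
  moreover have "0 \<le> real n * (real q * \<beta>\<^sup>2)" by simp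
  ultimately have "0 \<le> K" using K by linarith
  then show ?case by (simp add: Q_def S_def)
next
  case (Suc m)
  then have IH: "Q m \<xi> = (\<Sum>i<m. G (\<xi> i)) + 2 * (\<Sum>i<m. inc R K i \<xi> (\<xi> i))" "Q m \<xi> \<le> K" by auto
  have "inc R K m \<xi> (\<xi> m) = (\<Sum>j\<in>J. S m \<xi> j * F j (\<xi> m))"
    using IH(2) SR[of _ m] Suc.prems by (simp add: inc_def)
  then have eq: "Q (Suc m) \<xi> = (\<Sum>i<Suc m. G (\<xi> i)) + 2 * (\<Sum>i<Suc m. inc R K i \<xi> (\<xi> i))"
    using IH(1) by (simp add: Q_Suc)
  \<comment> \<open>For the induction the diagonal needs only its deterministic bound, valid at
    every time; its fluctuation matters at time n alone.\<close>
  have "(\<Sum>i<Suc m. G (\<xi> i)) \<le> (\<Sum>i<Suc m. real q * \<beta>\<^sup>2)"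
    using abs_le_D1[OF G_bound[OF \<xi>]] Suc.prems by (intro sum_mono) auto
  also have "\<dots> = real (Suc m) * (real q * \<beta>\<^sup>2)" by simp
  also have "\<dots> \<le> real n * (real q * \<beta>\<^sup>2)" using Suc.prems by (intro mult_right_mono) auto
  finally have "Q (Suc m) \<xi> \<le> K" using eq incT[of "Suc m"] Suc.prems K by linarith
  with eq show ?case by simp
qed

text \<open>T depends on K, so the hypothesis on K is a self-consistency condition. It can be met
  because T grows only like the square root of K; \<open>deviation_terms_le\<close> exhibits a
  solution.\<close>

theorem Q_concentration:
  fixes K :: real
  assumes x: "0 < x" and n: "0 < n"
  defines "R \<equiv> 2 * sqrt (real n * \<tau> * x) + 2 * \<beta> * x"
  defines "T \<equiv> 2 * sqrt (real n * (\<tau> * K) * x) + (real q * (R * \<beta>)) * x"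
  defines "U \<equiv> 2 * sqrt (real n * (real q * \<beta>\<^sup>2)\<^sup>2 * x) + 2 * (real q * \<beta>\<^sup>2) * x"
  assumes K: "real n * (real q * \<beta>\<^sup>2) + 2 * T \<le> K" "0 < K"
  obtains B where "B \<in> sets (iid n P)"
    "measure (iid n P) B \<le> (real (card J) * (real n + 1) + (real n + 1) + 1) * (2 * exp (- x))"
    "\<And>\<xi>. \<xi> \<in> space (iid n P) - B \<Longrightarrow> Q n \<xi> \<le> K"
    "\<And>\<xi>. \<xi> \<in> space (iid n P) - B \<Longrightarrow> \<bar>Q n \<xi> - real n * expectation G\<bar> \<le> 2 * T + U"
proof -
  interpret PP: prob_space "iid n P" by (intro prob_space_PiM prob_space_axioms)
  have R: "0 < R" unfolding R_def using x n \<beta>_pos \<tau>_pos by (intro add_pos_pos mult_pos_pos) auto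
  obtain B1 where B1: "B1 \<in> PP.events" "PP.prob B1 \<le> real (card J) * (real n + 1) * (2 * exp (- x))"
    and S: "\<And>\<xi> j m. \<xi> \<in> space (iid n P) - B1 \<Longrightarrow> j \<in> J \<Longrightarrow> m \<le> n \<Longrightarrow> \<bar>S m \<xi> j\<bar> < R"
    using S_bounded[OF x n, folded R_def] by blast
  obtain B2 where B2: "B2 \<in> PP.events" "PP.prob B2 \<le> (real n + 1) * (2 * exp (- x))"
    and inc: "\<And>\<xi> m. \<xi> \<in> space (iid n P) - B2 \<Longrightarrow> m \<le> n \<Longrightarrow> \<bar>\<Sum>i<m. inc R K i \<xi> (\<xi> i)\<bar> < T"
    using inc_sums_bounded[OF x n R K(2), folded T_def] by blast
  define B3 where "B3 = {\<xi> \<in> space (iid n P). \<bar>(\<Sum>i<n. G (\<xi> i)) - real n * expectation G\<bar> \<ge> U}"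
  have B3m: "B3 \<in> PP.events"
  proof -
    have [measurable]: "(\<lambda>\<xi>. \<Sum>i<n. G (\<xi> i)) \<in> borel_measurable (iid n P)"
      by (intro borel_measurable_sum measurable_compose[OF _ G_measurable] measurable_component_singleton) auto
    show ?thesis unfolding B3_def by measurable
  qed
  \<comment> \<open>The squared sup bound of \<open>G\<close> serves as second moment. This is
    crude, but the diagonal then still costs only a relative error of order sqrt (x / n).\<close>
  have G2: "expectation (\<lambda>z. (G z)\<^sup>2) \<le> (real q * \<beta>\<^sup>2)\<^sup>2"
  proof (rule integral_le_const)
    show "AE z in P. (G z)\<^sup>2 \<le> (real q * \<beta>\<^sup>2)\<^sup>2"
      using power_mono[OF G_bound, of _ 2] by (intro AE_I2) simp
    show "integrable P (\<lambda>z. (G z)\<^sup>2)"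
      by (rule bounded_square_integrable[OF G_measurable AE_I2[OF G_bound]])
  qed
  have B3: "PP.prob B3 \<le> 2 * exp (- x)"
    unfolding B3_def U_def
    by (rule bernstein_abs[OF prob_space_axioms G_measurable G_bound G2]) (use x n q_pos \<beta>_pos in auto)
  define B where "B = B1 \<union> B2 \<union> B3"
  have "PP.prob B \<le> PP.prob B1 + PP.prob B2 + PP.prob B3"
    unfolding B_def using B1 B2 B3m
    by (intro order_trans[OF measure_Un_le] add_mono measure_Un_le order_refl) auto
  also have "\<dots> \<le> (real (card J) * (real n + 1) + (real n + 1) + 1) * (2 * exp (- x))"
    using B1(2) B2(2) B3 by (simp add: distrib_right)
  finally have prob: "PP.prob B \<le> (real (card J) * (real n + 1) + (real n + 1) + 1) * (2 * exp (- x))" .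
  have main: "Q n \<xi> \<le> K \<and> \<bar>Q n \<xi> - real n * expectation G\<bar> \<le> 2 * T + U"
    if \<xi>: "\<xi> \<in> space (iid n P) - B" for \<xi>
  proof -
    have "\<xi> i \<in> space P" if "i < n" for i using \<xi> that by (auto simp: space_PiM PiE_def)
    moreover have "\<bar>S m \<xi> j\<bar> < R" if "j \<in> J" "m \<le> n" for j m
      using S \<xi> that by (auto simp: B_def)
    moreover have T: "\<bar>\<Sum>i<m. inc R K i \<xi> (\<xi> i)\<bar> < T" if "m \<le> n" for m
      using inc \<xi> that by (auto simp: B_def)
    ultimately have "Q n \<xi> = (\<Sum>i<n. G (\<xi> i)) + 2 * (\<Sum>i<n. inc R K i \<xi> (\<xi> i)) \<and> Q n \<xi> \<le> K"
      using K by (intro Q_eq_diagonal_plus_martingale[of n \<xi> R K T]) auto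
    moreover have "\<bar>(\<Sum>i<n. G (\<xi> i)) - real n * expectation G\<bar> < U"
      using \<xi> by (auto simp: B_def B3_def)
    ultimately show ?thesis using T[of n] by auto
  qed
  show thesis
    by (rule that[of B]) (use prob main B1 B2 B3m in \<open>auto simp: B_def\<close>)
qed

end

section \<open>Orthonormal polynomials and sup-norm bounds\<close>

text \<open>The inner product is abstract because two kinds are used: Lebesgue measure on the unit
  interval for the sup-norm inequality, and the law of X restricted to a cell for the basis.\<close>

lemma gram_schmidt_poly:
  fixes ip :: "real poly \<Rightarrow> real poly \<Rightarrow> real"
  assumes sym: "\<And>p q. ip p q = ip q p"
    and add: "\<And>p q s. ip (p + q) s = ip p s + ip q s"
    and scale: "\<And>c p q. ip (smult c p) q = c * ip p q"
    and pos: "\<And>p. p \<noteq> 0 \<Longrightarrow> ip p p > 0"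
  shows "\<exists>e. (\<forall>k\<le>r. degree (e k) \<le> r) \<and>
    (\<forall>j\<le>r. \<forall>k\<le>r. ip (e j) (e k) = (if j = k then 1 else 0)) \<and>
    (\<forall>p. degree p \<le> r \<longrightarrow> (\<exists>c. p = (\<Sum>k\<le>r. smult (c k) (e k))))"
proof (induction r)
  have scale2: "ip (smult a p) (smult b q) = a * (b * ip p q)" for a b p q
    using scale[of a p "smult b q"] scale[of b q p] sym[of p q] sym[of p "smult b q"] by simp
  case 0
  define d where "d = sqrt (ip 1 1)"
  have d: "d > 0" "d * d = ip 1 1" "ip 1 1 \<noteq> 0" using pos[of 1] by (auto simp: d_def)
  have "ip (smult (1 / d) 1) (smult (1 / d) 1) = 1"
    using d scale2[of "1 / d" 1 "1 / d" 1] by (simp add: field_simps)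
  moreover have "\<exists>c :: nat \<Rightarrow> real. p = (\<Sum>k\<le>0. smult (c k) (smult (1 / d) 1))" if "degree p \<le> 0" for p
  proof -
    from that obtain a where "p = [:a:]" by (auto elim: degree_eq_zeroE)
    then show ?thesis using d by (intro exI[of _ "\<lambda>_. a * d"]) simp
  qed
  ultimately show ?case by (intro exI[of _ "\<lambda>_. smult (1 / d) 1"]) auto
next
  have scale2: "ip (smult a p) (smult b q) = a * (b * ip p q)" for a b p q
    using scale[of a p "smult b q"] scale[of b q p] sym[of p q] sym[of p "smult b q"] by simp
  case (Suc r)
  then obtain e where deg: "\<And>k. k \<le> r \<Longrightarrow> degree (e k) \<le> r"
    and on: "\<And>j k. j \<le> r \<Longrightarrow> k \<le> r \<Longrightarrow> ip (e j) (e k) = (if j = k then 1 else 0)"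
    and span: "\<And>p. degree p \<le> r \<Longrightarrow> \<exists>c. p = (\<Sum>k\<le>r. smult (c k) (e k))"
    by blast
  have sum: "ip (\<Sum>k\<in>A. g k) s = (\<Sum>k\<in>A. ip (g k) s)" if "finite A" for A :: "nat set" and g s
    using that
  proof induction
    case empty
    show ?case using scale[of 0 0 s] by simp
  qed (simp add: add)
  define m where "m = (monom 1 (Suc r) :: real poly)"
  define s where "s = (\<Sum>k\<le>r. smult (- ip m (e k)) (e k))"
  define u where "u = m + s"
  have degs: "degree s \<le> r" unfolding s_def
    by (intro degree_sum_le) (auto intro: order_trans[OF degree_smult_le] deg)
  have cs: "coeff s (Suc r) = 0" using degs by (intro coeff_eq_0) simp
  \<comment> \<open>Subtracting the projection onto lower degrees leaves u monic. Hence u is not 0,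
    and subtracting a multiple of u from a polynomial of degree at most r + 1 lowers the
    degree.\<close>
  have cu: "coeff u (Suc r) = 1" by (simp add: u_def m_def cs)
  have degu: "degree u \<le> Suc r"
    unfolding u_def m_def using degs by (intro degree_add_le) (auto simp: degree_monom_eq)
  have orth: "ip u (e j) = 0" if "j \<le> r" for j
  proof -
    have "ip u (e j) = ip m (e j) + (\<Sum>k\<le>r. - ip m (e k) * ip (e k) (e j))"
      unfolding u_def s_def by (simp add: add sum scale del: smult_minus_left)
    also have "(\<Sum>k\<le>r. - ip m (e k) * ip (e k) (e j)) = (\<Sum>k\<le>r. if k = j then - ip m (e k) else 0)"
      using that by (intro sum.cong) (auto simp: on)
    finally show ?thesis using that by (simp add: sum.delta)
  qed
  define d where "d = sqrt (ip u u)"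
  have "u \<noteq> 0" using cu by auto
  then have d: "d > 0" "d * d = ip u u" "ip u u \<noteq> 0" using pos[of u] by (auto simp: d_def)
  define e' where "e' = e(Suc r := smult (1 / d) u)"
  have "degree (e' k) \<le> Suc r" if "k \<le> Suc r" for k
    using that deg[of k] degu by (auto simp: e'_def le_Suc_eq)
  moreover have "ip (e' j) (e' k) = (if j = k then 1 else 0)" if "j \<le> Suc r" "k \<le> Suc r" for j k
  proof -
    have "ip (smult (1 / d) u) (smult (1 / d) u) = 1"
      using d by (simp add: scale2 field_simps)
    then show ?thesis
      using that on orth sym[of "e j" u] sym[of "e j" "smult (1 / d) u"]
      by (auto simp: e'_def le_Suc_eq scale)
  qed
  moreover have "\<exists>c. p = (\<Sum>k\<le>Suc r. smult (c k) (e' k))" if p: "degree p \<le> Suc r" for p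
  proof -
    define p' where "p' = p - smult (coeff p (Suc r)) u"
    have "degree p' \<le> Suc r" unfolding p'_def
      using p degu by (intro degree_diff_le) (auto intro: order_trans[OF degree_smult_le])
    moreover have "coeff p' (Suc r) = 0" by (simp add: p'_def cu)
    ultimately have "degree p' \<le> r"
      by (metis le_Suc_eq leading_coeff_0_iff degree_0 le0)
    then obtain c where c: "p' = (\<Sum>k\<le>r. smult (c k) (e k))" using span by blast
    have "p = p' + smult (coeff p (Suc r) * d) (smult (1 / d) u)"
      using d by (simp add: p'_def)
    also have "\<dots> = (\<Sum>k\<le>Suc r. smult ((c(Suc r := coeff p (Suc r) * d)) k) (e' k))"
      by (simp add: c e'_def)
    finally show ?thesis by blast
  qed
  ultimately show ?case by blast
qed

section \<open>Lebesgue measure on the unit interval, and polynomials on its subintervals\<close>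

lemma space_leb01[simp]: "space leb01 = {0..1}"
  by (simp add: leb01_def space_restrict_space)

lemma measurable_leb01: "f \<in> borel_measurable borel \<Longrightarrow> f \<in> borel_measurable leb01"
  unfolding leb01_def by (intro measurable_restrict_space1) simp

lemma integral_leb01: "(LINT x|leb01. f x) = (LINT x|lborel. indicator {0..1} x * (f x :: real))"
  unfolding leb01_def by (subst integral_restrict_space) auto

lemma measure_leb01: "A \<subseteq> {0..1} \<Longrightarrow> measure leb01 A = measure lborel A"
  unfolding leb01_def by (intro measure_restrict_space) auto

interpretation leb01: prob_space leb01
  by (rule prob_spaceI) (simp add: leb01_def space_restrict_space emeasure_restrict_space)

text \<open>A cell may be open, closed or half open. Up to its end points it is [a, b], which
  suffices for integrals, and positive length excludes singletons.\<close>

lemma interval_between: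
  fixes I :: "real set"
  assumes I: "is_interval I" "I \<subseteq> {0..1}" and pos: "measure leb01 I > 0"
  obtains a b where "0 \<le> a" "a < b" "b \<le> 1" "{a<..<b} \<subseteq> I" "I \<subseteq> {a..b}" "measure leb01 I = b - a"
proof -
  have ne: "I \<noteq> {}" using pos by auto
  have bd: "bdd_below I" "bdd_above I" using I(2) by (auto intro: bdd_below_mono bdd_above_mono)
  define a b where "a = Inf I" and "b = Sup I"
  have ab: "0 \<le> a" "b \<le> 1" unfolding a_def b_def using I(2) ne
    by (auto intro!: cInf_greatest cSup_least)
  have sub: "I \<subseteq> {a..b}" unfolding a_def b_def using bd by (auto intro: cInf_lower cSup_upper)
  have sup: "{a<..<b} \<subseteq> I"
  proof
    fix x assume "x \<in> {a<..<b}"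
    then obtain y z where "y \<in> I" "y < x" "z \<in> I" "x < z"
      unfolding a_def b_def using cInf_lessD[OF ne, of x] less_cSupD[OF ne, of x] by auto
    then show "x \<in> I" using I(1) unfolding is_interval_1 by (meson less_imp_le)
  qed
  have borel: "I \<in> sets borel" using I(1) by (rule real_interval_borel_measurable)
  have "a \<le> b" using ne sub by force
  have fin: "emeasure lborel {a..b} \<noteq> \<infinity>" using \<open>a \<le> b\<close> by simp
  have "measure lborel I \<le> measure lborel {a..b}"
    using sub borel fin by (intro measure_mono_fmeasurable) (auto simp: fmeasurable_def top.not_eq_extremum)
  moreover have "measure lborel {a<..<b} \<le> measure lborel I"
  proof (rule measure_mono_fmeasurable[OF sup])
    show "I \<in> fmeasurable lborel"
      using borel sub fin emeasure_mono[OF sub, of lborel] by (auto simp: fmeasurable_def top.not_eq_extremum)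
  qed auto
  ultimately have m: "measure leb01 I = b - a"
    using \<open>a \<le> b\<close> I(2) by (simp add: measure_leb01)
  then show thesis using that[of a b] ab sub sup pos by simp
qed

lemma integral_indicator_between:
  fixes f :: "real \<Rightarrow> real"
  assumes "0 \<le> a" "a < b" "b \<le> 1" and sup: "{a<..<b} \<subseteq> I" and sub: "I \<subseteq> {a..b}"
    and f: "f \<in> borel_measurable borel" and I: "I \<in> sets borel"
  shows "(LINT x|leb01. indicator I x * f x) = (LINT x|lborel. indicator {a..b} x * f x)"
  unfolding integral_leb01
proof (rule integral_cong_AE)
  have "AE x in lborel. x \<noteq> a" "AE x in lborel. x \<noteq> b" by (auto intro: AE_lborel_singleton)
  then show "AE x in lborel. indicator {0..1} x * (indicator I x * f x) = indicator {a..b} x * f x"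
  proof eventually_elim
    case (elim x)
    have "x \<in> I \<longleftrightarrow> x \<in> {a..b}"
      using elim subsetD[OF sup, of x] subsetD[OF sub, of x] by auto
    then show ?case using assms by (auto split: split_indicator)
  qed
qed (use f I in measurable)

lemma poly_measurable: "poly (p :: real poly) \<in> borel_measurable borel"
  by (intro borel_measurable_continuous_onI continuous_intros)

lemma poly_bounded_on_unit:
  obtains C where "\<And>x. x \<in> {0..1} \<Longrightarrow> \<bar>poly (p :: real poly) x\<bar> \<le> C"
proof -
  have "compact (poly p ` {0..1})"
    by (intro compact_continuous_image continuous_intros) auto
  then have "bounded (poly p ` {0..1})" by (rule compact_imp_bounded)
  then obtain C where "\<forall>y\<in>poly p ` {0..1}. norm y \<le> C" by (auto simp: bounded_iff)
  then show thesis using that[of C] by auto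
qed

lemma poly_integrable_leb01:
  assumes "I \<in> sets borel"
  shows "integrable leb01 (\<lambda>x. indicator I x * poly (p :: real poly) x)"
proof -
  obtain C where C: "\<And>x. x \<in> {0..1} \<Longrightarrow> \<bar>poly p x\<bar> \<le> C" using poly_bounded_on_unit[of p] by blast
  show ?thesis
  proof (rule leb01.integrable_const_bound[where B = C])
    show "AE x in leb01. norm (indicator I x * poly p x) \<le> C"
      using C order_trans[OF abs_ge_zero C] by (intro AE_I2) (auto split: split_indicator)
    show "(\<lambda>x. indicator I x * poly p x) \<in> borel_measurable leb01"
      using assms
      by (intro measurable_leb01 borel_measurable_times borel_measurable_indicator poly_measurable) auto
  qed
qed

text \<open>A nonzero polynomial has finitely many roots, so it cannot vanish almost everywhere on
  an interval of positive length.\<close>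

lemma integral_poly_square_pos:
  fixes p :: "real poly"
  assumes "p \<noteq> 0" "a < b"
  shows "0 < (LINT x|lborel. indicator {a..b} x * (poly p x)\<^sup>2)"
proof -
  have int: "integrable lborel (\<lambda>x. (poly p x)\<^sup>2 * indicator {a..b} x)"
    by (rule borel_integrable_atLeastAtMost) (auto intro!: continuous_intros)
  have "(LINT x|lborel. (poly p x)\<^sup>2 * indicator {a..b} x) \<noteq> 0"
  proof
    assume "(LINT x|lborel. (poly p x)\<^sup>2 * indicator {a..b} x) = 0"
    then have "AE x in lborel. (poly p x)\<^sup>2 * indicator {a..b} x = 0"
      using integral_nonneg_eq_0_iff_AE[OF int] by auto
    moreover have "AE x in lborel. x \<notin> {x. poly p x = 0}"
      using poly_roots_finite[OF assms(1)] by (intro AE_not_in finite_imp_null_set_lborel)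
    ultimately have "AE x in lborel. x \<notin> {a..b}"
      by eventually_elim (auto split: split_indicator_asm)
    then have "emeasure lborel {a..b} = 0" by (subst (asm) AE_iff_measurable[of "{a..b}"]) auto
    then show False using assms(2) by simp
  qed
  moreover have "0 \<le> (LINT x|lborel. (poly p x)\<^sup>2 * indicator {a..b} x)"
    by (intro Bochner_Integration.integral_nonneg) auto
  ultimately have "0 < (LINT x|lborel. (poly p x)\<^sup>2 * indicator {a..b} x)" by linarith
  then show ?thesis by (simp add: mult.commute)
qed

lemma integral_orthonormal_square:
  fixes b :: "'j \<Rightarrow> 'a \<Rightarrow> real"
  assumes "\<And>j k. j \<in> J \<Longrightarrow> k \<in> J \<Longrightarrow> integrable M (\<lambda>x. b j x * b k x)"
    and "finite J" and "\<And>j k. j \<in> J \<Longrightarrow> k \<in> J \<Longrightarrow> (LINT x|M. b j x * b k x) = (if j = k then 1 else 0)"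
  shows "integrable M (\<lambda>x. (\<Sum>j\<in>J. v j * b j x)\<^sup>2)"
    and "(LINT x|M. (\<Sum>j\<in>J. v j * b j x)\<^sup>2) = (\<Sum>j\<in>J. (v j)\<^sup>2)"
proof -
  have eq: "(\<Sum>j\<in>J. v j * b j x)\<^sup>2 = (\<Sum>j\<in>J. \<Sum>k\<in>J. v j * v k * (b j x * b k x))" for x
    unfolding power2_eq_square sum_product by (intro sum.cong refl) (simp add: algebra_simps)
  show "integrable M (\<lambda>x. (\<Sum>j\<in>J. v j * b j x)\<^sup>2)"
    unfolding eq using assms(1) by (intro Bochner_Integration.integrable_sum integrable_mult_right) auto
  have "(LINT x|M. (\<Sum>j\<in>J. v j * b j x)\<^sup>2) = (\<Sum>j\<in>J. \<Sum>k\<in>J. v j * v k * (LINT x|M. b j x * b k x))"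
    unfolding eq using assms(1) by (simp add: Bochner_Integration.integral_sum)
  also have "\<dots> = (\<Sum>j\<in>J. \<Sum>k\<in>J. if k = j then v j * v j else 0)"
    using assms(3) by (intro sum.cong refl) auto
  finally show "(LINT x|M. (\<Sum>j\<in>J. v j * b j x)\<^sup>2) = (\<Sum>j\<in>J. (v j)\<^sup>2)"
    using assms(2) by (simp add: power2_eq_square sum.delta)
qed

text \<open>In an orthonormal basis the value p(x) is the scalar product of the coefficient vector
  with the vector of basis values at x. Cauchy-Schwarz and Parseval's identity leave the sum of
  squared basis values, bounded on the unit interval.\<close>

lemma poly_sup_unit_interval:
  "\<exists>C>0. \<forall>p :: real poly. degree p \<le> r \<longrightarrow>
    (\<forall>x\<in>{0..1}. (poly p x)\<^sup>2 \<le> C * (LINT y|lborel. indicator {0..1} y * (poly p y)\<^sup>2))"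
proof -
  define ip where "ip p q = (LINT x|leb01. poly p x * poly q x)" for p q :: "real poly"
  have int: "integrable leb01 (\<lambda>x. poly p x * poly q x)" for p q :: "real poly"
    using poly_integrable_leb01[of UNIV "p * q"] by simp
  have "\<exists>e. (\<forall>k\<le>r. degree (e k) \<le> r) \<and>
    (\<forall>j\<le>r. \<forall>k\<le>r. ip (e j) (e k) = (if j = k then 1 else 0)) \<and>
    (\<forall>p. degree p \<le> r \<longrightarrow> (\<exists>c. p = (\<Sum>k\<le>r. smult (c k) (e k))))"
  proof (rule gram_schmidt_poly)
    show "ip p p > 0" if "p \<noteq> 0" for p
      using integral_poly_square_pos[OF that, of 0 1] by (simp add: ip_def integral_leb01 power2_eq_square)
  qed (auto simp: ip_def distrib_right mult.assoc int mult.commute[of "poly _ _" "poly _ _"])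
  then obtain e where on: "\<And>j k. j \<le> r \<Longrightarrow> k \<le> r \<Longrightarrow> ip (e j) (e k) = (if j = k then 1 else 0)"
    and span: "\<And>p. degree p \<le> r \<Longrightarrow> \<exists>c. p = (\<Sum>k\<le>r. smult (c k) (e k))" by blast
  have "\<forall>k. \<exists>C. \<forall>x\<in>{0..1}. \<bar>poly (e k) x\<bar> \<le> C"
    using poly_bounded_on_unit by meson
  then obtain C where C: "\<And>k x. x \<in> {0..1} \<Longrightarrow> \<bar>poly (e k) x\<bar> \<le> C k" by metis
  \<comment> \<open>The summand 1 only makes the constant positive.\<close>
  define C' where "C' = (\<Sum>k\<le>r. (C k)\<^sup>2) + 1"
  have C': "C' > 0" unfolding C'_def by (intro add_nonneg_pos sum_nonneg) auto
  have "(poly p x)\<^sup>2 \<le> C' * (LINT y|lborel. indicator {0..1} y * (poly p y)\<^sup>2)"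
    if p: "degree p \<le> r" and x: "x \<in> {0..1}" for p x
  proof -
    obtain c where c: "p = (\<Sum>k\<le>r. smult (c k) (e k))" using span[OF p] by blast
    have pc: "poly p y = (\<Sum>k\<le>r. c k * poly (e k) y)" for y by (simp add: c poly_sum)
    have "(\<Sum>k\<le>r. (c k)\<^sup>2) = (LINT y|leb01. (poly p y)\<^sup>2)"
      unfolding pc using on
      by (intro integral_orthonormal_square(2)[symmetric]) (auto simp: int ip_def)
    then have eq: "(\<Sum>k\<le>r. (c k)\<^sup>2) = (LINT y|lborel. indicator {0..1} y * (poly p y)\<^sup>2)"
      by (simp add: integral_leb01)
    have "(poly p x)\<^sup>2 \<le> (\<Sum>k\<le>r. (c k)\<^sup>2) * (\<Sum>k\<le>r. (poly (e k) x)\<^sup>2)"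
      unfolding pc by (rule Cauchy_Schwarz_ineq_sum)
    also have "\<dots> \<le> (\<Sum>k\<le>r. (c k)\<^sup>2) * C'"
    proof (rule mult_left_mono)
      have "(poly (e k) x)\<^sup>2 \<le> (C k)\<^sup>2" for k using power_mono[OF C[OF x, of k], of 2] by simp
      then have "(\<Sum>k\<le>r. (poly (e k) x)\<^sup>2) \<le> (\<Sum>k\<le>r. (C k)\<^sup>2)" by (intro sum_mono)
      then show "(\<Sum>k\<le>r. (poly (e k) x)\<^sup>2) \<le> C'" by (simp add: C'_def)
    qed (auto intro: sum_nonneg)
    finally show ?thesis by (simp add: eq mult.commute)
  qed
  then show ?thesis using C' by blast
qed

text \<open>Composition with the affine map from [0, 1] onto [a, b] preserves the degree bound. The
  change of variables produces the factor 1 / (b - a), so the constant depends on r alone.\<close>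

lemma poly_sup_interval:
  "\<exists>C>0. \<forall>(p :: real poly) a b x. degree p \<le> r \<longrightarrow> a < b \<longrightarrow> x \<in> {a..b} \<longrightarrow>
    (poly p x)\<^sup>2 \<le> C / (b - a) * (LINT y|lborel. indicator {a..b} y * (poly p y)\<^sup>2)"
proof -
  obtain C where "C > 0" and C: "\<And>(p :: real poly) x. degree p \<le> r \<Longrightarrow> x \<in> {0..1} \<Longrightarrow>
    (poly p x)\<^sup>2 \<le> C * (LINT y|lborel. indicator {0..1} y * (poly p y)\<^sup>2)"
    using poly_sup_unit_interval[of r] by blast
  have "(poly p x)\<^sup>2 \<le> C / (b - a) * (LINT y|lborel. indicator {a..b} y * (poly p y)\<^sup>2)"
    if deg: "degree p \<le> r" and ab: "a < b" and x: "x \<in> {a..b}" for p :: "real poly" and a b x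
  proof -
    define q where "q = pcompose p [:a, b - a:]"
    have q: "poly q u = poly p (a + (b - a) * u)" for u
      by (simp add: q_def poly_pcompose mult.commute)
    have degq: "degree q \<le> r" using deg ab by (simp add: q_def degree_pcompose)
    define u where "u = (x - a) / (b - a)"
    have u: "u \<in> {0..1}" "x = a + (b - a) * u" using x ab by (auto simp: u_def field_simps)
    have ind: "indicator {a..b} (a + (b - a) * y) = (indicator {0..1} y :: real)" for y
    proof -
      have "a + (b - a) * y \<in> {a..b} \<longleftrightarrow> (b - a) * 0 \<le> (b - a) * y \<and> (b - a) * y \<le> (b - a) * 1"
        by auto
      also have "\<dots> \<longleftrightarrow> y \<in> {0..1}" unfolding mult_le_cancel_left using ab by auto
      finally show ?thesis by (auto split: split_indicator)
    qed
    have "(LINT y|lborel. indicator {a..b} y * (poly p y)\<^sup>2)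
      = (b - a) * (LINT y|lborel. indicator {0..1} y * (poly q y)\<^sup>2)"
      using lborel_integral_real_affine[of "b - a" "\<lambda>y. indicator {a..b} y * (poly p y)\<^sup>2" a] ab
      by (simp add: ind q)
    then have "C / (b - a) * (LINT y|lborel. indicator {a..b} y * (poly p y)\<^sup>2)
      = C * (LINT y|lborel. indicator {0..1} y * (poly q y)\<^sup>2)"
      using ab by simp
    moreover have "(poly q u)\<^sup>2 \<le> C * (LINT y|lborel. indicator {0..1} y * (poly q y)\<^sup>2)"
      by (rule C[OF degq u(1)])
    ultimately show ?thesis by (simp add: q u(2))
  qed
  then show ?thesis using \<open>C > 0\<close> by blast
qed

section \<open>A basis adapted to the partition\<close>

text \<open>The index (I, k) stands for the k-th function of the cell I. It is supported in I, so
  distinct cells never interact, neither under the law of X nor in the empirical Gram matrix.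
  Localisation also allows \<open>B\<close> to be of the order of the square root of the number of
  cells.\<close>

locale block_basis =
  fixes PX :: "real measure" and \<I> :: "real set set" and r :: nat
    and b :: "real set \<times> nat \<Rightarrow> real \<Rightarrow> real" and B :: real
  assumes partition: "interval_partition \<I>"
    and PX: "prob_space PX" "sets PX = sets leb01"
    and b_measurable: "\<And>j. j \<in> \<I> \<times> {..r} \<Longrightarrow> b j \<in> borel_measurable borel"
    and b_support: "\<And>I k x. x \<notin> I \<Longrightarrow> b (I, k) x = 0"
    and b_model: "\<And>j. j \<in> \<I> \<times> {..r} \<Longrightarrow> b j \<in> piecewise_poly \<I> r"
    and b_orthonormal: "\<And>j k. j \<in> \<I> \<times> {..r} \<Longrightarrow> k \<in> \<I> \<times> {..r} \<Longrightarrow>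
      (LINT x|PX. b j x * b k x) = (if j = k then 1 else 0)"
    and b_bound: "\<And>j x. j \<in> \<I> \<times> {..r} \<Longrightarrow> \<bar>b j x\<bar> \<le> B"
    and b_span: "\<And>s. s \<in> piecewise_poly \<I> r \<Longrightarrow> \<exists>c. \<forall>x. s x = (\<Sum>j\<in>\<I> \<times> {..r}. c j * b j x)"

section \<open>Consequences of the bounds on the density and on the cell lengths\<close>

lemma integral_bounded_density_ge:
  assumes bd: "bounded_density PX c_min c_max" and c: "0 < c_min"
    and g: "g \<in> borel_measurable borel" "\<And>x. x \<in> {0..1} \<Longrightarrow> 0 \<le> g x" "\<And>x. x \<in> {0..1} \<Longrightarrow> g x \<le> C"
  shows "c_min * (LINT x|leb01. g x) \<le> (LINT x|PX. g x)"
proof -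
  obtain f where f[measurable]: "f \<in> borel_measurable leb01" and PX: "PX = density leb01 (\<lambda>x. ennreal (f x))"
    and fb: "\<And>x. x \<in> {0..1} \<Longrightarrow> c_min \<le> f x" "\<And>x. x \<in> {0..1} \<Longrightarrow> f x \<le> c_max"
    using bd unfolding bounded_density_def by blast
  have gm[measurable]: "g \<in> borel_measurable leb01" by (rule measurable_leb01[OF g(1)])
  have C: "0 \<le> C" using g(2,3)[of 0] by simp
  have "integrable leb01 g"
    by (rule leb01.integrable_const_bound[where B = C]) (use g in \<open>auto intro!: AE_I2\<close>)
  moreover have "integrable leb01 (\<lambda>x. f x * g x)"
  proof (rule leb01.integrable_const_bound[where B = "c_max * C"])
    show "AE x in leb01. norm (f x * g x) \<le> c_max * C"
    proof (rule AE_I2)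
      fix x assume "x \<in> space leb01"
      then have x: "x \<in> {0..1}" by simp
      have "0 \<le> f x" "0 \<le> c_max" using fb[OF x] c by linarith+
      then show "norm (f x * g x) \<le> c_max * C"
        using fb[OF x] g(2,3)[OF x] C by (simp add: abs_mult mult_mono)
    qed
  qed measurable
  moreover have "c_min * g x \<le> f x * g x" if "x \<in> space leb01" for x
    using that fb g by (intro mult_right_mono) auto
  ultimately have "(LINT x|leb01. c_min * g x) \<le> (LINT x|leb01. f x * g x)"
    by (intro integral_mono) auto
  also have "\<dots> = (LINT x|PX. g x)"
    unfolding PX using c order_trans[OF less_imp_le fb(1)]
    by (subst integral_density) (auto intro!: AE_I2)
  finally show ?thesis by simp
qed

lemma bounded_density_sets: "bounded_density PX c_min c_max \<Longrightarrow> sets PX = sets leb01"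
  by (auto simp: bounded_density_def)

lemma partition_cells:
  assumes "interval_partition \<I>"
  shows "finite \<I>" "\<I> \<noteq> {}" "\<And>I. I \<in> \<I> \<Longrightarrow> is_interval I" "\<And>I. I \<in> \<I> \<Longrightarrow> I \<subseteq> {0..1}"
    "\<And>I. I \<in> \<I> \<Longrightarrow> I \<in> sets borel" "\<And>x. x \<in> {0..1} \<Longrightarrow> \<exists>I\<in>\<I>. x \<in> I"
    "\<And>I I' x. I \<in> \<I> \<Longrightarrow> I' \<in> \<I> \<Longrightarrow> x \<in> I \<Longrightarrow> x \<in> I' \<Longrightarrow> I = I'"
  using assms unfolding interval_partition_def partition_on_def disjoint_def
  by (auto intro: real_interval_borel_measurable)

lemma lower_regular_cell:
  assumes "lower_regular \<I> c" "0 < c" "finite \<I>" "I \<in> \<I>"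
  shows "c\<^sup>2 / real (card \<I>) \<le> measure leb01 I"
proof -
  let ?m = "INF I\<in>\<I>. measure leb01 I"
  have "c\<^sup>2 \<le> (sqrt (real (card \<I>) * ?m))\<^sup>2"
    using assms(1,2) by (intro power_mono) (auto simp: lower_regular_def)
  \<comment> \<open>\<open>sqrt\<close> is an odd function, so it must be known that its argument is
    nonnegative before squaring recovers that argument.\<close>
  moreover have "0 < sqrt (real (card \<I>) * ?m)"
    using less_le_trans[OF assms(2) assms(1)[unfolded lower_regular_def]] .
  ultimately have "c\<^sup>2 \<le> real (card \<I>) * ?m" by simp
  moreover have "?m \<le> measure leb01 I" using assms(3,4) by (intro cINF_lower) auto
  moreover have "0 < real (card \<I>)" using assms(3,4) by (auto simp: card_gt_0_iff)
  ultimately have "c\<^sup>2 \<le> real (card \<I>) * measure leb01 I"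
    by (meson mult_left_mono order_trans less_imp_le)
  then show ?thesis using \<open>0 < real (card \<I>)\<close> by (simp add: field_simps)
qed

text \<open>Gram-Schmidt is carried out in each cell for the law of X. For the sup bound,
  \<open>poly_sup_interval\<close> compares with the Lebesgue norm on the cell at cost C / Leb(I),
  the density bound replaces that norm at cost 1 / c_min, and regularity gives Leb(I) \<ge> c_M^2 /
  |P|. C is fixed before the law and the partition, which makes all later constants uniform in
  them.\<close>

lemma block_basis_exists:
  "\<exists>C>0. \<forall>PX \<I> c_min c_max c_M. prob_space PX \<longrightarrow> bounded_density PX c_min c_max \<longrightarrow> 0 < c_min \<longrightarrow>
    interval_partition \<I> \<longrightarrow> lower_regular \<I> c_M \<longrightarrow> 0 < c_M \<longrightarrow>
    (\<exists>b. block_basis PX \<I> r b (sqrt (C / (c_min * c_M\<^sup>2) * real (card \<I>))))"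
proof -
  obtain C where C: "C > 0" and sup: "\<And>(p :: real poly) a b x. degree p \<le> r \<Longrightarrow> a < b \<Longrightarrow> x \<in> {a..b} \<Longrightarrow>
    (poly p x)\<^sup>2 \<le> C / (b - a) * (LINT y|lborel. indicator {a..b} y * (poly p y)\<^sup>2)"
    using poly_sup_interval[of r] by blast
  have "\<exists>b. block_basis PX \<I> r b (sqrt (C / (c_min * c_M\<^sup>2) * real (card \<I>)))"
    if prob: "prob_space PX" and dens: "bounded_density PX c_min c_max" and c_min: "0 < c_min"
    and part: "interval_partition \<I>" and reg: "lower_regular \<I> c_M" and c_M: "0 < c_M"
    for PX \<I> c_min c_max c_M
  proof -
    interpret PX: prob_space PX by fact
    have sets: "sets PX = sets leb01" using bounded_density_sets[OF dens] .
    have space: "space PX = {0..1}" using sets_eq_imp_space_eq[OF sets] by simp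
    note cells = partition_cells[OF part]
    have N: "0 < real (card \<I>)" using cells(1,2) by (simp add: card_gt_0_iff)
    have meas: "g \<in> borel_measurable PX" if "g \<in> borel_measurable borel" for g :: "real \<Rightarrow> real"
      using measurable_leb01[OF that] measurable_cong_sets[OF sets refl] by auto
    have len: "c_M\<^sup>2 / real (card \<I>) \<le> measure leb01 I" if "I \<in> \<I>" for I
      by (rule lower_regular_cell[OF reg c_M cells(1) that])
    have len_pos: "0 < measure leb01 I" if "I \<in> \<I>" for I
      using len[OF that] c_M N by (smt (verit) divide_pos_pos zero_less_power)
    have int: "integrable PX (\<lambda>x. indicator I x * (poly p x * poly q x))"
      if "I \<in> \<I>" for I and p q :: "real poly"
    proof -
      obtain K where K: "\<And>x. x \<in> {0..1} \<Longrightarrow> \<bar>poly (p * q) x\<bar> \<le> K" using poly_bounded_on_unit[of "p * q"] by blast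
      have "integrable PX (\<lambda>x. indicator I x * poly (p * q) x)"
      proof (rule PX.integrable_const_bound[where B = K])
        show "AE x in PX. norm (indicator I x * poly (p * q) x) \<le> K"
          using K order_trans[OF abs_ge_zero K] by (intro AE_I2) (auto simp: space split: split_indicator)
        show "(\<lambda>x. indicator I x * poly (p * q) x) \<in> borel_measurable PX"
          using cells(5)[OF that]
          by (intro meas borel_measurable_times borel_measurable_indicator poly_measurable) auto
      qed
      then show ?thesis by simp
    qed
    define ip where "ip I p q = (LINT x|PX. indicator I x * (poly p x * poly q x))" for I and p q :: "real poly"
    \<comment> \<open>m is the Lebesgue integral of p^2 over the cell; the existential hides the end
      points. It carries both positivity and the sup-norm inequality over to the law of X.\<close>
    have ip_lower: "\<exists>m. c_min * m \<le> ip I p p \<and> (p \<noteq> 0 \<longrightarrow> 0 < m) \<and>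
        (degree p \<le> r \<longrightarrow> (\<forall>x\<in>I. (poly p x)\<^sup>2 \<le> C / measure leb01 I * m))"
      if I: "I \<in> \<I>" for I p
    proof -
      obtain a b where ab: "0 \<le> a" "a < b" "b \<le> 1" "{a<..<b} \<subseteq> I" "I \<subseteq> {a..b}" "measure leb01 I = b - a"
        using interval_between[OF cells(3,4)[OF I] len_pos[OF I]] .
      define m where "m = (LINT x|lborel. indicator {a..b} x * (poly p x)\<^sup>2)"
      have p2: "(\<lambda>x. (poly p x)\<^sup>2) \<in> borel_measurable borel"
        by (intro borel_measurable_power poly_measurable)
      obtain K where K: "\<And>x. x \<in> {0..1} \<Longrightarrow> \<bar>poly (p * p) x\<bar> \<le> K" using poly_bounded_on_unit[of "p * p"] by blast
      have "c_min * (LINT x|leb01. indicator I x * (poly p x)\<^sup>2) \<le> (LINT x|PX. indicator I x * (poly p x)\<^sup>2)"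
      proof (rule integral_bounded_density_ge[OF dens c_min, where C = K])
        show "(\<lambda>x. indicator I x * (poly p x)\<^sup>2) \<in> borel_measurable borel"
          using cells(5)[OF I] p2 by (intro borel_measurable_times borel_measurable_indicator) auto
        show "indicator I x * (poly p x)\<^sup>2 \<le> K" if "x \<in> {0..1}" for x
          using K[OF that] order_trans[OF abs_ge_zero K[OF that]]
          by (auto simp: power2_eq_square split: split_indicator)
      qed auto
      also have "(LINT x|leb01. indicator I x * (poly p x)\<^sup>2) = m"
        unfolding m_def by (rule integral_indicator_between[OF ab(1-5) p2 cells(5)[OF I]])
      finally have "c_min * m \<le> ip I p p" by (simp add: ip_def power2_eq_square)
      moreover have "0 < m" if "p \<noteq> 0" unfolding m_def by (rule integral_poly_square_pos[OF that ab(2)])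
      moreover have "(poly p x)\<^sup>2 \<le> C / measure leb01 I * m" if "degree p \<le> r" "x \<in> I" for x
        unfolding m_def ab(6) using sup[OF that(1) ab(2)] that(2) ab(5) by auto
      ultimately show ?thesis by blast
    qed
    have ip_pos: "0 < ip I p p" if "I \<in> \<I>" "p \<noteq> 0" for I p
      using ip_lower[OF that(1), of p] that(2) c_min by (smt (verit) mult_pos_pos)
    have sup_cell: "(poly p x)\<^sup>2 \<le> C / (c_min * c_M\<^sup>2) * real (card \<I>) * ip I p p"
      if I: "I \<in> \<I>" and deg: "degree p \<le> r" and x: "x \<in> I" for I p x
    proof -
      obtain m where m: "c_min * m \<le> ip I p p" "p \<noteq> 0 \<longrightarrow> 0 < m" "(poly p x)\<^sup>2 \<le> C / measure leb01 I * m"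
        using ip_lower[OF I, of p] deg x by blast
      show ?thesis
      \<comment> \<open>For nonzero p, m is positive, the sign needed to multiply the two upper
        bounds below.\<close>
      proof (cases "p = 0")
        case True
        then show ?thesis by (simp add: ip_def)
      next
        case False
        have cM2: "0 < c_M\<^sup>2" using c_M by simp
        have "C / measure leb01 I \<le> C / (c_M\<^sup>2 / real (card \<I>))"
          using C N cM2 len[OF I] len_pos[OF I] by (intro divide_left_mono) auto
        moreover have "m \<le> ip I p p / c_min" using m(1) c_min by (simp add: field_simps)
        ultimately have "C / measure leb01 I * m \<le> C / (c_M\<^sup>2 / real (card \<I>)) * (ip I p p / c_min)"
          using m(2) False C N cM2 by (intro mult_mono) auto
        with m(3) show ?thesis by (simp add: field_simps)
      qed
    qed
    have "\<exists>e. (\<forall>k\<le>r. degree (e k) \<le> r) \<and>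
      (\<forall>j\<le>r. \<forall>k\<le>r. ip I (e j) (e k) = (if j = k then 1 else 0)) \<and>
      (\<forall>p. degree p \<le> r \<longrightarrow> (\<exists>c. p = (\<Sum>k\<le>r. smult (c k) (e k))))" if I: "I \<in> \<I>" for I
    proof (rule gram_schmidt_poly)
      show "0 < ip I p p" if "p \<noteq> 0" for p using ip_pos[OF I that] .
      show "ip I (p + q) t = ip I p t + ip I q t" for p q t
        using int[OF I, of p t] int[OF I, of q t] by (simp add: ip_def algebra_simps)
      show "ip I (smult c p) q = c * ip I p q" for c p q
      proof -
        have "ip I (smult c p) q = (LINT x|PX. c * (indicator I x * (poly p x * poly q x)))"
          by (simp add: ip_def algebra_simps)
        then show ?thesis by (simp add: ip_def)
      qed
    qed (simp add: ip_def mult.commute)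
    then have "\<forall>I\<in>\<I>. \<exists>e. (\<forall>k\<le>r. degree (e k) \<le> r) \<and>
      (\<forall>j\<le>r. \<forall>k\<le>r. ip I (e j) (e k) = (if j = k then 1 else 0)) \<and>
      (\<forall>p. degree p \<le> r \<longrightarrow> (\<exists>c. p = (\<Sum>k\<le>r. smult (c k) (e k))))" by blast
    from bchoice[OF this] obtain e where deg: "\<And>I k. I \<in> \<I> \<Longrightarrow> k \<le> r \<Longrightarrow> degree (e I k) \<le> r"
      and on: "\<And>I j k. I \<in> \<I> \<Longrightarrow> j \<le> r \<Longrightarrow> k \<le> r \<Longrightarrow> ip I (e I j) (e I k) = (if j = k then 1 else 0)"
      and span: "\<And>I p. I \<in> \<I> \<Longrightarrow> degree p \<le> r \<Longrightarrow> \<exists>c. p = (\<Sum>k\<le>r. smult (c k) (e I k))" by blast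
    define b where "b = (\<lambda>(I, k) x. indicator I x * poly (e I k) x)"
    have disj: "indicator I x * indicator I' x = (0 :: real)" if "I \<in> \<I>" "I' \<in> \<I>" "I \<noteq> I'" for I I' x
      using cells(7)[OF that(1,2), of x] that(3) by (auto split: split_indicator)
    have "block_basis PX \<I> r b (sqrt (C / (c_min * c_M\<^sup>2) * real (card \<I>)))"
    proof (unfold_locales)
      show "interval_partition \<I>" "sets PX = sets leb01" by (fact part, fact sets)
      fix j assume j: "j \<in> \<I> \<times> {..r}"
      obtain I k where j_def: "j = (I, k)" "I \<in> \<I>" "k \<le> r" using j by auto
      show "b j \<in> borel_measurable borel"
        unfolding j_def b_def prod.case using cells(5)[OF j_def(2)]
        by (intro borel_measurable_times borel_measurable_indicator poly_measurable) auto
      have "\<exists>p. degree p \<le> r \<and> (\<forall>x\<in>I'. b (I, k) x = poly p x)" if "I' \<in> \<I>" for I'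
      proof (cases "I' = I")
        case True
        then show ?thesis using deg[OF j_def(2,3)] by (intro exI[of _ "e I k"]) (auto simp: b_def)
      next
        case False
        have "b (I, k) x = poly 0 x" if "x \<in> I'" for x
          using disj[OF j_def(2) \<open>I' \<in> \<I>\<close>, of x] False that by (auto simp: b_def)
        then show ?thesis by (intro exI[of _ 0]) auto
      qed
      then show "b j \<in> piecewise_poly \<I> r"
        using cells(4)[OF j_def(2)] unfolding piecewise_poly_def j_def(1)
        by (auto simp: b_def split: split_indicator)
      show "\<bar>b j x\<bar> \<le> sqrt (C / (c_min * c_M\<^sup>2) * real (card \<I>))" for x
      proof -
        have "(b j x)\<^sup>2 \<le> C / (c_min * c_M\<^sup>2) * real (card \<I>)"
        proof (cases "x \<in> I")
          case True
          then show ?thesis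
            using sup_cell[OF j_def(2) deg[OF j_def(2,3)] True] on[OF j_def(2,3,3)] by (simp add: b_def j_def)
        next
          case False
          then show ?thesis using C c_min by (simp add: b_def j_def)
        qed
        then show ?thesis by (metis real_sqrt_abs real_sqrt_le_mono)
      qed
      fix j' assume j': "j' \<in> \<I> \<times> {..r}"
      obtain I' k' where j'_def: "j' = (I', k')" "I' \<in> \<I>" "k' \<le> r" using j' by auto
      show "(LINT x|PX. b j x * b j' x) = (if j = j' then 1 else 0)"
      proof (cases "I = I'")
        case True
        have "b j x * b j' x = indicator I x * (poly (e I k) x * poly (e I k') x)" for x
          by (auto simp: b_def j_def j'_def True split: split_indicator)
        then show ?thesis using on[OF j_def(2,3) j'_def(3)] True by (simp add: ip_def j_def j'_def)
      next
        case False
        have "b j x * b j' x = (indicator I x * indicator I' x) * (poly (e I k) x * poly (e I' k') x)" for x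
          by (simp add: b_def j_def j'_def)
        then have "(\<lambda>x. b j x * b j' x) = (\<lambda>_. 0)"
          unfolding disj[OF j_def(2) j'_def(2) False] by (simp add: fun_eq_iff)
        then show ?thesis using False by (simp add: j_def j'_def)
      qed
    next
      show "b (I, k) x = 0" if "x \<notin> I" for I k x using that by (simp add: b_def)
      fix s assume s: "s \<in> piecewise_poly \<I> r"
      have "\<forall>I\<in>\<I>. \<exists>c. \<forall>x\<in>I. s x = (\<Sum>k\<le>r. c k * poly (e I k) x)"
      proof
        fix I assume I: "I \<in> \<I>"
        then obtain p where p: "degree p \<le> r" "\<And>x. x \<in> I \<Longrightarrow> s x = poly p x"
          using s unfolding piecewise_poly_def by blast
        obtain c where "p = (\<Sum>k\<le>r. smult (c k) (e I k))" using span[OF I p(1)] by blast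
        then show "\<exists>c. \<forall>x\<in>I. s x = (\<Sum>k\<le>r. c k * poly (e I k) x)"
          using p(2) by (intro exI[of _ c]) (simp add: poly_sum)
      qed
      from bchoice[OF this] obtain c where c: "\<And>I x. I \<in> \<I> \<Longrightarrow> x \<in> I \<Longrightarrow> s x = (\<Sum>k\<le>r. c I k * poly (e I k) x)"
        by blast
      have "s x = (\<Sum>j\<in>\<I> \<times> {..r}. (case j of (I, k) \<Rightarrow> c I k) * b j x)" for x
      proof -
        have eq: "(\<Sum>j\<in>\<I> \<times> {..r}. (case j of (I, k) \<Rightarrow> c I k) * b j x)
          = (\<Sum>I\<in>\<I>. indicator I x * (\<Sum>k\<le>r. c I k * poly (e I k) x))"
          by (simp add: sum.cartesian_product' b_def sum_distrib_left algebra_simps)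
        show ?thesis
        proof (cases "x \<in> {0..1}")
          case True
          then obtain I0 where I0: "I0 \<in> \<I>" "x \<in> I0" using cells(6) by blast
          have "(\<Sum>I\<in>\<I>. indicator I x * (\<Sum>k\<le>r. c I k * poly (e I k) x)) = (\<Sum>I\<in>\<I>. if I = I0 then s x else 0)"
          proof (rule sum.cong[OF refl])
            fix I assume I: "I \<in> \<I>"
            show "indicator I x * (\<Sum>k\<le>r. c I k * poly (e I k) x) = (if I = I0 then s x else 0)"
            proof (cases "x \<in> I")
              case True
              then have "I = I0" by (rule cells(7)[OF I I0(1) _ I0(2)])
              then show ?thesis using c[OF I True] True by simp
            next
              case False
              then show ?thesis using I0(2) by auto
            qed
          qed
          also have "\<dots> = s x" using I0(1) cells(1) by (simp add: sum.delta')
          finally show ?thesis unfolding eq by simp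
        next
          case False
          then have "s x = 0" using s by (simp add: piecewise_poly_def)
          moreover have "x \<notin> I" if "I \<in> \<I>" for I using cells(4)[OF that] False by auto
          ultimately show ?thesis unfolding eq by simp
        qed
      qed
      then show "\<exists>c. \<forall>x. s x = (\<Sum>j\<in>\<I> \<times> {..r}. c j * b j x)" by blast
    qed
    then show ?thesis by blast
  qed
  then show ?thesis using C by blast
qed

section \<open>Moments of the regression law\<close>

lemma integrable_mult_of_squares:
  fixes f g :: "'a \<Rightarrow> real"
  assumes [measurable]: "f \<in> borel_measurable M" "g \<in> borel_measurable M"
    and "integrable M (\<lambda>x. (f x)\<^sup>2)" "integrable M (\<lambda>x. (g x)\<^sup>2)"
  shows "integrable M (\<lambda>x. f x * g x)"
proof (rule Bochner_Integration.integrable_bound)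
  show "integrable M (\<lambda>x. (f x)\<^sup>2 + (g x)\<^sup>2)" using assms by simp
  show "AE x in M. norm (f x * g x) \<le> norm ((f x)\<^sup>2 + (g x)\<^sup>2)"
  proof (rule AE_I2)
    fix x
    have "0 \<le> (\<bar>f x\<bar> - \<bar>g x\<bar>)\<^sup>2" by simp
    then have "2 * (\<bar>f x\<bar> * \<bar>g x\<bar>) \<le> (f x)\<^sup>2 + (g x)\<^sup>2" by (simp add: power2_diff)
    moreover have "0 \<le> \<bar>f x\<bar> * \<bar>g x\<bar>" by simp
    ultimately have "\<bar>f x\<bar> * \<bar>g x\<bar> \<le> (f x)\<^sup>2 + (g x)\<^sup>2" by linarith
    then show "norm (f x * g x) \<le> norm ((f x)\<^sup>2 + (g x)\<^sup>2)" by (simp add: abs_mult)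
  qed
qed measurable

lemma regression_law_prob_space:
  assumes "regression_law P s \<sigma>"
  shows "prob_space P" "sets P = sets data_space"
proof -
  obtain Q where Q: "prob_space Q" "sets Q = sets data_space"
    "P = distr Q data_space (\<lambda>(x, e). (x, s x + \<sigma> x * e))"
    using assms unfolding regression_law_def by blast
  have [measurable]: "s \<in> borel_measurable leb01" "\<sigma> \<in> borel_measurable leb01"
    using assms unfolding regression_law_def by auto
  have [measurable_cong]: "sets Q = sets data_space" by fact
  have "(\<lambda>(x, e). (x, s x + \<sigma> x * e)) \<in> Q \<rightarrow>\<^sub>M data_space" by measurable
  then show "prob_space P" unfolding Q(3) by (intro prob_space.prob_space_distr Q)
  show "sets P = sets data_space" unfolding Q(3) by simp
qed

text \<open>The first identity holds because the noise is centred given X. The second combines a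
  conditional variance of Y that is at least \<open>\<sigma>min\<^sup>2\<close> with a squared bias
  that is nonnegative. Everything is pulled back to the joint law Q of X and the noise, because the
  noise need not be a function of (X, Y).\<close>

lemma regression_law_moments:
  assumes law: "regression_law P s \<sigma>" and A: "AE z in P. \<bar>snd z\<bar> \<le> A"
    and u[measurable]: "u \<in> borel_measurable leb01" and uC: "\<And>x. x \<in> {0..1} \<Longrightarrow> \<bar>u x\<bar> \<le> C"
    and m[measurable]: "m \<in> borel_measurable leb01" and mC: "\<And>x. x \<in> {0..1} \<Longrightarrow> \<bar>m x\<bar> \<le> C'"
  shows "(LINT z|P. (snd z - m (fst z)) * u (fst z)) = (LINT x|law_X P. (s x - m x) * u x)"
    and "0 < \<sigma>min \<Longrightarrow> AE x in law_X P. \<sigma>min \<le> \<sigma> x \<Longrightarrow> (\<And>x. 0 \<le> u x) \<Longrightarrow>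
      \<sigma>min\<^sup>2 * (LINT x|law_X P. u x) \<le> (LINT z|P. (snd z - m (fst z))\<^sup>2 * u (fst z))"
proof -
  have sm[measurable]: "s \<in> borel_measurable leb01" "\<sigma> \<in> borel_measurable leb01"
    and s2: "integrable (law_X P) (\<lambda>x. (s x)\<^sup>2)"
    using law unfolding regression_law_def by auto
  obtain Q where Q: "prob_space Q" "sets Q = sets data_space"
    and ce1: "AE z in Q. real_cond_exp Q (vimage_algebra (space Q) fst leb01) (\<lambda>(x, e). e) z = 0"
    and ce2: "AE z in Q. real_cond_exp Q (vimage_algebra (space Q) fst leb01) (\<lambda>(x, e). e\<^sup>2) z = 1"
    and P: "P = distr Q data_space (\<lambda>(x, e). (x, s x + \<sigma> x * e))"
    using law unfolding regression_law_def by blast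
  interpret Q: prob_space Q by fact
  have [measurable_cong]: "sets Q = sets data_space" by fact
  define F where "F = vimage_algebra (space Q) fst leb01"
  define T where "T = (\<lambda>z. (fst z, s (fst z) + \<sigma> (fst z) * snd z) :: real \<times> real)"
  have T[measurable]: "T \<in> Q \<rightarrow>\<^sub>M data_space" unfolding T_def by measurable
  have P: "P = distr Q data_space T" unfolding P T_def by (simp add: case_prod_beta')
  have fstQ[measurable]: "fst \<in> Q \<rightarrow>\<^sub>M leb01" by measurable
  have PX: "law_X P = distr Q leb01 fst"
    unfolding law_X_def P by (subst distr_distr) (auto simp: comp_def T_def)
  have fst01: "fst z \<in> {0..1}" if "z \<in> space Q" for z
    using measurable_space[OF fstQ that] by simp
  have intX: "(LINT x|law_X P. g x) = (LINT z|Q. g (fst z))" if "g \<in> borel_measurable leb01" for g :: "real \<Rightarrow> real"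
    unfolding PX using that by (intro integral_distr) measurable
  have intP: "(LINT z|P. g z) = (LINT z|Q. g (T z))" if "g \<in> borel_measurable data_space" for g :: "real \<times> real \<Rightarrow> real"
    unfolding P using that by (intro integral_distr) measurable
  have fst_space: "fst \<in> space Q \<rightarrow> space leb01" using fst01 by auto
  have sub: "subalgebra Q F"
    unfolding subalgebra_def F_def using measurable_sets[OF fstQ]
    by (auto simp: sets_vimage_algebra2[OF fst_space])
  interpret F: finite_measure_subalgebra Q F by unfold_locales (rule sub)
  have Fm: "(\<lambda>z. g (fst z)) \<in> borel_measurable F" if "g \<in> borel_measurable leb01" for g :: "real \<Rightarrow> real"
    unfolding F_def by (rule measurable_compose[OF measurable_vimage_algebra1[OF fst_space] that])
  have s2Q: "integrable Q (\<lambda>z. (s (fst z))\<^sup>2)"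
    using s2 unfolding PX by (subst (asm) integrable_distr_eq) auto
  have AQ: "AE z in Q. \<bar>s (fst z) + \<sigma> (fst z) * snd z\<bar> \<le> A"
    using A unfolding P by (auto simp: T_def dest!: AE_distrD[OF T])
  have Y2: "integrable Q (\<lambda>z. (s (fst z) + \<sigma> (fst z) * snd z)\<^sup>2)"
    by (rule Q.bounded_square_integrable[OF _ AQ]) measurable
  have m2: "integrable Q (\<lambda>z. (m (fst z))\<^sup>2)"
    by (rule Q.bounded_square_integrable[where C = C']) (use mC fst01 in \<open>auto intro!: AE_I2\<close>)
  have u2: "integrable Q (\<lambda>z. (u (fst z))\<^sup>2)"
    by (rule Q.bounded_square_integrable[where C = C]) (use uC fst01 in \<open>auto intro!: AE_I2\<close>)
  have sum2: "integrable Q (\<lambda>z. (f z + g z)\<^sup>2)"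
    if [measurable]: "f \<in> borel_measurable Q" "g \<in> borel_measurable Q"
    and "integrable Q (\<lambda>z. (f z)\<^sup>2)" "integrable Q (\<lambda>z. (g z)\<^sup>2)" for f g :: "_ \<Rightarrow> real"
    using that integrable_mult_of_squares[OF that] by (simp add: power2_sum mult.assoc)
  \<comment> \<open>No moment of \<open>\<sigma>\<close> is given, but the noise term is the
    difference of Y, which is bounded, and s(X), which is square integrable.\<close>
  have \<sigma>e2: "integrable Q (\<lambda>z. (\<sigma> (fst z) * snd z)\<^sup>2)"
    using sum2[OF _ _ Y2, of "\<lambda>z. - s (fst z)"] s2Q by simp
  have sm2: "integrable Q (\<lambda>z. (s (fst z) - m (fst z))\<^sup>2)"
    using sum2[OF _ _ s2Q, of "\<lambda>z. - m (fst z)"] m2 by simp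
  have smu2: "integrable Q (\<lambda>z. ((s (fst z) - m (fst z)) * u (fst z))\<^sup>2)"
    and \<sigma>eu: "integrable Q (\<lambda>z. (\<sigma> (fst z) * snd z)\<^sup>2 * u (fst z))"
    and smu: "integrable Q (\<lambda>z. (s (fst z) - m (fst z))\<^sup>2 * u (fst z))"
  proof -
    have int_u: "integrable Q (\<lambda>z. g z * u (fst z))" if g: "integrable Q g" for g :: "_ \<Rightarrow> real"
    proof (rule Bochner_Integration.integrable_bound)
      show "integrable Q (\<lambda>z. C * g z)" using g by simp
      show "(\<lambda>z. g z * u (fst z)) \<in> borel_measurable Q"
        using borel_measurable_integrable[OF g] by measurable
      show "AE z in Q. norm (g z * u (fst z)) \<le> norm (C * g z)"
        using uC[OF fst01] order_trans[OF abs_ge_zero uC[OF fst01]]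
        by (intro AE_I2) (auto simp: abs_mult mult.commute intro!: mult_right_mono)
    qed
    show "integrable Q (\<lambda>z. (\<sigma> (fst z) * snd z)\<^sup>2 * u (fst z))" by (rule int_u[OF \<sigma>e2])
    show smu: "integrable Q (\<lambda>z. (s (fst z) - m (fst z))\<^sup>2 * u (fst z))" by (rule int_u[OF sm2])
    show "integrable Q (\<lambda>z. ((s (fst z) - m (fst z)) * u (fst z))\<^sup>2)"
      using int_u[OF smu] by (simp add: power_mult_distrib power2_eq_square ac_simps)
  qed
  \<comment> \<open>A factor that depends on X alone may be pulled out of the conditional
    expectation given X, which is 0.\<close>
  have noise: "(LINT z|Q. g (fst z) * snd z) = 0"
    if g[measurable]: "g \<in> borel_measurable leb01" and int: "integrable Q (\<lambda>z. g (fst z) * snd z)" for g :: "real \<Rightarrow> real"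
  proof -
    have i: "integrable Q (\<lambda>z. g (fst z) * (case z of (x, e) \<Rightarrow> e))"
      using int by (simp add: case_prod_beta')
    have "(LINT z|Q. g (fst z) * snd z) = (LINT z|Q. g (fst z) * (case z of (x, e) \<Rightarrow> e))"
      by (simp add: case_prod_beta')
    also have "\<dots> = (LINT z|Q. g (fst z) * real_cond_exp Q F (\<lambda>(x, e). e) z)"
      by (rule F.real_cond_exp_intg(2)[OF i Fm[OF g], symmetric]) measurable
    also have "\<dots> = (LINT z|Q. 0)"
      using ce1[folded F_def] by (intro integral_cong_AE) auto
    finally show ?thesis by simp
  qed
  show "(LINT z|P. (snd z - m (fst z)) * u (fst z)) = (LINT x|law_X P. (s x - m x) * u x)"
  proof -
    have i1: "integrable Q (\<lambda>z. (s (fst z) - m (fst z)) * u (fst z))"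
      by (intro integrable_mult_of_squares sm2 u2) measurable
    have i2: "integrable Q (\<lambda>z. (\<sigma> (fst z) * snd z) * u (fst z))"
      by (intro integrable_mult_of_squares \<sigma>e2 u2) measurable
    have "(LINT z|P. (snd z - m (fst z)) * u (fst z))
      = (LINT z|Q. (s (fst z) - m (fst z)) * u (fst z) + (\<sigma> (fst z) * snd z) * u (fst z))"
      by (subst intP) (auto simp: T_def algebra_simps)
    also have "\<dots> = (LINT z|Q. (s (fst z) - m (fst z)) * u (fst z)) + (LINT z|Q. (\<sigma> (fst z) * u (fst z)) * snd z)"
      using i1 i2 by (simp add: ac_simps)
    also have "(LINT z|Q. (\<sigma> (fst z) * u (fst z)) * snd z) = 0"
      using i2 by (intro noise[of "\<lambda>x. \<sigma> x * u x"]) (auto simp: algebra_simps)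
    finally show ?thesis by (subst intX) auto
  qed
  show "\<sigma>min\<^sup>2 * (LINT x|law_X P. u x) \<le> (LINT z|P. (snd z - m (fst z))\<^sup>2 * u (fst z))"
    if \<sigma>min: "0 < \<sigma>min" "AE x in law_X P. \<sigma>min \<le> \<sigma> x" and u0: "\<And>x. 0 \<le> u x"
  proof -
    have \<sigma>Q: "AE z in Q. \<sigma>min \<le> \<sigma> (fst z)"
      using \<sigma>min(2) unfolding PX by (rule AE_distrD[OF fstQ])
    have cross_int: "integrable Q (\<lambda>z. ((s (fst z) - m (fst z)) * u (fst z)) * (\<sigma> (fst z) * snd z))"
      by (intro integrable_mult_of_squares smu2 \<sigma>e2) measurable
    have cross: "(LINT z|Q. ((s (fst z) - m (fst z)) * u (fst z)) * (\<sigma> (fst z) * snd z)) = 0"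
      using noise[of "\<lambda>x. (s x - m x) * u x * \<sigma> x"] cross_int by (simp add: mult.assoc)
    have eq: "(LINT z|Q. (\<sigma> (fst z) * snd z)\<^sup>2 * u (fst z)) = (LINT z|Q. (\<sigma> (fst z))\<^sup>2 * u (fst z))"
      and int: "integrable Q (\<lambda>z. (\<sigma> (fst z))\<^sup>2 * u (fst z))"
    proof -
      have i: "integrable Q (\<lambda>z. ((\<sigma> (fst z))\<^sup>2 * u (fst z)) * (case z of (x, e) \<Rightarrow> e\<^sup>2))"
        using \<sigma>eu by (simp add: case_prod_beta' power_mult_distrib algebra_simps)
      have M: "(\<lambda>z. (\<sigma> (fst z))\<^sup>2 * u (fst z)) \<in> borel_measurable F"
        by (rule Fm[of "\<lambda>x. (\<sigma> x)\<^sup>2 * u x"]) measurable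
      have AEeq: "AE z in Q. (\<sigma> (fst z))\<^sup>2 * u (fst z) * real_cond_exp Q F (\<lambda>(x, e). e\<^sup>2) z = (\<sigma> (fst z))\<^sup>2 * u (fst z)"
        using ce2[folded F_def] by eventually_elim simp
      \<comment> \<open>Integrability passes from \<open>\<sigma>\<^sup>2 * e\<^sup>2 * u\<close> to
        \<open>\<sigma>\<^sup>2 * u\<close> through the conditional expectation of
        \<open>e\<^sup>2\<close>, which is 1.\<close>
      show "integrable Q (\<lambda>z. (\<sigma> (fst z))\<^sup>2 * u (fst z))"
      proof -
        have "integrable Q (\<lambda>z. (\<sigma> (fst z))\<^sup>2 * u (fst z) * real_cond_exp Q F (\<lambda>(x, e). e\<^sup>2) z)"
          by (rule F.real_cond_exp_intg(1)[OF i M]) measurable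
        then show ?thesis by (subst (asm) integrable_cong_AE[OF _ _ AEeq]) auto
      qed
      have "(LINT z|Q. (\<sigma> (fst z) * snd z)\<^sup>2 * u (fst z)) = (LINT z|Q. ((\<sigma> (fst z))\<^sup>2 * u (fst z)) * (case z of (x, e) \<Rightarrow> e\<^sup>2))"
        by (simp add: case_prod_beta' power_mult_distrib algebra_simps)
      also have "\<dots> = (LINT z|Q. (\<sigma> (fst z))\<^sup>2 * u (fst z) * real_cond_exp Q F (\<lambda>(x, e). e\<^sup>2) z)"
        by (rule F.real_cond_exp_intg(2)[OF i M, symmetric]) measurable
      also have "\<dots> = (LINT z|Q. (\<sigma> (fst z))\<^sup>2 * u (fst z))"
        by (intro integral_cong_AE AEeq) auto
      finally show "(LINT z|Q. (\<sigma> (fst z) * snd z)\<^sup>2 * u (fst z)) = (LINT z|Q. (\<sigma> (fst z))\<^sup>2 * u (fst z))" .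
    qed
    have uint: "integrable Q (\<lambda>z. u (fst z))"
      by (rule Q.integrable_const_bound[where B = C]) (use uC fst01 in \<open>auto intro!: AE_I2\<close>)
    have "\<sigma>min\<^sup>2 * (LINT x|law_X P. u x) = (LINT z|Q. \<sigma>min\<^sup>2 * u (fst z))"
      by (subst intX) auto
    also have "\<dots> \<le> (LINT z|Q. (\<sigma> (fst z))\<^sup>2 * u (fst z))"
    proof (rule integral_mono_AE)
      show "AE z in Q. \<sigma>min\<^sup>2 * u (fst z) \<le> (\<sigma> (fst z))\<^sup>2 * u (fst z)"
        using \<sigma>Q by eventually_elim (use \<sigma>min(1) u0 in \<open>auto intro!: mult_right_mono power_mono\<close>)
    qed (use uint int in auto)
    \<comment> \<open>Adding the squared bias, and then the cross term, whose integral is 0,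
      completes the square to (Y - m(X))^2.\<close>
    also have "\<dots> \<le> (LINT z|Q. (\<sigma> (fst z))\<^sup>2 * u (fst z)) + (LINT z|Q. (s (fst z) - m (fst z))\<^sup>2 * u (fst z))"
      using u0 by (simp add: Bochner_Integration.integral_nonneg)
    also have "\<dots> = (LINT z|Q. (\<sigma> (fst z) * snd z)\<^sup>2 * u (fst z)) + (LINT z|Q. (s (fst z) - m (fst z))\<^sup>2 * u (fst z))
       + 2 * (LINT z|Q. ((s (fst z) - m (fst z)) * u (fst z)) * (\<sigma> (fst z) * snd z))"
      unfolding eq cross by simp
    also have "\<dots> = (LINT z|Q. (\<sigma> (fst z) * snd z)\<^sup>2 * u (fst z) + (s (fst z) - m (fst z))\<^sup>2 * u (fst z)
       + 2 * (((s (fst z) - m (fst z)) * u (fst z)) * (\<sigma> (fst z) * snd z)))"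
      using \<sigma>eu smu cross_int by simp
    also have "\<dots> = (LINT z|P. (snd z - m (fst z))\<^sup>2 * u (fst z))"
      by (subst intP) (auto simp: T_def power2_eq_square algebra_simps intro!: Bochner_Integration.integral_cong)
    finally show ?thesis .
  qed
qed

section \<open>Perturbation of the normal equations\<close>

text \<open>The error is given relative to the unknown |c|. Since \<delta> \<le> 1/2, the triangle
  inequality gives |c| \<le> 2 |g|, so ||c| - |g|| \<le> 2 \<delta> |g|. Multiplied by |c| + |g|
  \<le> 3 |g|, this gives the constant 6; Cauchy-Schwarz gives 2 for the scalar product.\<close>

lemma near_vector:
  fixes g c :: "'j \<Rightarrow> real"
  assumes near: "(\<Sum>j\<in>J. (g j - c j)\<^sup>2) \<le> \<delta>\<^sup>2 * (\<Sum>j\<in>J. (c j)\<^sup>2)" and \<delta>: "0 \<le> \<delta>" "\<delta> \<le> 1 / 2"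
  shows "\<bar>(\<Sum>j\<in>J. (c j)\<^sup>2) - (\<Sum>j\<in>J. (g j)\<^sup>2)\<bar> \<le> 6 * \<delta> * (\<Sum>j\<in>J. (g j)\<^sup>2)"
    and "\<bar>(\<Sum>j\<in>J. c j * g j) - (\<Sum>j\<in>J. (g j)\<^sup>2)\<bar> \<le> 2 * \<delta> * (\<Sum>j\<in>J. (g j)\<^sup>2)"
proof -
  define a where "a = L2_set c J"
  define \<gamma> where "\<gamma> = L2_set g J"
  define d where "d = L2_set (\<lambda>j. g j - c j) J"
  have sq: "a\<^sup>2 = (\<Sum>j\<in>J. (c j)\<^sup>2)" "\<gamma>\<^sup>2 = (\<Sum>j\<in>J. (g j)\<^sup>2)"
    "d\<^sup>2 = (\<Sum>j\<in>J. (g j - c j)\<^sup>2)"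
    by (simp_all add: a_def \<gamma>_def d_def L2_set_def sum_nonneg)
  have nn: "0 \<le> a" "0 \<le> \<gamma>" "0 \<le> d" by (simp_all add: a_def \<gamma>_def d_def)
  have d: "d \<le> \<delta> * a"
  proof (rule power2_le_imp_le)
    show "d\<^sup>2 \<le> (\<delta> * a)\<^sup>2" using near unfolding sq[symmetric] by (simp add: power_mult_distrib)
    show "0 \<le> \<delta> * a" using \<delta> nn by simp
  qed
  have "\<gamma> \<le> a + d"
    using L2_set_triangle_ineq[of c "\<lambda>j. g j - c j" J] by (simp add: a_def \<gamma>_def d_def)
  moreover have "a \<le> \<gamma> + d"
    using L2_set_triangle_ineq[of g "\<lambda>j. c j - g j" J]
    by (simp add: a_def \<gamma>_def d_def L2_set_def power2_commute)
  ultimately have diff: "\<bar>a - \<gamma>\<bar> \<le> \<delta> * a" using d by linarith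
  have "\<delta> * a \<le> 1 / 2 * a" using \<delta> nn by (intro mult_right_mono) auto
  then have a2: "a \<le> 2 * \<gamma>" using diff by linarith
  then have da: "\<delta> * a \<le> 2 * \<delta> * \<gamma>" using mult_left_mono[OF a2 \<delta>(1)] by simp
  have "\<bar>a\<^sup>2 - \<gamma>\<^sup>2\<bar> = \<bar>a - \<gamma>\<bar> * (a + \<gamma>)"
    using nn by (simp add: power2_eq_square square_diff_square_factored abs_mult)
  also have "\<dots> \<le> (2 * \<delta> * \<gamma>) * (3 * \<gamma>)"
    using diff da a2 nn \<delta> by (intro mult_mono) auto
  finally show "\<bar>(\<Sum>j\<in>J. (c j)\<^sup>2) - (\<Sum>j\<in>J. (g j)\<^sup>2)\<bar> \<le> 6 * \<delta> * (\<Sum>j\<in>J. (g j)\<^sup>2)"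
    unfolding sq[symmetric] by (simp add: power2_eq_square algebra_simps)
  have "\<bar>(\<Sum>j\<in>J. c j * g j) - (\<Sum>j\<in>J. (g j)\<^sup>2)\<bar> = \<bar>\<Sum>j\<in>J. (g j - c j) * g j\<bar>"
    by (simp add: power2_eq_square algebra_simps sum_subtractf abs_minus_commute)
  also have "\<dots> \<le> (\<Sum>j\<in>J. \<bar>g j - c j\<bar> * \<bar>g j\<bar>)"
    by (rule order_trans[OF sum_abs]) (simp add: abs_mult)
  also have "\<dots> \<le> d * \<gamma>" unfolding d_def \<gamma>_def by (rule L2_set_mult_ineq)
  also have "\<dots> \<le> 2 * \<delta> * \<gamma> * \<gamma>" using d da nn by (intro mult_right_mono) auto
  finally show "\<bar>(\<Sum>j\<in>J. c j * g j) - (\<Sum>j\<in>J. (g j)\<^sup>2)\<bar> \<le> 2 * \<delta> * (\<Sum>j\<in>J. (g j)\<^sup>2)"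
    unfolding sq[symmetric] by (simp add: power2_eq_square)
qed

lemma linear_coefficient_zero:
  fixes a d :: real
  assumes "0 \<le> a" and "\<And>\<theta>. 0 \<le> a * \<theta>\<^sup>2 - 2 * d * \<theta>"
  shows "d = 0"
proof (rule ccontr)
  assume "d \<noteq> 0"
  \<comment> \<open>The minimiser would be d / a; the denominator a + 1 also covers a = 0 and still
    makes the quadratic negative.\<close>
  have "a * (d / (a + 1))\<^sup>2 - 2 * d * (d / (a + 1)) = - (d\<^sup>2 * (a + 2)) / (a + 1)\<^sup>2"
    using assms(1) by (simp add: power2_eq_square divide_simps) (simp add: algebra_simps)
  moreover have "0 < d\<^sup>2 * (a + 2) / (a + 1)\<^sup>2"
    using \<open>d \<noteq> 0\<close> assms(1) by (intro divide_pos_pos mult_pos_pos) auto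
  ultimately show False using assms(2)[of "d / (a + 1)"] by simp
qed

lemma piecewise_poly_add_scaled:
  assumes "s \<in> piecewise_poly \<I> r" "u \<in> piecewise_poly \<I> r"
  shows "(\<lambda>x. s x + \<theta> * u x) \<in> piecewise_poly \<I> r"
proof -
  have "\<exists>p. degree p \<le> r \<and> (\<forall>x\<in>I. s x + \<theta> * u x = poly p x)" if I: "I \<in> \<I>" for I
  proof -
    obtain p q where "degree p \<le> r" "\<forall>x\<in>I. s x = poly p x" "degree q \<le> r" "\<forall>x\<in>I. u x = poly q x"
      using assms I unfolding piecewise_poly_def by blast
    then show ?thesis
      by (intro exI[of _ "p + smult \<theta> q"]) (auto intro!: degree_add_le order_trans[OF degree_smult_le])
  qed
  then show ?thesis using assms by (auto simp: piecewise_poly_def)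
qed

context block_basis
begin

abbreviation J :: "(real set \<times> nat) set" where "J \<equiv> \<I> \<times> {..r}"

lemma finite_J: "finite J"
  using partition_cells(1)[OF partition] by simp

lemma card_J: "card J = model_dim \<I> r"
  by (simp add: model_dim_def card_cartesian_product)

lemma card_J_pos: "0 < card J"
  using partition_cells(1,2)[OF partition] by (simp add: card_gt_0_iff card_cartesian_product)

lemma model_borel: "s \<in> piecewise_poly \<I> r \<Longrightarrow> s \<in> borel_measurable borel"
proof -
  assume "s \<in> piecewise_poly \<I> r"
  then obtain c where "\<And>x. s x = (\<Sum>j\<in>J. c j * b j x)" using b_span by blast
  then have "s = (\<lambda>x. \<Sum>j\<in>J. c j * b j x)" by blast
  then show ?thesis
    by (auto intro!: borel_measurable_sum borel_measurable_times b_measurable)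
qed

lemma model_bounded: "s \<in> piecewise_poly \<I> r \<Longrightarrow> \<exists>C. \<forall>x. \<bar>s x\<bar> \<le> C"
proof -
  assume "s \<in> piecewise_poly \<I> r"
  then obtain c where c: "\<And>x. s x = (\<Sum>j\<in>J. c j * b j x)" using b_span by blast
  have "\<bar>s x\<bar> \<le> (\<Sum>j\<in>J. \<bar>c j\<bar> * B)" for x
    unfolding c by (rule order_trans[OF sum_abs], rule sum_mono)
      (simp add: abs_mult mult_left_mono b_bound)
  then show ?thesis by blast
qed

lemma borel_PX: "f \<in> borel_measurable borel \<Longrightarrow> f \<in> borel_measurable PX" for f :: "real \<Rightarrow> real"
  using measurable_leb01 measurable_cong_sets[OF PX(2) refl] by auto

lemma model_integrable:
  assumes "s \<in> piecewise_poly \<I> r" "t \<in> piecewise_poly \<I> r"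
  shows "integrable PX (\<lambda>x. s x * t x)"
proof -
  interpret PX: prob_space PX by (rule PX)
  obtain C C' where C: "\<And>x. \<bar>s x\<bar> \<le> C" "\<And>x. \<bar>t x\<bar> \<le> C'" using model_bounded assms by meson
  show ?thesis
  proof (rule PX.integrable_const_bound[where B = "C * C'"])
    show "(\<lambda>x. s x * t x) \<in> borel_measurable PX"
      using assms by (intro borel_PX borel_measurable_times model_borel)
    show "AE x in PX. norm (s x * t x) \<le> C * C'"
      using C order_trans[OF abs_ge_zero C(1)] by (intro AE_I2) (auto simp: abs_mult intro!: mult_mono)
  qed
qed

lemma model_norm:
  assumes "\<And>x. s x = (\<Sum>j\<in>J. c j * b j x)"
  shows "(LINT x|PX. (s x)\<^sup>2) = (\<Sum>j\<in>J. (c j)\<^sup>2)"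
  unfolding assms
  by (rule integral_orthonormal_square(2)[OF _ finite_J b_orthonormal])
     (use model_integrable b_model in auto)

text \<open>The index type is arbitrary because both the block basis and the basis of
  \<open>K1_sq\<close> are expanded, each in terms of the other.\<close>

lemma orthonormal_expansion:
  assumes fin: "finite I" and model: "\<And>i. i \<in> I \<Longrightarrow> e i \<in> piecewise_poly \<I> r"
    and on: "\<And>i i'. i \<in> I \<Longrightarrow> i' \<in> I \<Longrightarrow> (LINT x|PX. e i x * e i' x) = (if i = i' then 1 else 0)"
    and s: "\<And>x. s x = (\<Sum>i\<in>I. c i * e i x)"
  shows "s x = (\<Sum>i\<in>I. (LINT y|PX. s y * e i y) * e i x)"
proof -
  have "(LINT y|PX. s y * e i y) = c i" if i: "i \<in> I" for i
  proof -
    have "(LINT y|PX. s y * e i y) = (LINT y|PX. (\<Sum>i'\<in>I. c i' * (e i' y * e i y)))"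
      by (simp add: s sum_distrib_right mult.assoc)
    also have "\<dots> = (\<Sum>i'\<in>I. c i' * (LINT y|PX. e i' y * e i y))"
      using model i model_integrable by (subst Bochner_Integration.integral_sum) auto
    also have "\<dots> = (\<Sum>i'\<in>I. if i' = i then c i else 0)"
      using i on by (intro sum.cong) auto
    finally show ?thesis using i fin by simp
  qed
  then show ?thesis using s by simp
qed

text \<open>This is the diagonal of the reproducing kernel of the model. Expanding each basis in the
  other writes both sides as the same double sum. It links \<open>K1_sq\<close>, computed in any
  basis, to the block basis used for concentration.\<close>

lemma kernel_diagonal_unique:
  assumes \<phi>: "orthonormal_basis PX (piecewise_poly \<I> r) D \<phi>"
  shows "(\<Sum>k<D. (\<phi> k x)\<^sup>2) = (\<Sum>j\<in>J. (b j x)\<^sup>2)"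
proof -
  have m: "\<phi> k \<in> piecewise_poly \<I> r" if "k < D" for k
    using \<phi> that by (auto simp: orthonormal_basis_def)
  have e1: "\<phi> k x = (\<Sum>j\<in>J. (LINT y|PX. \<phi> k y * b j y) * b j x)" if k: "k < D" for k x
  proof -
    obtain c where "\<And>x. \<phi> k x = (\<Sum>j\<in>J. c j * b j x)" using b_span[OF m[OF k]] by blast
    from orthonormal_expansion[OF finite_J b_model b_orthonormal this] show ?thesis .
  qed
  have e2: "b j x = (\<Sum>k<D. (LINT y|PX. b j y * \<phi> k y) * \<phi> k x)" if j: "j \<in> J" for j x
  proof -
    obtain c where "\<And>x. b j x = (\<Sum>k<D. c k * \<phi> k x)"
      using b_model[OF j] \<phi> unfolding orthonormal_basis_def by blast
    moreover have "(LINT x|PX. \<phi> k x * \<phi> k' x) = (if k = k' then 1 else 0)" if "k \<in> {..<D}" "k' \<in> {..<D}" for k k'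
      using \<phi> that by (auto simp: orthonormal_basis_def L2_inner_def)
    ultimately show ?thesis using m by (intro orthonormal_expansion) auto
  qed
  have "(\<Sum>k<D. (\<phi> k x)\<^sup>2) = (\<Sum>k<D. \<Sum>j\<in>J. (LINT y|PX. \<phi> k y * b j y) * b j x * \<phi> k x)"
    unfolding power2_eq_square sum_distrib_right[symmetric]
    by (intro sum.cong refl arg_cong[where f = "\<lambda>t. t * _"] e1) auto
  also have "\<dots> = (\<Sum>j\<in>J. b j x * (\<Sum>k<D. (LINT y|PX. b j y * \<phi> k y) * \<phi> k x))"
    by (subst sum.swap) (simp add: sum_distrib_left algebra_simps)
  also have "\<dots> = (\<Sum>j\<in>J. (b j x)\<^sup>2)"
    unfolding power2_eq_square
    by (intro sum.cong refl arg_cong[where f = "\<lambda>t. _ * t"] e2[symmetric])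
  finally show ?thesis .
qed

text \<open>Block diagonality turns the entrywise bound into an operator norm bound that does not involve
  the number of cells.\<close>

lemma gram_near_identity:
  assumes g: "\<And>j. j \<in> J \<Longrightarrow> g j = (\<Sum>j'\<in>J. c j' * \<Gamma> j j')"
    and cross: "\<And>I I' k l. I \<in> \<I> \<Longrightarrow> I' \<in> \<I> \<Longrightarrow> I \<noteq> I' \<Longrightarrow> \<Gamma> (I, k) (I', l) = (0 :: real)"
    and near: "\<And>I k l. I \<in> \<I> \<Longrightarrow> k \<le> r \<Longrightarrow> l \<le> r \<Longrightarrow> \<bar>\<Gamma> (I, k) (I, l) - (if k = l then 1 else 0)\<bar> \<le> \<eta>"
    and \<eta>: "0 \<le> \<eta>"
  shows "(\<Sum>j\<in>J. (g j - c j)\<^sup>2) \<le> (\<eta> * (real r + 1))\<^sup>2 * (\<Sum>j\<in>J. (c j)\<^sup>2)"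
proof -
  have "(g (I, k) - c (I, k))\<^sup>2 \<le> \<eta>\<^sup>2 * ((real r + 1) * (\<Sum>l\<le>r. (c (I, l))\<^sup>2))"
    if I: "I \<in> \<I>" and k: "k \<le> r" for I k
  proof -
    have "g (I, k) = (\<Sum>I'\<in>\<I>. \<Sum>l\<le>r. c (I', l) * \<Gamma> (I, k) (I', l))"
      using g[of "(I, k)"] I k by (simp add: sum.cartesian_product')
    also have "\<dots> = (\<Sum>I'\<in>\<I>. if I' = I then \<Sum>l\<le>r. c (I, l) * \<Gamma> (I, k) (I, l) else 0)"
      using cross[OF I] by (intro sum.cong) auto
    also have "\<dots> = (\<Sum>l\<le>r. c (I, l) * \<Gamma> (I, k) (I, l))"
      using I partition_cells(1)[OF partition] by simp
    finally have "g (I, k) - c (I, k) = (\<Sum>l\<le>r. c (I, l) * \<Gamma> (I, k) (I, l)) - (\<Sum>l\<le>r. if l = k then c (I, l) else 0)"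
      using k by simp
    also have "\<dots> = (\<Sum>l\<le>r. c (I, l) * (\<Gamma> (I, k) (I, l) - (if k = l then 1 else 0)))"
      unfolding sum_subtractf[symmetric] by (intro sum.cong) (auto simp: algebra_simps)
    finally have "\<bar>g (I, k) - c (I, k)\<bar> \<le> (\<Sum>l\<le>r. \<bar>c (I, l) * (\<Gamma> (I, k) (I, l) - (if k = l then 1 else 0))\<bar>)"
      using sum_abs by simp
    also have "\<dots> \<le> (\<Sum>l\<le>r. \<bar>c (I, l)\<bar> * \<eta>)"
      unfolding abs_mult using near[OF I k] by (intro sum_mono mult_left_mono) auto
    finally have "\<bar>g (I, k) - c (I, k)\<bar> \<le> \<eta> * (\<Sum>l\<le>r. \<bar>c (I, l)\<bar>)"
      by (simp add: sum_distrib_left mult.commute)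
    from power_mono[OF this, of 2] have "(g (I, k) - c (I, k))\<^sup>2 \<le> \<eta>\<^sup>2 * (\<Sum>l\<le>r. \<bar>c (I, l)\<bar>)\<^sup>2"
      by (simp add: power_mult_distrib)
    \<comment> \<open>Cauchy-Schwarz in one row of a block costs a factor r + 1; summing over the r
      + 1 rows costs another.\<close>
    also have "\<dots> \<le> \<eta>\<^sup>2 * ((real r + 1) * (\<Sum>l\<le>r. (c (I, l))\<^sup>2))"
      using Cauchy_Schwarz_ineq_sum[of "\<lambda>_. 1" "\<lambda>l. \<bar>c (I, l)\<bar>" "{..r}"]
      by (intro mult_left_mono) (auto simp: add.commute)
    finally show ?thesis .
  qed
  then have "(\<Sum>I\<in>\<I>. \<Sum>k\<le>r. (g (I, k) - c (I, k))\<^sup>2) \<le> (\<Sum>I\<in>\<I>. \<Sum>k\<le>r. \<eta>\<^sup>2 * ((real r + 1) * (\<Sum>l\<le>r. (c (I, l))\<^sup>2)))"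
    by (intro sum_mono) auto
  also have "\<dots> = (\<eta> * (real r + 1))\<^sup>2 * (\<Sum>I\<in>\<I>. \<Sum>l\<le>r. (c (I, l))\<^sup>2)"
    unfolding sum_distrib_left[of _ _ \<I>]
    by (intro sum.cong refl) (simp add: power2_eq_square add.commute)
  finally show ?thesis by (simp add: sum.cartesian_product')
qed

end

section \<open>Excess risks of the least-squares estimator\<close>

locale regression_model = block_basis "law_X P" \<I> r b B
  for P :: "(real \<times> real) measure" and \<I> r b B +
  fixes s \<sigma> s_M :: "real \<Rightarrow> real" and s_n :: "(nat \<Rightarrow> real \<times> real) \<Rightarrow> real \<Rightarrow> real"
    and A c_M c_min c_max :: real and n :: nat
  assumes common: "common_hyps A c_M c_min c_max r n P s \<sigma> \<I> s_M s_n"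
    and A_pos: "0 < A" and B_pos: "0 < B" and n_pos: "0 < n"
begin

abbreviation "M \<equiv> piecewise_poly \<I> r"

lemma law: "regression_law P s \<sigma>"
  and proj: "orth_projection (law_X P) M s s_M"
  and lse: "least_squares n P M s_n"
  and y_bound: "AE z in P. \<bar>snd z\<bar> \<le> A"
  and s_M_bound: "\<And>x. x \<in> {0..1} \<Longrightarrow> \<bar>s_M x\<bar> \<le> A"
  using common unfolding common_hyps_def by (auto simp: case_prod_beta')

sublocale P: prob_space P
  by (rule regression_law_prob_space(1)[OF law])

lemma sets_P[measurable_cong]: "sets P = sets data_space"
  by (rule regression_law_prob_space(2)[OF law])

lemma space_P: "space P = {0..1} \<times> UNIV"
  using sets_eq_imp_space_eq[OF sets_P] by (simp add: space_pair_measure)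

lemma fst_P[measurable]: "fst \<in> P \<rightarrow>\<^sub>M leb01"
  by measurable

lemma integral_law_X: "f \<in> borel_measurable borel \<Longrightarrow> (LINT x|law_X P. f x) = (LINT z|P. (f (fst z) :: real))"
  unfolding law_X_def by (intro integral_distr fst_P measurable_leb01)

lemma s_M_model: "s_M \<in> M"
  using proj by (simp add: orth_projection_def)

lemma fst_borel: "f \<in> borel_measurable borel \<Longrightarrow> (\<lambda>z. f (fst z) :: real) \<in> borel_measurable P"
  by (intro measurable_compose[OF fst_P] measurable_leb01)

definition w :: "real \<times> real \<Rightarrow> real"
  where "w z = snd z - s_M (fst z)"

text \<open>The truncation makes the almost sure bound on \<open>w\<close> hold everywhere, as \<open>sparse_scores\<close> requires.\<close>

definition w_trunc :: "real \<times> real \<Rightarrow> real"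
  where "w_trunc z = (if \<bar>w z\<bar> \<le> 2 * A then w z else 0)"

definition F :: "real set \<times> nat \<Rightarrow> real \<times> real \<Rightarrow> real"
  where "F j z = w_trunc z * b j (fst z)"

lemma w_measurable[measurable]: "w \<in> borel_measurable P"
proof -
  have [measurable]: "(\<lambda>z. s_M (fst z)) \<in> borel_measurable P"
    by (intro fst_borel model_borel s_M_model)
  show ?thesis unfolding w_def by measurable
qed

lemma w_trunc_measurable[measurable]: "w_trunc \<in> borel_measurable P"
  unfolding w_trunc_def by measurable

lemma b_measurable_P[measurable]: "j \<in> J \<Longrightarrow> (\<lambda>z. b j (fst z)) \<in> borel_measurable P"
  by (intro fst_borel b_measurable)

lemma w_trunc_bound: "\<bar>w_trunc z\<bar> \<le> 2 * A"
  using A_pos by (simp add: w_trunc_def)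

lemma w_trunc_eq: "z \<in> space P \<Longrightarrow> \<bar>snd z\<bar> \<le> A \<Longrightarrow> w_trunc z = w z"
  using s_M_bound[of "fst z"] by (auto simp: w_trunc_def w_def space_P)

lemma AE_w_trunc: "AE z in P. w_trunc z = w z"
  using y_bound AE_space by eventually_elim (rule w_trunc_eq)

text \<open>The residual w is the noise plus the bias s - s_M. The noise is centred given X, and the
  bias is orthogonal to the model.\<close>

lemma w_model_mean:
  assumes t: "t \<in> M"
  shows "(LINT z|P. w z * t (fst z)) = 0"
proof -
  obtain C where C: "\<And>x. \<bar>t x\<bar> \<le> C" using model_bounded[OF t] by blast
  have "(LINT z|P. (snd z - s_M (fst z)) * t (fst z)) = (LINT x|law_X P. (s x - s_M x) * t x)"
    by (rule regression_law_moments(1)[OF law y_bound _ _ _ s_M_bound, where C = C])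
       (use C t s_M_model in \<open>auto intro!: measurable_leb01 model_borel\<close>)
  also have "\<dots> = 0"
    using proj t by (auto simp: orth_projection_def L2_inner_def)
  finally show ?thesis by (simp add: w_def)
qed

text \<open>With |w| \<le> 2 A and |b| \<le> B each score is at most 2 A B. The point fst z lies in
  one cell, hence at most r + 1 nonzero scores. A linear combination of scores is w t(X) with t in
  the model, so its second moment is at most 4 A^2 times the squared norm of t, which Parseval's
  identity equates with that of the coefficients.\<close>

sublocale sc: sparse_scores P J F "2 * A * B" "4 * A\<^sup>2" "Suc r"
proof (unfold_locales)
  fix j assume j: "j \<in> J"
  show "F j \<in> borel_measurable P" unfolding F_def using j by measurable
  show "\<bar>F j z\<bar> \<le> 2 * A * B" for z
    unfolding F_def abs_mult using w_trunc_bound b_bound[OF j] A_pos by (intro mult_mono) auto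
  have "P.expectation (F j) = (LINT z|P. w z * b j (fst z))"
    unfolding F_def using AE_w_trunc j by (intro integral_cong_AE) (auto elim!: eventually_mono)
  then show "P.expectation (F j) = 0" using w_model_mean[OF b_model[OF j]] by simp
next
  show "finite J" by (rule finite_J)
  fix z assume z: "z \<in> space P"
  then obtain I where I: "I \<in> \<I>" "fst z \<in> I"
    using partition_cells(6)[OF partition, of "fst z"] by (auto simp: space_P)
  have "{j \<in> J. F j z \<noteq> 0} \<subseteq> {I} \<times> {..r}"
  proof
    fix j assume j: "j \<in> {j \<in> J. F j z \<noteq> 0}"
    obtain I' k where jk: "j = (I', k)" by force
    have "fst z \<in> I'" using j jk b_support[of "fst z" I' k] by (auto simp: F_def)
    then have "I' = I" using partition_cells(7)[OF partition] I j jk by auto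
    then show "j \<in> {I} \<times> {..r}" using j jk by auto
  qed
  from card_mono[OF _ this] show "card {j \<in> J. F j z \<noteq> 0} \<le> Suc r"
    by (simp add: card_cartesian_product)
next
  fix v :: "real set \<times> nat \<Rightarrow> real"
  define t where "t x = (\<Sum>j\<in>J. v j * b j x)" for x
  have tm: "t \<in> borel_measurable borel"
    unfolding t_def by (intro borel_measurable_sum borel_measurable_times b_measurable) auto
  have t2: "(\<lambda>x. (t x)\<^sup>2) \<in> borel_measurable borel" using tm by (intro borel_measurable_power)
  have tint: "integrable (law_X P) (\<lambda>x. (t x)\<^sup>2)"
    unfolding t_def
    by (rule integral_orthonormal_square(1)[OF _ finite_J b_orthonormal]) (use model_integrable b_model in auto)
  have tintP: "integrable P (\<lambda>z. (t (fst z))\<^sup>2)"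
    using tint unfolding law_X_def
    by (subst (asm) integrable_distr_eq) (auto intro: measurable_leb01 t2)
  have eq: "(\<Sum>j\<in>J. v j * F j z)\<^sup>2 = (w_trunc z)\<^sup>2 * (t (fst z))\<^sup>2" for z
    by (simp add: F_def t_def sum_distrib_left power_mult_distrib[symmetric] algebra_simps)
  have w2: "(w_trunc z)\<^sup>2 \<le> 4 * A\<^sup>2" for z
    using power_mono[OF w_trunc_bound, of z 2] by (simp add: power_mult_distrib)
  have "P.expectation (\<lambda>z. (\<Sum>j\<in>J. v j * F j z)\<^sup>2) \<le> P.expectation (\<lambda>z. 4 * A\<^sup>2 * (t (fst z))\<^sup>2)"
    unfolding eq
  proof (rule integral_mono)
    show "integrable P (\<lambda>z. (w_trunc z)\<^sup>2 * (t (fst z))\<^sup>2)"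
    proof (rule Bochner_Integration.integrable_bound)
      show "integrable P (\<lambda>z. 4 * A\<^sup>2 * (t (fst z))\<^sup>2)" using tintP by simp
      show "(\<lambda>z. (w_trunc z)\<^sup>2 * (t (fst z))\<^sup>2) \<in> borel_measurable P"
        using fst_borel[OF t2] by measurable
      show "AE z in P. norm ((w_trunc z)\<^sup>2 * (t (fst z))\<^sup>2) \<le> norm (4 * A\<^sup>2 * (t (fst z))\<^sup>2)"
        using w2 by (intro AE_I2) (auto intro!: mult_right_mono)
    qed
  qed (use tintP w2 in \<open>auto intro!: mult_right_mono\<close>)
  also have "\<dots> = 4 * A\<^sup>2 * (LINT x|law_X P. (t x)\<^sup>2)"
    by (simp add: integral_law_X[OF t2])
  also have "(LINT x|law_X P. (t x)\<^sup>2) = (\<Sum>j\<in>J. (v j)\<^sup>2)"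
    by (rule model_norm) (simp add: t_def)
  finally show "P.expectation (\<lambda>z. (\<Sum>j\<in>J. v j * F j z)\<^sup>2) \<le> 4 * A\<^sup>2 * (\<Sum>j\<in>J. (v j)\<^sup>2)" .
qed (use A_pos B_pos in auto)

section \<open>The empirical Gram matrix\<close>

definition \<Gamma> :: "(nat \<Rightarrow> real \<times> real) \<Rightarrow> real set \<times> nat \<Rightarrow> real set \<times> nat \<Rightarrow> real"
  where "\<Gamma> \<xi> j j' = (\<Sum>i<n. b j (fst (\<xi> i)) * b j' (fst (\<xi> i))) / real n"

text \<open>A product of two basis functions is at most B^2, and so is its second moment, because
  one factor is bounded by B and the other has norm 1. Only entries within a block are tested,
  \<open>card J\<close> times r + 1 in number; the others vanish identically.\<close>

lemma gram_concentration:
  assumes x: "0 < x"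
  defines "\<eta> \<equiv> (2 * sqrt (real n * B\<^sup>2 * x) + 2 * B\<^sup>2 * x) / real n"
  shows "\<exists>Bad\<in>sets (iid n P). measure (iid n P) Bad \<le> real (card J) * (real r + 1) * (2 * exp (- x)) \<and>
    (\<forall>\<xi>\<in>space (iid n P) - Bad. \<forall>I\<in>\<I>. \<forall>k\<le>r. \<forall>l\<le>r. \<bar>\<Gamma> \<xi> (I, k) (I, l) - (if k = l then 1 else 0)\<bar> < \<eta>)"
proof -
  interpret PP: prob_space "iid n P" by (intro prob_space_PiM P.prob_space_axioms)
  define bad where "bad a \<xi> \<longleftrightarrow> (case a of ((I, k), l) \<Rightarrow>
    \<bar>\<Gamma> \<xi> (I, k) (I, l) - (if k = l then 1 else 0)\<bar> \<ge> \<eta>)" for a \<xi>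
  have one: "{\<xi> \<in> space (iid n P). bad a \<xi>} \<in> sets (iid n P) \<and>
    \<P>(\<xi> in iid n P. bad a \<xi>) \<le> 2 * exp (- x)" if a: "a \<in> J \<times> {..r}" for a
  proof -
    obtain I k l where a_def: "a = ((I, k), l)" and Ikl: "I \<in> \<I>" "k \<le> r" "l \<le> r" using a by auto
    have jk: "(I, k) \<in> J" "(I, l) \<in> J" using Ikl by auto
    define g where "g z = b (I, k) (fst z) * b (I, l) (fst z)" for z :: "real \<times> real"
    have g[measurable]: "g \<in> borel_measurable P" unfolding g_def using jk by measurable
    have prodm: "(\<lambda>x. b (I, k) x * b (I, l) x) \<in> borel_measurable borel"
      using jk by (intro borel_measurable_times b_measurable)
    have Eg: "(LINT z|P. g z) = (if k = l then 1 else 0)"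
      using b_orthonormal[OF jk] unfolding g_def by (subst (asm) integral_law_X[OF prodm]) simp
    have gB: "\<bar>g z\<bar> \<le> B\<^sup>2" for z
      unfolding g_def abs_mult power2_eq_square using b_bound[OF jk(1)] b_bound[OF jk(2)] B_pos
      by (intro mult_mono) auto
    have g2: "(LINT z|P. (g z)\<^sup>2) \<le> B\<^sup>2"
    proof -
      have sqm: "(\<lambda>x. (b (I, k) x)\<^sup>2) \<in> borel_measurable borel"
        using jk by (intro borel_measurable_power b_measurable)
      have bint: "integrable P (\<lambda>z. (b (I, k) (fst z))\<^sup>2)"
        by (rule P.bounded_square_integrable[where C = B]) (use jk b_bound in \<open>auto intro!: AE_I2 b_measurable_P\<close>)
      have "(LINT z|P. (g z)\<^sup>2) \<le> (LINT z|P. B\<^sup>2 * (b (I, k) (fst z))\<^sup>2)"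
      proof (rule integral_mono)
        show "integrable P (\<lambda>z. (g z)\<^sup>2)"
          by (rule P.bounded_square_integrable[OF g, where C = "B\<^sup>2"]) (use gB in auto)
        show "(g z)\<^sup>2 \<le> B\<^sup>2 * (b (I, k) (fst z))\<^sup>2" for z
          using power_mono[OF b_bound[OF jk(2), of "fst z"], of 2]
          by (simp add: g_def power_mult_distrib mult.commute[of "B\<^sup>2"] mult_left_mono)
      qed (use bint in auto)
      also have "\<dots> = B\<^sup>2 * (LINT x|law_X P. (b (I, k) x)\<^sup>2)"
        by (simp add: integral_law_X[OF sqm])
      also have "\<dots> = B\<^sup>2" using b_orthonormal[OF jk(1) jk(1)] by (simp add: power2_eq_square)
      finally show ?thesis .
    qed
    have eq: "bad a \<xi> \<longleftrightarrow> \<bar>(\<Sum>i<n. g (\<xi> i)) - real n * (LINT z|P. g z)\<bar> \<ge> 2 * sqrt (real n * B\<^sup>2 * x) + 2 * B\<^sup>2 * x" for \<xi>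
    proof -
      have "\<Gamma> \<xi> (I, k) (I, l) - (if k = l then 1 else 0) = ((\<Sum>i<n. g (\<xi> i)) - real n * (LINT z|P. g z)) / real n"
        using n_pos by (simp add: \<Gamma>_def g_def[symmetric] Eg diff_divide_distrib)
      then show ?thesis using n_pos by (simp add: bad_def a_def \<eta>_def divide_le_cancel)
    qed
    have "(\<lambda>\<xi>. \<Sum>i<n. g (\<xi> i)) \<in> borel_measurable (iid n P)"
      by (intro borel_measurable_sum measurable_compose[OF _ g] measurable_component_singleton) auto
    then have "{\<xi> \<in> space (iid n P). bad a \<xi>} \<in> sets (iid n P)"
      unfolding eq by measurable
    moreover have "\<P>(\<xi> in iid n P. bad a \<xi>) \<le> 2 * exp (- x)"
      unfolding eq using bernstein_abs[OF P.prob_space_axioms g gB g2 _ _ x n_pos order_refl] B_pos by simp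
    ultimately show ?thesis by simp
  qed
  have "finite (J \<times> {..r})" using finite_J by simp
  from PP.union_bound[of _ bad, OF this conjunct1[OF one] conjunct2[OF one]] obtain Bad where
    "Bad \<in> PP.events" "PP.prob Bad \<le> real (card (J \<times> {..r})) * (2 * exp (- x))"
    and good: "\<And>\<xi> a. \<xi> \<in> space (iid n P) - Bad \<Longrightarrow> a \<in> J \<times> {..r} \<Longrightarrow> \<not> bad a \<xi>" by blast
  moreover have "\<bar>\<Gamma> \<xi> (I, k) (I, l) - (if k = l then 1 else 0)\<bar> < \<eta>"
    if "\<xi> \<in> space (iid n P) - Bad" "I \<in> \<I>" "k \<le> r" "l \<le> r" for \<xi> I k l
    using good[OF that(1), of "((I, k), l)"] that by (simp add: bad_def not_le)
  ultimately show ?thesis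
    by (intro bexI[of _ Bad]) (simp_all add: card_cartesian_product algebra_simps)
qed

section \<open>Normal equations and exact formulas for the excess risks\<close>

lemma s_n_model: "\<xi> \<in> space (sample n P) \<Longrightarrow> s_n \<xi> \<in> M"
  using lse by (auto simp: least_squares_def is_arg_min_def)

text \<open>The model is a linear space, so the estimator can be perturbed by any multiple of u. The
  increase of the empirical contrast is a quadratic in that multiple without constant term; as it is
  never negative, its linear coefficient vanishes.\<close>

lemma normal_equation:
  assumes \<xi>: "\<xi> \<in> space (sample n P)" and u: "u \<in> M"
  shows "(\<Sum>i<n. (snd (\<xi> i) - s_n \<xi> (fst (\<xi> i))) * u (fst (\<xi> i))) = 0"
proof -
  define e where "e i = snd (\<xi> i) - s_n \<xi> (fst (\<xi> i))" for i
  define v where "v i = u (fst (\<xi> i))" for i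
  show ?thesis
    unfolding e_def[symmetric] v_def[symmetric]
  proof (rule linear_coefficient_zero)
    show "0 \<le> (\<Sum>i<n. (v i)\<^sup>2)" by (intro sum_nonneg) auto
    fix \<theta>
    have "(\<lambda>x. s_n \<xi> x + \<theta> * u x) \<in> M"
      by (intro piecewise_poly_add_scaled s_n_model \<xi> u)
    then have "\<not> empirical n \<xi> (contrast (\<lambda>x. s_n \<xi> x + \<theta> * u x)) < empirical n \<xi> (contrast (s_n \<xi>))"
      using lse \<xi> by (auto simp: least_squares_def is_arg_min_def)
    then have "(\<Sum>i<n. (e i)\<^sup>2) \<le> (\<Sum>i<n. (e i - \<theta> * v i)\<^sup>2)"
      using n_pos by (simp add: empirical_def contrast_def case_prod_beta' e_def v_def not_less
          divide_le_cancel algebra_simps)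
    also have "\<dots> = (\<Sum>i<n. (e i)\<^sup>2) + ((\<Sum>i<n. (v i)\<^sup>2) * \<theta>\<^sup>2 - 2 * (\<Sum>i<n. e i * v i) * \<theta>)"
      by (simp add: power2_diff sum.distrib sum_subtractf sum_distrib_left sum_distrib_right
          power_mult_distrib algebra_simps)
    finally show "0 \<le> (\<Sum>i<n. (v i)\<^sup>2) * \<theta>\<^sup>2 - 2 * (\<Sum>i<n. e i * v i) * \<theta>" by simp
  qed
qed

lemma model_integrable_P:
  assumes t: "t \<in> M"
  shows "integrable P (\<lambda>z. (t (fst z))\<^sup>2)" "integrable P (\<lambda>z. w z * t (fst z))"
proof -
  obtain C where C: "\<And>x. \<bar>t x\<bar> \<le> C" using model_bounded[OF t] by blast
  have tm[measurable]: "(\<lambda>z. t (fst z)) \<in> borel_measurable P" by (intro fst_borel model_borel t)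
  show t2: "integrable P (\<lambda>z. (t (fst z))\<^sup>2)"
    by (rule P.bounded_square_integrable[OF tm, where C = C]) (use C in auto)
  have "AE z in P. \<bar>w z\<bar> \<le> 2 * A"
    using AE_w_trunc by eventually_elim (metis w_trunc_bound)
  then have "integrable P (\<lambda>z. (w z)\<^sup>2)" by (rule P.bounded_square_integrable[OF w_measurable])
  then show "integrable P (\<lambda>z. w z * t (fst z))"
    using t2 by (intro integrable_mult_of_squares) measurable
qed

lemma excess_representation:
  assumes \<xi>: "\<xi> \<in> space (sample n P)" and y: "\<And>i. i < n \<Longrightarrow> \<bar>snd (\<xi> i)\<bar> \<le> A"
    and c: "\<And>x. s_n \<xi> x - s_M x = (\<Sum>j\<in>J. c j * b j x)"
  defines "g \<equiv> (\<lambda>j. sc.S n \<xi> j / real n)"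
  shows "\<And>j. j \<in> J \<Longrightarrow> g j = (\<Sum>j'\<in>J. c j' * \<Gamma> \<xi> j j')"
    and "true_excess P (s_n \<xi>) s_M = (\<Sum>j\<in>J. (c j)\<^sup>2)"
    and "empirical_excess n \<xi> (s_n \<xi>) s_M = (\<Sum>j\<in>J. c j * g j)"
proof -
  define t where "t x = s_n \<xi> x - s_M x" for x
  have "t = (\<lambda>x. s_n \<xi> x + (- 1) * s_M x)" by (simp add: t_def fun_eq_iff)
  then have t: "t \<in> M"
    by (simp only: piecewise_poly_add_scaled[OF s_n_model[OF \<xi>] s_M_model])
  have \<xi>P: "\<xi> i \<in> space P" if "i < n" for i
    using \<xi> that by (auto simp: sample_def space_PiM PiE_def)
  have w: "w_trunc (\<xi> i) = w (\<xi> i)" if "i < n" for i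
    using w_trunc_eq[OF \<xi>P y] that by simp
  have g: "g j = (\<Sum>i<n. w (\<xi> i) * b j (fst (\<xi> i))) / real n" for j
    unfolding g_def sc.S_def F_def using w by simp
  have normal: "(\<Sum>i<n. w (\<xi> i) * u (fst (\<xi> i))) = (\<Sum>i<n. t (fst (\<xi> i)) * u (fst (\<xi> i)))" if "u \<in> M" for u
  proof -
    have "(\<Sum>i<n. w (\<xi> i) * u (fst (\<xi> i)) - t (fst (\<xi> i)) * u (fst (\<xi> i))) = 0"
      using normal_equation[OF \<xi> that] by (simp add: w_def t_def algebra_simps)
    then show ?thesis by (simp add: sum_subtractf)
  qed
  show "g j = (\<Sum>j'\<in>J. c j' * \<Gamma> \<xi> j j')" if "j \<in> J" for j
  proof -
    have "(\<Sum>i<n. w (\<xi> i) * b j (fst (\<xi> i))) = (\<Sum>i<n. \<Sum>j'\<in>J. c j' * (b j (fst (\<xi> i)) * b j' (fst (\<xi> i))))"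
      using normal[OF b_model[OF that]] by (simp add: t_def c sum_distrib_left mult.commute mult.left_commute)
    also have "\<dots> = (\<Sum>j'\<in>J. c j' * (\<Sum>i<n. b j (fst (\<xi> i)) * b j' (fst (\<xi> i))))"
      by (subst sum.swap) (simp add: sum_distrib_left)
    finally show ?thesis unfolding g \<Gamma>_def by (simp only: sum_divide_distrib[of _ J] times_divide_eq_right)
  qed
  have tsum: "t x = (\<Sum>j\<in>J. c j * b j x)" for x by (simp add: t_def c)
  have t2m: "(\<lambda>x. (t x)\<^sup>2) \<in> borel_measurable borel"
    using model_borel[OF t] by (rule borel_measurable_power)
  \<comment> \<open>The difference of contrasts is t^2 - 2 w t, whose cross term has mean 0 because
    t belongs to the model.\<close>
  have "true_excess P (s_n \<xi>) s_M = (LINT z|P. (t (fst z))\<^sup>2 - 2 * (w z * t (fst z)))"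
    unfolding true_excess_def contrast_def
    by (intro Bochner_Integration.integral_cong refl)
      (simp add: case_prod_beta' w_def t_def power2_eq_square algebra_simps)
  also have "\<dots> = (LINT z|P. (t (fst z))\<^sup>2)"
    using model_integrable_P[OF t] w_model_mean[OF t] by simp
  also have "\<dots> = (\<Sum>j\<in>J. (c j)\<^sup>2)"
    using model_norm[OF tsum] by (simp add: integral_law_X[OF t2m])
  finally show "true_excess P (s_n \<xi>) s_M = (\<Sum>j\<in>J. (c j)\<^sup>2)" .
  have "empirical_excess n \<xi> (s_n \<xi>) s_M
      = (\<Sum>i<n. 2 * (w (\<xi> i) * t (fst (\<xi> i))) - t (fst (\<xi> i)) * t (fst (\<xi> i))) / real n"
    unfolding empirical_excess_def empirical_def contrast_def
    by (simp add: case_prod_beta' w_def t_def power2_eq_square algebra_simps)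
  \<comment> \<open>The sum of 2 w t - t^2 collapses, because the normal equations in the direction
    t equate the sums of t^2 and of w t.\<close>
  also have "\<dots> = (\<Sum>i<n. w (\<xi> i) * t (fst (\<xi> i))) / real n"
    using normal[OF t] by (simp add: sum_subtractf sum_distrib_left[symmetric])
  also have "(\<Sum>i<n. w (\<xi> i) * t (fst (\<xi> i))) = (\<Sum>i<n. \<Sum>j\<in>J. c j * (w (\<xi> i) * b j (fst (\<xi> i))))"
    by (simp add: tsum sum_distrib_left algebra_simps)
  also have "\<dots> = (\<Sum>j\<in>J. c j * (\<Sum>i<n. w (\<xi> i) * b j (fst (\<xi> i))))"
    by (subst sum.swap) (simp add: sum_distrib_left)
  finally show "empirical_excess n \<xi> (s_n \<xi>) s_M = (\<Sum>j\<in>J. c j * g j)"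
    unfolding g by (simp only: sum_divide_distrib[of _ J] times_divide_eq_right)
qed

text \<open>\<open>g\<close> is to be read as the squared norm of the vector P_n(psi b_j), that is
  \<open>sc.Q n \<xi>\<close> divided by n^2; \<open>K\<close> and \<open>dev\<close> are the bounds
  before this division.\<close>

definition near_excess :: "real \<Rightarrow> real \<Rightarrow> real \<Rightarrow> (nat \<Rightarrow> real \<times> real) \<Rightarrow> real \<Rightarrow> bool"
  where "near_excess K dev \<delta> \<xi> g \<longleftrightarrow> 0 \<le> g \<and> g \<le> K / (real n)\<^sup>2 \<and>
      \<bar>g - P.expectation sc.G / real n\<bar> \<le> dev / (real n)\<^sup>2 \<and>
      \<bar>true_excess P (s_n \<xi>) s_M - g\<bar> \<le> 6 * \<delta> * g \<and>
      \<bar>empirical_excess n \<xi> (s_n \<xi>) s_M - g\<bar> \<le> 2 * \<delta> * g"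

text \<open>This joins three exceptional sets: large deviations of the squared norm, deviations of
  the Gram matrix, and a null set. Outside them \<open>gram_near_identity\<close> and
  \<open>near_vector\<close> apply to the normal equations.\<close>

theorem excess_concentration:
  fixes K :: real
  assumes x: "0 < x"
  defines "\<delta> \<equiv> (2 * sqrt (real n * B\<^sup>2 * x) + 2 * B\<^sup>2 * x) / real n * (real r + 1)"
  defines "R \<equiv> 2 * sqrt (real n * (4 * A\<^sup>2) * x) + 2 * (2 * A * B) * x"
  defines "T \<equiv> 2 * sqrt (real n * (4 * A\<^sup>2 * K) * x) + (real (Suc r) * (R * (2 * A * B))) * x"
  defines "U \<equiv> 2 * sqrt (real n * (real (Suc r) * (2 * A * B)\<^sup>2)\<^sup>2 * x) + 2 * (real (Suc r) * (2 * A * B)\<^sup>2) * x"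
  assumes K: "real n * (real (Suc r) * (2 * A * B)\<^sup>2) + 2 * T \<le> K" "0 < K" and \<delta>: "\<delta> \<le> 1 / 2"
  obtains Bad \<gamma> where "Bad \<in> sets (sample n P)"
    "measure (sample n P) Bad \<le>
      (real (card J) * (real n + 1) + (real n + 1) + 1 + real (card J) * (real r + 1)) * (2 * exp (- x))"
    "\<And>\<xi>. \<xi> \<in> space (sample n P) - Bad \<Longrightarrow> near_excess K (2 * T + U) \<delta> \<xi> (\<gamma> \<xi>)"
proof -
  interpret PP: prob_space "iid n P" by (intro prob_space_PiM P.prob_space_axioms)
  obtain B1 where B1: "B1 \<in> PP.events"
    "PP.prob B1 \<le> (real (card J) * (real n + 1) + (real n + 1) + 1) * (2 * exp (- x))"
    "\<And>\<xi>. \<xi> \<in> space (iid n P) - B1 \<Longrightarrow> sc.Q n \<xi> \<le> K"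
    "\<And>\<xi>. \<xi> \<in> space (iid n P) - B1 \<Longrightarrow> \<bar>sc.Q n \<xi> - real n * P.expectation sc.G\<bar> \<le> 2 * T + U"
    using sc.Q_concentration[OF x n_pos, of K, folded R_def, folded T_def, folded U_def, OF K] by blast
  define \<eta> where "\<eta> = (2 * sqrt (real n * B\<^sup>2 * x) + 2 * B\<^sup>2 * x) / real n"
  have \<eta>: "0 \<le> \<eta>" unfolding \<eta>_def using x by (intro divide_nonneg_nonneg add_nonneg_nonneg) auto
  obtain B2 where B2: "B2 \<in> PP.events" "PP.prob B2 \<le> real (card J) * (real r + 1) * (2 * exp (- x))"
    and near: "\<And>\<xi> I k l. \<xi> \<in> space (iid n P) - B2 \<Longrightarrow> I \<in> \<I> \<Longrightarrow> k \<le> r \<Longrightarrow> l \<le> r \<Longrightarrow>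
      \<bar>\<Gamma> \<xi> (I, k) (I, l) - (if k = l then 1 else 0)\<bar> < \<eta>"
    using gram_concentration[OF x, folded \<eta>_def] by blast
  \<comment> \<open>Off a null set all observed Y_i are bounded by A, so \<open>w_trunc\<close> and
    \<open>w\<close> agree at the sample points.\<close>
  have "AE \<xi> in iid n P. \<forall>i\<in>{..<n}. \<bar>snd (\<xi> i)\<bar> \<le> A"
    using AE_PiM_component[of "{..<n}" "\<lambda>_. P", OF P.prob_space_axioms _ y_bound]
    by (intro AE_finite_allI) auto
  then obtain B3 where B3: "B3 \<in> null_sets (iid n P)"
    "{\<xi> \<in> space (iid n P). \<not> (\<forall>i\<in>{..<n}. \<bar>snd (\<xi> i)\<bar> \<le> A)} \<subseteq> B3"
    by (auto simp: eventually_ae_filter)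
  have B3p: "PP.prob B3 = 0" "B3 \<in> PP.events"
    using B3(1) by (auto simp: measure_eq_0_null_sets)
  define Bad where "Bad = B1 \<union> B2 \<union> B3"
  have "PP.prob Bad \<le> PP.prob B1 + PP.prob B2 + PP.prob B3"
    unfolding Bad_def using B1 B2 B3p
    by (intro order_trans[OF measure_Un_le] add_mono measure_Un_le order_refl) auto
  then have prob: "PP.prob Bad \<le>
      (real (card J) * (real n + 1) + (real n + 1) + 1 + real (card J) * (real r + 1)) * (2 * exp (- x))"
    using B1(2) B2(2) B3p by (simp add: distrib_right)
  define \<gamma> where "\<gamma> \<xi> = sc.Q n \<xi> / (real n)\<^sup>2" for \<xi>
  have main: "near_excess K (2 * T + U) \<delta> \<xi> (\<gamma> \<xi>)"
    if \<xi>: "\<xi> \<in> space (sample n P) - Bad" for \<xi>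
  proof -
    have \<xi>': "\<xi> \<in> space (iid n P) - B1" using \<xi> by (auto simp: sample_def Bad_def)
    have y: "\<bar>snd (\<xi> i)\<bar> \<le> A" if "i < n" for i
      using \<xi> B3(2) that unfolding sample_def Bad_def by blast
    have near': "\<bar>\<Gamma> \<xi> (I, k) (I, l) - (if k = l then 1 else 0)\<bar> \<le> \<eta>" if "I \<in> \<I>" "k \<le> r" "l \<le> r" for I k l
      using less_imp_le[OF near[of \<xi>, OF _ that]] \<xi>' \<xi> by (simp add: Bad_def)
    have cross: "\<Gamma> \<xi> (I, k) (I', l) = 0" if "I \<in> \<I>" "I' \<in> \<I>" "I \<noteq> I'" for I I' k l
    proof -
      have zero: "b (I, k) z * b (I', l) z = 0" for z
        using b_support[of z I k] b_support[of z I' l] partition_cells(7)[OF partition that(1,2), of z] that(3)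
        by auto
      show ?thesis unfolding \<Gamma>_def by (simp only: zero sum.neutral_const div_0)
    qed
    define t where "t x = s_n \<xi> x - s_M x" for x
    have "t = (\<lambda>x. s_n \<xi> x + (- 1) * s_M x)" by (simp add: t_def fun_eq_iff)
    moreover have "\<dots> \<in> M" using \<xi> by (intro piecewise_poly_add_scaled s_n_model s_M_model) auto
    ultimately have "t \<in> M" by simp
    then obtain c where c: "\<And>x. s_n \<xi> x - s_M x = (\<Sum>j\<in>J. c j * b j x)"
      using b_span[of t] unfolding t_def by blast
    have \<xi>'': "\<xi> \<in> space (sample n P)" using \<xi> by simp
    define g where "g j = sc.S n \<xi> j / real n" for j
    have coeff: "g j = (\<Sum>j'\<in>J. c j' * \<Gamma> \<xi> j j')" if "j \<in> J" for j
      unfolding g_def by (rule excess_representation(1)[OF \<xi>'' y c that])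
    have true_eq: "true_excess P (s_n \<xi>) s_M = (\<Sum>j\<in>J. (c j)\<^sup>2)"
      by (rule excess_representation(2)[OF \<xi>'' y c])
    have emp_eq: "empirical_excess n \<xi> (s_n \<xi>) s_M = (\<Sum>j\<in>J. c j * g j)"
      unfolding g_def by (rule excess_representation(3)[OF \<xi>'' y c])
    have g2: "(\<Sum>j\<in>J. (g j)\<^sup>2) = \<gamma> \<xi>"
      by (simp add: g_def \<gamma>_def sc.Q_def power_divide sum_divide_distrib)
    have nearv: "(\<Sum>j\<in>J. (g j - c j)\<^sup>2) \<le> \<delta>\<^sup>2 * (\<Sum>j\<in>J. (c j)\<^sup>2)"
      unfolding \<delta>_def \<eta>_def[symmetric]
      by (rule gram_near_identity[OF coeff cross near' \<eta>])
    have \<delta>0: "0 \<le> \<delta>" unfolding \<delta>_def \<eta>_def[symmetric] using \<eta> by simp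
    have "\<bar>true_excess P (s_n \<xi>) s_M - \<gamma> \<xi>\<bar> \<le> 6 * \<delta> * \<gamma> \<xi>"
      using near_vector(1)[OF nearv \<delta>0 \<delta>] unfolding true_eq g2 .
    moreover have "\<bar>empirical_excess n \<xi> (s_n \<xi>) s_M - \<gamma> \<xi>\<bar> \<le> 2 * \<delta> * \<gamma> \<xi>"
      using near_vector(2)[OF nearv \<delta>0 \<delta>] unfolding emp_eq g2 .
    moreover have "0 \<le> \<gamma> \<xi>" unfolding g2[symmetric] by (intro sum_nonneg) auto
    moreover have "\<gamma> \<xi> \<le> K / (real n)\<^sup>2"
      unfolding \<gamma>_def using B1(3)[OF \<xi>'] by (intro divide_right_mono) auto
    moreover have "\<gamma> \<xi> - P.expectation sc.G / real n = (sc.Q n \<xi> - real n * P.expectation sc.G) / (real n)\<^sup>2"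
      using n_pos by (simp add: \<gamma>_def diff_divide_distrib power2_eq_square)
    then have "\<bar>\<gamma> \<xi> - P.expectation sc.G / real n\<bar> \<le> (2 * T + U) / (real n)\<^sup>2"
      using B1(4)[OF \<xi>'] by (simp add: divide_right_mono)
    ultimately show ?thesis by (simp add: near_excess_def)
  qed
  show thesis
    by (rule that[of Bad \<gamma>]) (use prob main B1 B2 B3p in \<open>auto simp: Bad_def sample_def\<close>)
qed

section \<open>The mean of the squared norm\<close>

lemma expectation_G:
  "P.expectation sc.G = (LINT z|P. (w z)\<^sup>2 * (\<Sum>j\<in>J. (b j (fst z))\<^sup>2))"
proof -
  have eq: "sc.G z = (w_trunc z)\<^sup>2 * (\<Sum>j\<in>J. (b j (fst z))\<^sup>2)" for z
    by (simp add: sc.G_def F_def power_mult_distrib sum_distrib_left)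
  have [measurable]: "(\<lambda>z. \<Sum>j\<in>J. (b j (fst z))\<^sup>2) \<in> borel_measurable P"
    by (intro borel_measurable_sum borel_measurable_power b_measurable_P)
  show ?thesis
    unfolding eq using AE_w_trunc by (intro integral_cong_AE) (auto elim!: eventually_mono)
qed

text \<open>Since \<open>psi1\<close> is -2 w and w is orthogonal to the model, each variance is
  four times a second moment. Their sum is four times the mean of w^2 times the kernel diagonal,
  which does not depend on the basis.\<close>

lemma expectation_G_eq_K1:
  assumes \<phi>: "orthonormal_basis (law_X P) M (model_dim \<I> r) \<phi>"
  shows "P.expectation sc.G = 1 / 4 * (real (model_dim \<I> r) * K1_sq P s_M (model_dim \<I> r) \<phi>)"
proof -
  define D where "D = model_dim \<I> r"
  have D: "0 < real D" using card_J card_J_pos by (simp add: D_def)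
  have m: "\<phi> k \<in> M" if "k < D" for k using \<phi> that by (auto simp: orthonormal_basis_def D_def)
  have var: "P.variance (\<lambda>(x, y). psi1 s_M (x, y) * \<phi> k x) = 4 * (LINT z|P. (w z)\<^sup>2 * (\<phi> k (fst z))\<^sup>2)"
    if k: "k < D" for k
  proof -
    have eq: "(\<lambda>(x, y). psi1 s_M (x, y) * \<phi> k x) = (\<lambda>z. - 2 * (w z * \<phi> k (fst z)))"
      by (auto simp: psi1_def w_def fun_eq_iff algebra_simps)
    have "P.expectation (\<lambda>z. - 2 * (w z * \<phi> k (fst z))) = 0"
      using w_model_mean[OF m[OF k]] by simp
    then show ?thesis unfolding eq by (simp add: power_mult_distrib)
  qed
  have int: "integrable P (\<lambda>z. (w z)\<^sup>2 * (\<phi> k (fst z))\<^sup>2)" if k: "k < D" for k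
  proof -
    obtain C where C: "\<And>x. \<bar>\<phi> k x\<bar> \<le> C" using model_bounded[OF m[OF k]] by blast
    have [measurable]: "(\<lambda>z. \<phi> k (fst z)) \<in> borel_measurable P" by (intro fst_borel model_borel m k)
    have "integrable P (\<lambda>z. (w z * \<phi> k (fst z))\<^sup>2)"
    proof (rule P.bounded_square_integrable[where C = "2 * A * C"])
      show "AE z in P. \<bar>w z * \<phi> k (fst z)\<bar> \<le> 2 * A * C"
        using AE_w_trunc
      proof eventually_elim
        case (elim z)
        then have "\<bar>w z\<bar> \<le> 2 * A" by (metis w_trunc_bound)
        then show ?case unfolding abs_mult using C A_pos by (intro mult_mono) auto
      qed
    qed measurable
    then show ?thesis by (simp add: power_mult_distrib)
  qed
  have "real D * K1_sq P s_M D \<phi> = (\<Sum>k<D. 4 * (LINT z|P. (w z)\<^sup>2 * (\<phi> k (fst z))\<^sup>2))"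
    using D var by (simp add: K1_sq_def)
  also have "\<dots> = 4 * (\<Sum>k<D. (LINT z|P. (w z)\<^sup>2 * (\<phi> k (fst z))\<^sup>2))"
    by (simp add: sum_distrib_left)
  also have "(\<Sum>k<D. (LINT z|P. (w z)\<^sup>2 * (\<phi> k (fst z))\<^sup>2)) = (LINT z|P. (\<Sum>k<D. (w z)\<^sup>2 * (\<phi> k (fst z))\<^sup>2))"
    using int by (intro Bochner_Integration.integral_sum[symmetric]) auto
  also have "\<dots> = P.expectation sc.G"
    unfolding expectation_G sum_distrib_left[symmetric] using kernel_diagonal_unique[OF \<phi>] by (simp add: D_def)
  finally show ?thesis by (simp add: D_def)
qed

text \<open>The kernel diagonal integrates to the dimension, one unit per basis function. The
  resulting lower bound of order D on the mean is what turns absolute errors into relative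
  ones.\<close>

lemma expectation_G_ge:
  assumes \<sigma>: "AE x in law_X P. \<sigma>_min \<le> \<sigma> x" "0 < \<sigma>_min"
  shows "\<sigma>_min\<^sup>2 * real (model_dim \<I> r) \<le> P.expectation sc.G"
proof -
  define u where "u x = (\<Sum>j\<in>J. (b j x)\<^sup>2)" for x
  have u: "u \<in> borel_measurable borel"
    unfolding u_def by (intro borel_measurable_sum borel_measurable_power b_measurable)
  have uC: "\<bar>u x\<bar> \<le> (\<Sum>j\<in>J. B\<^sup>2)" for x
  proof -
    have "u x \<le> (\<Sum>j\<in>J. B\<^sup>2)" unfolding u_def
    proof (rule sum_mono)
      fix j assume "j \<in> J"
      from power_mono[OF b_bound[OF this, of x], of 2] show "(b j x)\<^sup>2 \<le> B\<^sup>2" by simp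
    qed
    moreover have "0 \<le> u x" unfolding u_def by (intro sum_nonneg) auto
    ultimately show ?thesis by simp
  qed
  have "(LINT x|law_X P. u x) = (\<Sum>j\<in>J. (LINT x|law_X P. (b j x)\<^sup>2))"
    unfolding u_def using model_integrable[OF b_model b_model]
    by (intro Bochner_Integration.integral_sum) (simp add: power2_eq_square)
  also have "\<dots> = (\<Sum>j\<in>J. 1)"
    using b_orthonormal by (intro sum.cong) (simp_all add: power2_eq_square)
  finally have "\<sigma>_min\<^sup>2 * real (model_dim \<I> r) = \<sigma>_min\<^sup>2 * (LINT x|law_X P. u x)"
    using card_J by simp
  also have "\<dots> \<le> (LINT z|P. (snd z - s_M (fst z))\<^sup>2 * u (fst z))"
  proof (rule regression_law_moments(2)[OF law y_bound])
    show "s_M \<in> borel_measurable leb01" by (intro measurable_leb01 model_borel s_M_model)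
    show "u \<in> borel_measurable leb01" by (intro measurable_leb01 u)
    show "0 \<le> u x" for x unfolding u_def by (intro sum_nonneg) auto
  qed (use uC s_M_bound \<sigma> in auto)
  finally show ?thesis by (simp add: expectation_G w_def u_def)
qed

text \<open>A probability can be bounded from below only for measurable events, because
  \<open>measure\<close> is 0 on other sets. The joint measurability in \<open>least_squares\<close>
  supplies this, by composition and by integration in the second variable.\<close>

lemma excess_measurable:
  "(\<lambda>\<xi>. true_excess P (s_n \<xi>) s_M) \<in> borel_measurable (sample n P)"
  "(\<lambda>\<xi>. empirical_excess n \<xi> (s_n \<xi>) s_M) \<in> borel_measurable (sample n P)"
proof -
  have sn: "(\<lambda>(\<xi>, x). s_n \<xi> x) \<in> borel_measurable (sample n P \<Otimes>\<^sub>M leb01)"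
    using lse by (simp add: least_squares_def)
  have sM[measurable]: "s_M \<in> borel_measurable leb01" by (intro measurable_leb01 model_borel s_M_model)
  have c1: "(\<lambda>p. s_n (fst p) (fst (snd p))) \<in> borel_measurable (sample n P \<Otimes>\<^sub>M P)"
  proof -
    have "(\<lambda>p. (fst p, fst (snd p))) \<in> sample n P \<Otimes>\<^sub>M P \<rightarrow>\<^sub>M sample n P \<Otimes>\<^sub>M leb01" by measurable
    from measurable_compose[OF this sn] show ?thesis by simp
  qed
  have "(\<lambda>p. contrast (s_n (fst p)) (snd p) - contrast s_M (snd p)) \<in> borel_measurable (sample n P \<Otimes>\<^sub>M P)"
    unfolding contrast_def case_prod_beta' using c1 by measurable
  then show "(\<lambda>\<xi>. true_excess P (s_n \<xi>) s_M) \<in> borel_measurable (sample n P)"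
    unfolding true_excess_def
    by (intro P.borel_measurable_lebesgue_integral) (simp add: case_prod_beta')
  have c2: "(\<lambda>\<xi>. s_n \<xi> (fst (\<xi> i))) \<in> borel_measurable (sample n P)"
    and c3[measurable]: "(\<lambda>\<xi>. \<xi> i) \<in> sample n P \<rightarrow>\<^sub>M P" if "i < n" for i
  proof -
    show [measurable]: "(\<lambda>\<xi>. \<xi> i) \<in> sample n P \<rightarrow>\<^sub>M P"
      unfolding sample_def using that by (intro measurable_component_singleton) auto
    have "(\<lambda>\<xi>. (\<xi>, fst (\<xi> i))) \<in> sample n P \<rightarrow>\<^sub>M sample n P \<Otimes>\<^sub>M leb01" by measurable
    from measurable_compose[OF this sn] show "(\<lambda>\<xi>. s_n \<xi> (fst (\<xi> i))) \<in> borel_measurable (sample n P)" by simp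
  qed
  have "(\<lambda>\<xi>. contrast s_M (\<xi> i) - contrast (s_n \<xi>) (\<xi> i)) \<in> borel_measurable (sample n P)" if "i < n" for i
  proof -
    have [measurable]: "(\<lambda>\<xi>. s_M (fst (\<xi> i))) \<in> borel_measurable (sample n P)"
      by (intro measurable_compose[OF c3[OF that] fst_borel] model_borel s_M_model)
    have "snd \<in> borel_measurable P" by measurable
    from measurable_compose[OF c3[OF that] this]
    have [measurable]: "(\<lambda>\<xi>. snd (\<xi> i)) \<in> borel_measurable (sample n P)" .
    show ?thesis unfolding contrast_def case_prod_beta' using c2[OF that] by measurable
  qed
  then show "(\<lambda>\<xi>. empirical_excess n \<xi> (s_n \<xi>) s_M) \<in> borel_measurable (sample n P)"
    unfolding empirical_excess_def empirical_def by (intro borel_measurable_divide borel_measurable_sum) auto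
qed

end

section \<open>Explicit rates\<close>

text \<open>The estimates are polynomial in \<open>m\<close>, \<open>d\<close> and \<open>u\<close>, the square roots of the sample size,
  of the dimension and of the deviation parameter.\<close>

lemma deviation_terms_le:
  fixes A q \<kappa> a m d u B :: real
  assumes pos: "0 < A" "1 \<le> q" "0 < \<kappa>" "0 < a" "0 < m" "1 \<le> d" "1 \<le> u" "0 \<le> B"
    and Bd: "B \<le> \<kappa> * d" and du: "d * u\<^sup>2 \<le> a * m" and um: "u \<le> m"
  defines "c5 \<equiv> 4 * A\<^sup>2 * q * \<kappa>\<^sup>2"
  defines "c4 \<equiv> 2 * A * q * (4 * A + 4 * A * \<kappa> * a) * (\<kappa> * a)"
  defines "l \<equiv> 8 * A + 1 + c5 + 2 * c4"
  defines "e \<equiv> max d u"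
  defines "K \<equiv> (l * m * e)\<^sup>2"
  defines "R \<equiv> 2 * sqrt (m\<^sup>2 * (4 * A\<^sup>2) * u\<^sup>2) + 2 * (2 * A * B) * u\<^sup>2"
  defines "T \<equiv> 2 * sqrt (m\<^sup>2 * (4 * A\<^sup>2 * K) * u\<^sup>2) + (q * (R * (2 * A * B))) * u\<^sup>2"
  defines "U \<equiv> 2 * sqrt (m\<^sup>2 * (q * (2 * A * B)\<^sup>2)\<^sup>2 * u\<^sup>2) + 2 * (q * (2 * A * B)\<^sup>2) * u\<^sup>2"
  shows "m\<^sup>2 * (q * (2 * A * B)\<^sup>2) + 2 * T \<le> K" "0 < K"
    and "2 * T + U \<le> 2 * (4 * A * l + c4) * (m\<^sup>2 * (e * u)) + 4 * c5 * (d\<^sup>2 * (m * u))"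
    and "(2 * sqrt (m\<^sup>2 * B\<^sup>2 * u\<^sup>2) + 2 * B\<^sup>2 * u\<^sup>2) / m\<^sup>2 * q \<le> q * (2 * \<kappa> + 2 * \<kappa>\<^sup>2 * a) * (d * u / m)"
proof -
  have e: "d \<le> e" "u \<le> e" "1 \<le> e" using pos by (auto simp: e_def)
  have c5: "0 \<le> c5" unfolding c5_def using pos by (intro mult_nonneg_nonneg) auto
  have c4: "0 \<le> c4" unfolding c4_def using pos by (intro mult_nonneg_nonneg add_nonneg_nonneg) auto
  have l: "1 \<le> l" unfolding l_def using pos c4 c5 by linarith
  \<comment> \<open>The hypothesis on d u^2 is the dimension bound D (ln n)^2 = O(n) after taking
    roots. It reduces B times the deviation parameter, the linear part of Bernstein's bound, to the
    order of sqrt n.\<close>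
  have Bu: "B * u\<^sup>2 \<le> \<kappa> * a * m"
  proof -
    have "B * u\<^sup>2 \<le> \<kappa> * d * u\<^sup>2" using Bd by (intro mult_right_mono) auto
    also have "\<dots> = \<kappa> * (d * u\<^sup>2)" by simp
    also have "\<dots> \<le> \<kappa> * (a * m)" using du pos by (intro mult_left_mono) auto
    finally show ?thesis by simp
  qed
  have B2: "q * (2 * A * B)\<^sup>2 \<le> c5 * d\<^sup>2"
  proof -
    have "B\<^sup>2 \<le> (\<kappa> * d)\<^sup>2" using Bd pos by (intro power_mono) auto
    then have "4 * A\<^sup>2 * q * B\<^sup>2 \<le> 4 * A\<^sup>2 * q * (\<kappa> * d)\<^sup>2" using pos by (intro mult_left_mono) auto
    then show ?thesis by (simp add: c5_def power_mult_distrib algebra_simps)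
  qed
  have sq1: "sqrt (m\<^sup>2 * (4 * A\<^sup>2) * u\<^sup>2) = 2 * A * m * u"
    using pos by (intro real_sqrt_unique) (auto simp: power_mult_distrib)
  have sq2: "sqrt (m\<^sup>2 * (4 * A\<^sup>2 * K) * u\<^sup>2) = 2 * A * m * (l * m * e) * u"
    using pos l e by (intro real_sqrt_unique) (auto simp: K_def power_mult_distrib)
  have sq3: "sqrt (m\<^sup>2 * (q * (2 * A * B)\<^sup>2)\<^sup>2 * u\<^sup>2) = m * (q * (2 * A * B)\<^sup>2) * u"
    using pos by (intro real_sqrt_unique) (auto simp: power_mult_distrib)
  have sq4: "sqrt (m\<^sup>2 * B\<^sup>2 * u\<^sup>2) = m * B * u"
    using pos by (intro real_sqrt_unique) (auto simp: power_mult_distrib)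
  have R: "R \<le> (4 * A + 4 * A * \<kappa> * a) * (m * u)"
  proof -
    have "\<kappa> * a * m * 1 \<le> \<kappa> * a * m * u" using pos by (intro mult_left_mono) auto
    then have "B * u\<^sup>2 \<le> \<kappa> * a * m * u" using Bu by linarith
    then have "4 * A * (B * u\<^sup>2) \<le> 4 * A * (\<kappa> * a * m * u)" using pos by (intro mult_left_mono) auto
    then show ?thesis unfolding R_def sq1 by (simp add: algebra_simps)
  qed
  have T: "T \<le> (4 * A * l + c4) * (m\<^sup>2 * (e * u))"
  proof -
    have "(q * (R * (2 * A * B))) * u\<^sup>2 = (2 * A * q) * (R * (B * u\<^sup>2))" by simp
    also have "\<dots> \<le> (2 * A * q) * (((4 * A + 4 * A * \<kappa> * a) * (m * u)) * (\<kappa> * a * m))"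
    proof (rule mult_left_mono)
      show "R * (B * u\<^sup>2) \<le> (4 * A + 4 * A * \<kappa> * a) * (m * u) * (\<kappa> * a * m)"
        by (rule mult_mono[OF R Bu]) (use pos in auto)
    qed (use pos in auto)
    also have "\<dots> = c4 * (m\<^sup>2 * (1 * u))" by (simp add: c4_def power2_eq_square)
    also have "\<dots> \<le> c4 * (m\<^sup>2 * (e * u))" using c4 e pos by (intro mult_left_mono mult_right_mono) auto
    finally show ?thesis unfolding T_def sq2 by (simp add: power2_eq_square algebra_simps)
  qed
  have "m\<^sup>2 * (q * (2 * A * B)\<^sup>2) \<le> m\<^sup>2 * (c5 * e\<^sup>2)"
    using order_trans[OF B2 mult_left_mono[OF power_mono[OF e(1), of 2] c5]] pos
    by (intro mult_left_mono) auto
  moreover have "T \<le> (4 * A * l + c4) * (m\<^sup>2 * e\<^sup>2)"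
    using e pos c4 l by (intro order_trans[OF T] mult_left_mono) (auto simp: power2_eq_square)
  ultimately have "m\<^sup>2 * (q * (2 * A * B)\<^sup>2) + 2 * T \<le> (c5 + 2 * (4 * A * l + c4)) * (m\<^sup>2 * e\<^sup>2)"
    by (simp add: algebra_simps)
  \<comment> \<open>The choice of l solves the self-consistency condition: the left side is affine
    in l with slope 8 A, and l is the slope plus the constant term plus 1.\<close>
  also have "c5 + 2 * (4 * A * l + c4) \<le> l\<^sup>2"
  proof -
    have "1 * (c5 + 2 * c4) \<le> l * (c5 + 2 * c4)" using l c4 c5 by (intro mult_right_mono) auto
    then have "c5 + 2 * (4 * A * l + c4) \<le> l * (8 * A + (c5 + 2 * c4))" by (simp add: algebra_simps)
    also have "\<dots> \<le> l * l" using l by (intro mult_left_mono) (auto simp: l_def)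
    finally show ?thesis by (simp add: power2_eq_square)
  qed
  finally show "m\<^sup>2 * (q * (2 * A * B)\<^sup>2) + 2 * T \<le> K"
    by (simp add: K_def power_mult_distrib mult.assoc mult_right_mono)
  show "0 < K" unfolding K_def using pos l e by (intro zero_less_power mult_pos_pos) auto
  have "U \<le> 4 * c5 * (d\<^sup>2 * (m * u))"
  proof -
    define X where "X = q * (2 * A * B)\<^sup>2"
    \<comment> \<open>With the deviation parameter at most n, the linear part of U is no larger in
      order than its square root part.\<close>
    have "u * u \<le> m * u" using um pos by (intro mult_right_mono) auto
    then have "X * (u * u) \<le> X * (m * u)" using pos by (intro mult_left_mono) (auto simp: X_def)
    then have "U \<le> 4 * X * (m * u)"
      unfolding U_def sq3 unfolding X_def[symmetric] by (simp add: power2_eq_square algebra_simps)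
    then have "U \<le> 4 * (q * (2 * A * B)\<^sup>2) * (m * u)" unfolding X_def .
    also have "\<dots> \<le> 4 * (c5 * d\<^sup>2) * (m * u)" using B2 pos by (intro mult_right_mono mult_left_mono) auto
    finally show ?thesis by simp
  qed
  then show "2 * T + U \<le> 2 * (4 * A * l + c4) * (m\<^sup>2 * (e * u)) + 4 * c5 * (d\<^sup>2 * (m * u))"
    using T by (simp add: algebra_simps)
  have "m * B * u \<le> m * (\<kappa> * d) * u" using Bd pos by (intro mult_right_mono mult_left_mono) auto
  moreover have "B\<^sup>2 * u\<^sup>2 \<le> \<kappa>\<^sup>2 * a * (m * d * u)"
  proof -
    have "B\<^sup>2 * u\<^sup>2 = B * (B * u\<^sup>2)" by (simp add: power2_eq_square)
    also have "\<dots> \<le> (\<kappa> * d) * (\<kappa> * a * m)" by (rule mult_mono[OF Bd Bu]) (use pos in auto)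
    also have "\<dots> = \<kappa>\<^sup>2 * a * (m * d * 1)" by (simp add: power2_eq_square)
    also have "\<dots> \<le> \<kappa>\<^sup>2 * a * (m * d * u)" using pos by (intro mult_left_mono) auto
    finally show ?thesis .
  qed
  ultimately have "2 * (m * B * u) + 2 * B\<^sup>2 * u\<^sup>2 \<le> (2 * \<kappa> + 2 * \<kappa>\<^sup>2 * a) * (m * d * u)"
    by (simp add: algebra_simps)
  then have "(2 * (m * B * u) + 2 * B\<^sup>2 * u\<^sup>2) / m\<^sup>2 \<le> (2 * \<kappa> + 2 * \<kappa>\<^sup>2 * a) * (m * d * u) / m\<^sup>2"
    by (intro divide_right_mono) auto
  also have "\<dots> = (2 * \<kappa> + 2 * \<kappa>\<^sup>2 * a) * (d * u / m)" using pos by (simp add: power2_eq_square)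
  finally have "(2 * (m * B * u) + 2 * B\<^sup>2 * u\<^sup>2) / m\<^sup>2 * q \<le> (2 * \<kappa> + 2 * \<kappa>\<^sup>2 * a) * (d * u / m) * q"
    using pos by (intro mult_right_mono) auto
  then show "(2 * sqrt (m\<^sup>2 * B\<^sup>2 * u\<^sup>2) + 2 * B\<^sup>2 * u\<^sup>2) / m\<^sup>2 * q \<le> q * (2 * \<kappa> + 2 * \<kappa>\<^sup>2 * a) * (d * u / m)"
    unfolding sq4 by (simp add: algebra_simps)
qed

text \<open>The fourth condition makes the relative error of the Gram matrix at most 1. The fifth
  counts the exceptional events: with D \<le> Ap n there are fewer than n^3 of them, and at
  deviation (\<alpha> + 3) ln n their total probability is at most
  \<open>n powr (- \<alpha>)\<close>.\<close>

lemma eventually_sample_size: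
  fixes \<alpha> Ap C :: real and q :: nat
  assumes "0 < \<alpha>" "0 < Ap" "0 < C"
  shows "\<forall>\<^sub>F n :: nat in sequentially. 0 < n \<and> 1 \<le> ln (real n) \<and> (\<alpha> + 3) * ln (real n) \<le> real n \<and>
    C * sqrt (Ap / ln (real n)) \<le> 1 \<and>
    (Ap * real n * (real n + 1) + (real n + 1) + 1 + Ap * real n * real q) * 2 \<le> real n ^ 3"
proof (intro eventually_conj)
  show "\<forall>\<^sub>F n :: nat in sequentially. 0 < n" by (rule eventually_gt_at_top)
  show "\<forall>\<^sub>F n :: nat in sequentially. 1 \<le> ln (real n)" by real_asymp
  show "\<forall>\<^sub>F n :: nat in sequentially. (\<alpha> + 3) * ln (real n) \<le> real n"
    using assms by real_asymp
  show "\<forall>\<^sub>F n :: nat in sequentially. C * sqrt (Ap / ln (real n)) \<le> 1"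
    using assms by real_asymp
  show "\<forall>\<^sub>F n :: nat in sequentially.
    (Ap * real n * (real n + 1) + (real n + 1) + 1 + Ap * real n * real q) * 2 \<le> real n ^ 3"
    using assms by real_asymp
qed

text \<open>v is the target (D/4n) K_{1,M}^2 and \<open>\<gamma>\<close> the squared norm that
  approximates it. The distance of the excess risks from \<open>\<gamma>\<close> is relative, that
  of \<open>\<gamma>\<close> from v absolute: the latter becomes relative only when the noise is
  bounded below, so both regimes of the theorem can start from here.\<close>

definition excess_controlled ::
  "real \<Rightarrow> real \<Rightarrow> nat \<Rightarrow> nat \<Rightarrow> (real \<times> real) measure \<Rightarrow> (real \<Rightarrow> real) \<Rightarrow>
    ((nat \<Rightarrow> real \<times> real) \<Rightarrow> real \<Rightarrow> real) \<Rightarrow> real \<Rightarrow> bool"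
  where "excess_controlled C \<alpha> n D P s_M s_n v \<longleftrightarrow>
    1 \<le> D \<and> 1 \<le> ln (real n) \<and> 0 < n \<and> prob_space P \<and>
    C * sqrt (real D * ln (real n) / real n) \<le> 1 \<and>
    (\<lambda>\<xi>. true_excess P (s_n \<xi>) s_M) \<in> borel_measurable (sample n P) \<and>
    (\<lambda>\<xi>. empirical_excess n \<xi> (s_n \<xi>) s_M) \<in> borel_measurable (sample n P) \<and>
    (\<exists>Bad \<gamma>. Bad \<in> sets (sample n P) \<and> measure (sample n P) Bad \<le> real n powr (- \<alpha>) \<and>
      (\<forall>\<xi>\<in>space (sample n P) - Bad. 0 \<le> \<gamma> \<xi> \<and> \<gamma> \<xi> \<le> C * (max (real D) (ln (real n)) / real n) \<and>
        \<bar>true_excess P (s_n \<xi>) s_M - \<gamma> \<xi>\<bar> \<le> C * sqrt (real D * ln (real n) / real n) * \<gamma> \<xi> \<and>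
        \<bar>empirical_excess n \<xi> (s_n \<xi>) s_M - \<gamma> \<xi>\<bar> \<le> C * sqrt (real D * ln (real n) / real n) * \<gamma> \<xi> \<and>
        \<bar>\<gamma> \<xi> - v\<bar> \<le> C * (sqrt (max (real D) (ln (real n)) * ln (real n)) / real n
          + real D * sqrt (ln (real n) / real n) / real n)))"

text \<open>C stands outside the quantifiers over the upper density bound, the law and the
  partition, which makes the control uniform in them. One v serves all orthonormal bases, and the
  lower bound on the noise enters as a premise of the last conjunct only.\<close>

definition regime_controlled :: "real \<Rightarrow> real \<Rightarrow> real \<Rightarrow> real \<Rightarrow> real \<Rightarrow> real \<Rightarrow> nat \<Rightarrow> nat \<Rightarrow> bool"
  where "regime_controlled C \<alpha> A Ap c_M c_min r n \<longleftrightarrow> (\<forall>c_max P s \<sigma> \<I> s_M s_n.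
    common_hyps A c_M c_min c_max r n P s \<sigma> \<I> s_M s_n \<and>
    real (model_dim \<I> r) \<le> Ap * (real n / (ln (real n))\<^sup>2) \<longrightarrow>
    (\<exists>v. excess_controlled C \<alpha> n (model_dim \<I> r) P s_M s_n v \<and>
      (\<forall>\<phi>. orthonormal_basis (law_X P) (piecewise_poly \<I> r) (model_dim \<I> r) \<phi> \<longrightarrow>
        v = 1 / 4 * (real (model_dim \<I> r) / real n) * K1_sq P s_M (model_dim \<I> r) \<phi>) \<and>
      (\<forall>\<sigma>_min>0. (AE x in law_X P. \<sigma>_min \<le> \<sigma> x) \<longrightarrow>
        \<sigma>_min\<^sup>2 * (real (model_dim \<I> r) / real n) \<le> v)))"

theorem excess_controlled_eventually:
  fixes \<alpha> A Ap c_M c_min :: real and r :: nat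
  assumes pos: "0 < \<alpha>" "0 < A" "0 < Ap" "0 < c_M" "0 < c_min"
  shows "\<exists>C>0. \<forall>\<^sub>F n in sequentially. regime_controlled C \<alpha> A Ap c_M c_min r n"
proof -
  obtain C0 where C0: "C0 > 0" and basis: "\<And>PX \<I> c_max. prob_space PX \<Longrightarrow> bounded_density PX c_min c_max \<Longrightarrow>
    interval_partition \<I> \<Longrightarrow> lower_regular \<I> c_M \<Longrightarrow>
    \<exists>b. block_basis PX \<I> r b (sqrt (C0 / (c_min * c_M\<^sup>2) * real (card \<I>)))"
    using block_basis_exists[of r] pos by blast
  \<comment> \<open>The deviation parameter is k ln n, so each event has probability of order
    \<open>n powr (- \<alpha> - 3)\<close>.\<close>
  define k where "k = \<alpha> + 3"
  define \<kappa> where "\<kappa> = sqrt (C0 / (c_min * c_M\<^sup>2))"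
  \<comment> \<open>Multiplying sqrt D ln n \<le> sqrt (Ap n) by k gives the condition on d u^2 in
    \<open>deviation_terms_le\<close>.\<close>
  define a where "a = k * sqrt Ap"
  define q where "q = real (Suc r)"
  define c5 where "c5 = 4 * A\<^sup>2 * q * \<kappa>\<^sup>2"
  define c4 where "c4 = 2 * A * q * (4 * A + 4 * A * \<kappa> * a) * (\<kappa> * a)"
  define l where "l = 8 * A + 1 + c5 + 2 * c4"
  define c7 where "c7 = q * (2 * \<kappa> + 2 * \<kappa>\<^sup>2 * a)"
  \<comment> \<open>Each summand is nonnegative and covers one estimate: the size of
    \<open>\<gamma>\<close>, the martingale, the diagonal and the Gram matrix. The final 1 gives
    positivity.\<close>
  define C where "C = l\<^sup>2 * k + 2 * (4 * A * l + c4) * k + 4 * c5 * sqrt k + 6 * c7 * sqrt k + 1"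
  have k: "1 \<le> k" "0 < k" using pos by (auto simp: k_def)
  have \<kappa>: "0 < \<kappa>" using C0 pos by (simp add: \<kappa>_def)
  have a: "0 < a" using k pos by (simp add: a_def)
  have q: "1 \<le> q" by (simp add: q_def)
  have c5: "0 \<le> c5" unfolding c5_def using q by simp
  have c4: "0 \<le> c4" unfolding c4_def using q \<kappa> a pos by (intro mult_nonneg_nonneg add_nonneg_nonneg) auto
  have l: "0 \<le> l" unfolding l_def using c4 c5 pos by simp
  have c7: "0 \<le> c7" unfolding c7_def using q \<kappa> a by (intro mult_nonneg_nonneg add_nonneg_nonneg) auto
  have parts: "0 \<le> l\<^sup>2 * k" "0 \<le> 2 * (4 * A * l + c4) * k" "0 \<le> 4 * c5 * sqrt k" "0 \<le> 6 * c7 * sqrt k"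
    using l c4 c5 c7 k pos by auto
  have C: "0 < C" "l\<^sup>2 * k \<le> C" "2 * (4 * A * l + c4) * k \<le> C" "4 * c5 * sqrt k \<le> C" "6 * c7 * sqrt k \<le> C"
    unfolding C_def using parts by linarith+
  show ?thesis
  proof (intro exI[of _ C] conjI C(1), use eventually_sample_size[OF pos(1,3) C(1), of "Suc r"] in eventually_elim,
      unfold regime_controlled_def, intro allI impI, elim conjE)
    fix n c_max P s \<sigma> \<I> s_M s_n
    assume n: "0 < n" and L1: "1 \<le> ln (real n)" and kL: "(\<alpha> + 3) * ln (real n) \<le> real n"
      and small: "C * sqrt (Ap / ln (real n)) \<le> 1"
      and cubic: "(Ap * real n * (real n + 1) + (real n + 1) + 1 + Ap * real n * real (Suc r)) * 2 \<le> real n ^ 3"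
      and common: "common_hyps A c_M c_min c_max r n P s \<sigma> \<I> s_M s_n"
      and D_le: "real (model_dim \<I> r) \<le> Ap * (real n / (ln (real n))\<^sup>2)"
    define L where "L = ln (real n)"
    define D where "D = real (model_dim \<I> r)"
    define B where "B = sqrt (C0 / (c_min * c_M\<^sup>2) * real (card \<I>))"
    have law: "regression_law P s \<sigma>" and dens: "bounded_density (law_X P) c_min c_max"
      and part: "interval_partition \<I>" and reg: "lower_regular \<I> c_M"
      using common by (auto simp: common_hyps_def)
    have Pprob: "prob_space P" by (rule regression_law_prob_space(1)[OF law])
    have PXprob: "prob_space (law_X P)"
    proof -
      have [measurable_cong]: "sets P = sets data_space" by (rule regression_law_prob_space(2)[OF law])
      show ?thesis unfolding law_X_def by (intro prob_space.prob_space_distr Pprob) measurable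
    qed
    obtain b where bb: "block_basis (law_X P) \<I> r b B"
      using basis[OF PXprob dens part reg] unfolding B_def by blast
    have N: "0 < real (card \<I>)" using partition_cells(1,2)[OF part] by (simp add: card_gt_0_iff)
    have B: "0 < B" using N C0 pos by (simp add: B_def)
    interpret regression_model P \<I> r b B s \<sigma> s_M s_n A c_M c_min c_max n
      using bb common B n pos by (intro regression_model.intro regression_model_axioms.intro) auto
    have D1: "1 \<le> D" using card_J card_J_pos by (simp add: D_def)
    have ND: "real (card \<I>) \<le> D" by (simp add: D_def model_dim_def)
    have L: "1 \<le> L" using L1 by (simp add: L_def)
    have n0: "0 < real n" using n by simp
    define m where "m = sqrt (real n)"
    define d where "d = sqrt D"
    define u where "u = sqrt (k * L)"
    have m: "0 < m" "m\<^sup>2 = real n" using n0 by (auto simp: m_def)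
    have d: "1 \<le> d" "d\<^sup>2 = D" using D1 by (auto simp: d_def)
    have kL1: "1 \<le> k * L" using mult_mono[OF k(1) L] k by simp
    have u: "1 \<le> u" "u\<^sup>2 = k * L" using kL1 by (auto simp: u_def)
    have Bd: "B \<le> \<kappa> * d"
      unfolding B_def \<kappa>_def d_def real_sqrt_mult[symmetric] using ND C0 pos
      by (intro real_sqrt_le_mono mult_left_mono) auto
    have DL2: "D * L\<^sup>2 \<le> Ap * real n" using D_le L by (simp add: D_def L_def field_simps)
    have dL: "d * L \<le> sqrt Ap * m"
    proof -
      from DL2 have "sqrt (D * L\<^sup>2) \<le> sqrt (Ap * real n)" by (rule real_sqrt_le_mono)
      then show ?thesis using L by (simp add: real_sqrt_mult d_def m_def)
    qed
    have du: "d * u\<^sup>2 \<le> a * m"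
      using mult_left_mono[OF dL, of k] k by (simp add: u(2) a_def algebra_simps)
    have um: "u \<le> m" unfolding u_def m_def using kL by (intro real_sqrt_le_mono) (simp add: k_def L_def)
    define e where "e = max d u"
    define K where "K = (l * m * e)\<^sup>2"
    note est = deviation_terms_le[OF pos(2) q \<kappa> a m(1) d(1) u(1) less_imp_le[OF B] Bd du um,
      folded c5_def c4_def, folded l_def, folded e_def, folded K_def, folded c7_def]
    have DLn: "D * L / real n \<le> Ap / L"
      using DL2 L n0 by (simp add: field_simps power2_eq_square)
    have sqDL: "sqrt (D * L / real n) \<le> sqrt (Ap / L)" using DLn by (rule real_sqrt_le_mono)
    have CsDL: "C * sqrt (D * L / real n) \<le> 1"
      using order_trans[OF mult_left_mono[OF sqDL less_imp_le[OF C(1)]] small[folded L_def]] .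
    have dum: "d * u / m = sqrt k * sqrt (D * L / real n)"
      by (simp add: d_def u_def m_def real_sqrt_mult real_sqrt_divide)
    have s0: "0 \<le> sqrt (D * L / real n)" using D1 L n0 by simp
    define \<delta> where "\<delta> = (2 * sqrt (m\<^sup>2 * B\<^sup>2 * u\<^sup>2) + 2 * B\<^sup>2 * u\<^sup>2) / m\<^sup>2 * q"
    \<comment> \<open>The factor 6 comes from \<open>near_vector\<close>. Together with
      \<open>CsDL\<close> the bound gives \<delta> \<le> 1/6, within the range that this lemma
      allows.\<close>
    have \<delta>: "6 * \<delta> \<le> C * sqrt (D * L / real n)" 
    proof -
      have "6 * \<delta> \<le> 6 * c7 * sqrt k * sqrt (D * L / real n)"
        using est(4) unfolding \<delta>_def[symmetric] dum by simp
      also have "\<dots> \<le> C * sqrt (D * L / real n)" using C(5) s0 by (rule mult_right_mono)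
      finally show ?thesis .
    qed
    have \<delta>_eq: "\<delta> = (2 * sqrt (real n * B\<^sup>2 * (k * L)) + 2 * B\<^sup>2 * (k * L)) / real n * (real r + 1)"
      by (simp add: \<delta>_def m(2) u(2) q_def add.commute)
    have \<delta>_half: "\<delta> \<le> 1 / 2" using \<delta> CsDL by simp
    define R where "R = 2 * sqrt (real n * (4 * A\<^sup>2) * (k * L)) + 2 * (2 * A * B) * (k * L)"
    define T where "T = 2 * sqrt (real n * (4 * A\<^sup>2 * K) * (k * L)) + (real (Suc r) * (R * (2 * A * B))) * (k * L)"
    define U where "U = 2 * sqrt (real n * (real (Suc r) * (2 * A * B)\<^sup>2)\<^sup>2 * (k * L)) + 2 * (real (Suc r) * (2 * A * B)\<^sup>2) * (k * L)"
    note est' = est(1-3)[unfolded m(2) u(2) d(2) q_def, folded R_def, folded T_def U_def]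
    have kL0: "0 < k * L" using kL1 by simp
    obtain Bad \<gamma> where Bad: "Bad \<in> sets (sample n P)"
      "measure (sample n P) Bad \<le>
      (real (card J) * (real n + 1) + (real n + 1) + 1 + real (card J) * (real r + 1)) * (2 * exp (- (k * L)))"
      and ctrl: "\<And>\<xi>. \<xi> \<in> space (sample n P) - Bad \<Longrightarrow> near_excess K (2 * T + U) \<delta> \<xi> (\<gamma> \<xi>)"
      using excess_concentration[OF kL0, of K, folded R_def, folded T_def U_def \<delta>_eq, OF est'(1,2) \<delta>_half]
      by blast
    have prob_Bad: "measure (sample n P) Bad \<le> real n powr (- \<alpha>)"
    proof -
      have D_n: "D \<le> Ap * real n"
      proof -
        have "real n / L\<^sup>2 \<le> real n / 1" using L n0 by (intro divide_left_mono) auto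
        then have "Ap * (real n / L\<^sup>2) \<le> Ap * real n" using pos by (intro mult_left_mono) auto
        then show ?thesis using D_le by (simp add: D_def L_def)
      qed
      have ex: "exp (- (k * L)) = real n powr (- \<alpha>) / real n ^ 3"
      proof -
        have "exp (- (k * L)) = real n powr (- \<alpha> - 3)" using n0 by (simp add: powr_def k_def L_def algebra_simps)
        also have "\<dots> = real n powr (- \<alpha>) / real n powr 3" by (rule powr_diff)
        finally show ?thesis using n0 by (simp add: powr_numeral)
      qed
      have "(real (card J) * (real n + 1) + (real n + 1) + 1 + real (card J) * (real r + 1)) * 2
        \<le> (Ap * real n * (real n + 1) + (real n + 1) + 1 + Ap * real n * (real r + 1)) * 2"
        using D_n unfolding card_J D_def by (intro mult_right_mono add_mono order_refl) auto
      also have "\<dots> \<le> real n ^ 3" using cubic by (simp add: add.commute)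
      finally have "(real (card J) * (real n + 1) + (real n + 1) + 1 + real (card J) * (real r + 1)) * 2 * exp (- (k * L))
        \<le> real n ^ 3 * exp (- (k * L))" by (intro mult_right_mono) auto
      also have "\<dots> = real n powr (- \<alpha>)" unfolding ex using n0 by simp
      finally show ?thesis
        using order_trans[OF Bad(2), of "real n powr (- \<alpha>)"] by (simp only: mult.assoc[symmetric])
    qed
    define E where "E = max D L"
    have E: "1 \<le> E" using D1 by (simp add: E_def)
    \<comment> \<open>e is the larger of sqrt D and sqrt (k L), so passing to E = max D L costs at
      most the factor k, which is at least 1.\<close>
    have e2: "e\<^sup>2 \<le> k * E"
    proof -
      have "e = d \<or> e = u" by (auto simp: e_def max_def)
      then have "e\<^sup>2 = D \<or> e\<^sup>2 = k * L" using d(2) u(2) by auto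
      moreover have "1 * D \<le> k * E" by (rule mult_mono) (use k D1 in \<open>auto simp: E_def\<close>)
      moreover have "k * L \<le> k * E" by (rule mult_left_mono) (use k in \<open>auto simp: E_def\<close>)
      ultimately show ?thesis by auto
    qed
    have K_le: "K / (real n)\<^sup>2 \<le> C * (E / real n)"
    proof -
      have "K / (real n)\<^sup>2 = l\<^sup>2 * e\<^sup>2 / real n"
        using n0 by (simp add: K_def power_mult_distrib m(2) power2_eq_square[of "real n"])
      also have "\<dots> \<le> l\<^sup>2 * (k * E) / real n" using e2 by (intro divide_right_mono mult_left_mono) auto
      also have "\<dots> = (l\<^sup>2 * k) * (E / real n)" by simp
      also have "\<dots> \<le> C * (E / real n)" using C(2) E by (intro mult_right_mono) auto
      finally show ?thesis .
    qed
    have TU: "(2 * T + U) / (real n)\<^sup>2 \<le> C * (sqrt (E * L) / real n + D * sqrt (L / real n) / real n)"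
    proof -
      have eu: "e * u \<le> k * sqrt (E * L)"
      proof -
        have "(e * u)\<^sup>2 \<le> (k * E) * (k * L)"
          unfolding power_mult_distrib u(2) using e2 kL0 by (intro mult_right_mono) auto
        also have "\<dots> = (k * sqrt (E * L))\<^sup>2" using E L by (simp add: power_mult_distrib power2_eq_square[of k])
        finally show ?thesis using k E L by (intro power2_le_imp_le[of "e * u"]) auto
      qed
      have "2 * (4 * A * l + c4) * (real n * (e * u)) \<le> 2 * (4 * A * l + c4) * (real n * (k * sqrt (E * L)))"
        using eu parts(2) pos l c4 by (intro mult_left_mono) auto
      also have "\<dots> = (2 * (4 * A * l + c4) * k) * (real n * sqrt (E * L))" by simp
      also have "\<dots> \<le> C * (real n * sqrt (E * L))" using C(3) E L by (intro mult_right_mono) auto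
      finally have t1: "2 * (4 * A * l + c4) * (real n * (e * u)) \<le> C * (real n * sqrt (E * L))" .
      have mu: "m * u = sqrt k * (real n * sqrt (L / real n))"
      proof -
        have "real n * sqrt (L / real n) = m * sqrt L"
          using n0 by (simp add: m_def real_sqrt_divide real_div_sqrt field_simps)
        then show ?thesis by (simp add: u_def real_sqrt_mult)
      qed
      have "4 * c5 * (D * (m * u)) = (4 * c5 * sqrt k) * (D * (real n * sqrt (L / real n)))"
        unfolding mu by simp
      also have "\<dots> \<le> C * (D * (real n * sqrt (L / real n)))"
        using C(4) D1 L by (intro mult_right_mono) auto
      finally have "2 * T + U \<le> C * (real n * sqrt (E * L)) + C * (D * (real n * sqrt (L / real n)))"
        using est'(3) t1 by linarith
      then have "(2 * T + U) / (real n)\<^sup>2 \<le> (C * (real n * sqrt (E * L)) + C * (D * (real n * sqrt (L / real n)))) / (real n)\<^sup>2"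
        by (intro divide_right_mono) auto
      also have "\<dots> = C * (sqrt (E * L) / real n + D * sqrt (L / real n) / real n)"
        using n0 by (simp add: power2_eq_square field_simps)
      finally show ?thesis .
    qed
    define v where "v = P.expectation sc.G / real n"
    have controlled: "excess_controlled C \<alpha> n (model_dim \<I> r) P s_M s_n v"
      unfolding excess_controlled_def D_def[symmetric] L_def[symmetric] E_def[symmetric]
    proof (intro conjI L n Pprob CsDL excess_measurable exI[of _ Bad] exI[of _ \<gamma>] ballI)
      show "1 \<le> model_dim \<I> r" using D1 by (simp add: D_def)
      show "Bad \<in> sets (sample n P)" "measure (sample n P) Bad \<le> real n powr (- \<alpha>)"
        by (fact Bad(1), fact prob_Bad)
      fix \<xi> assume "\<xi> \<in> space (sample n P) - Bad"
      note c = ctrl[OF this, unfolded near_excess_def]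
      show \<gamma>0: "0 \<le> \<gamma> \<xi>" using c by simp
      show "\<gamma> \<xi> \<le> C * (E / real n)" using c K_le by linarith
      show "\<bar>\<gamma> \<xi> - v\<bar> \<le> C * (sqrt (E * L) / real n + D * sqrt (L / real n) / real n)"
        using c TU unfolding v_def by linarith
      have "6 * \<delta> * \<gamma> \<xi> \<le> C * sqrt (D * L / real n) * \<gamma> \<xi>" using \<delta> \<gamma>0 by (rule mult_right_mono)
      then show "\<bar>true_excess P (s_n \<xi>) s_M - \<gamma> \<xi>\<bar> \<le> C * sqrt (D * L / real n) * \<gamma> \<xi>" using c by linarith
      have "2 * \<delta> \<le> C * sqrt (D * L / real n)" using \<delta> C(1) s0 by (smt (verit) mult_nonneg_nonneg)
      then have "2 * \<delta> * \<gamma> \<xi> \<le> C * sqrt (D * L / real n) * \<gamma> \<xi>" using \<gamma>0 by (rule mult_right_mono)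
      then show "\<bar>empirical_excess n \<xi> (s_n \<xi>) s_M - \<gamma> \<xi>\<bar> \<le> C * sqrt (D * L / real n) * \<gamma> \<xi>" using c by linarith
    qed
    have vK: "v = 1 / 4 * (D / real n) * K1_sq P s_M (model_dim \<I> r) \<phi>"
      if "orthonormal_basis (law_X P) (piecewise_poly \<I> r) (model_dim \<I> r) \<phi>" for \<phi>
      unfolding v_def expectation_G_eq_K1[OF that] D_def by simp
    have v\<sigma>: "\<sigma>_min\<^sup>2 * (D / real n) \<le> v" if "0 < \<sigma>_min" "AE x in law_X P. \<sigma>_min \<le> \<sigma> x" for \<sigma>_min
      using divide_right_mono[OF expectation_G_ge[OF that(2,1)], of "real n"] n0 by (simp add: v_def D_def)
    show "(\<exists>v. excess_controlled C \<alpha> n (model_dim \<I> r) P s_M s_n v \<and>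
        (\<forall>\<phi>. orthonormal_basis (law_X P) (piecewise_poly \<I> r) (model_dim \<I> r) \<phi> \<longrightarrow>
          v = 1 / 4 * (real (model_dim \<I> r) / real n) * K1_sq P s_M (model_dim \<I> r) \<phi>) \<and>
        (\<forall>\<sigma>_min>0. (AE x in law_X P. \<sigma>_min \<le> \<sigma> x) \<longrightarrow>
          \<sigma>_min\<^sup>2 * (real (model_dim \<I> r) / real n) \<le> v))"
      using controlled vK v\<sigma> unfolding D_def by blast
  qed
qed

section \<open>From absolute to relative errors\<close>

lemma powr_quarter_squared: "0 \<le> t \<Longrightarrow> (t powr (1 / 4))\<^sup>2 = sqrt (t :: real)"
  by (simp add: power2_eq_square powr_add[symmetric] powr_half_sqrt[symmetric])

text \<open>As D dominates a multiple of ln n, E is of the order of D, and sqrt (E L) is at most a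
  constant times D sqrt (L / D). Both terms are therefore at most a multiple of
  \<open>\<rho>\<close> times D / n, and the lower bound on v replaces D / n by v.\<close>

lemma relative_error_le:
  fixes C \<sigma> Am n D L E v :: real
  assumes pos: "0 < C" "0 < \<sigma>" "0 < Am" "0 < n" "1 \<le> D" "1 \<le> L"
    and AmD: "Am * L \<le> D" and v: "\<sigma>\<^sup>2 * (D / n) \<le> v" and E: "E = max D L"
  defines "\<rho> \<equiv> max (sqrt (L / D)) (sqrt (D * L / n))"
  shows "C * (sqrt (E * L) / n + D * sqrt (L / n) / n)
    \<le> C * (sqrt (max 1 (1 / Am)) + 1) / \<sigma>\<^sup>2 * (\<rho> * v)"
proof -
  define s where "s = sqrt (max 1 (1 / Am))"
  have s: "0 \<le> s" by (simp add: s_def)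
  have \<rho>: "0 \<le> \<rho>" "sqrt (L / D) \<le> \<rho>" "sqrt (D * L / n) \<le> \<rho>"
    using pos by (auto simp: \<rho>_def le_max_iff_disj)
  have Dn: "0 \<le> D / n" using pos by simp
  have "E \<le> max 1 (1 / Am) * D"
  proof -
    have "L \<le> 1 / Am * D" using AmD pos by (simp add: field_simps)
    also have "\<dots> \<le> max 1 (1 / Am) * D" using pos by (intro mult_right_mono) auto
    finally have "L \<le> max 1 (1 / Am) * D" .
    moreover have "1 * D \<le> max 1 (1 / Am) * D" using pos by (intro mult_right_mono) auto
    ultimately show ?thesis by (simp add: E)
  qed
  then have "E * L \<le> max 1 (1 / Am) * D * L" using pos by (intro mult_right_mono) auto
  then have "sqrt (E * L) \<le> sqrt (max 1 (1 / Am) * D * L)" by (rule real_sqrt_le_mono)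
  also have "\<dots> = s * sqrt (L / D) * D"
    using pos by (simp add: s_def real_sqrt_mult real_sqrt_divide real_div_sqrt field_simps)
  also have "\<dots> \<le> s * \<rho> * D" using s \<rho> pos by (intro mult_right_mono mult_left_mono) auto
  finally have 1: "sqrt (E * L) / n \<le> s * \<rho> * (D / n)" using pos by (simp add: divide_right_mono)
  have "sqrt (L / n) \<le> sqrt (D * L / n)"
    using pos by (intro real_sqrt_le_mono divide_right_mono) auto
  then have "sqrt (L / n) \<le> \<rho>" using \<rho> by linarith
  then have "sqrt (L / n) * (D / n) \<le> \<rho> * (D / n)" using Dn by (rule mult_right_mono)
  with 1 have "sqrt (E * L) / n + D * sqrt (L / n) / n \<le> (s + 1) * \<rho> * (D / n)"
    by (simp add: algebra_simps)
  also have "D / n \<le> v / \<sigma>\<^sup>2" using v pos by (simp add: field_simps)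
  finally have "sqrt (E * L) / n + D * sqrt (L / n) / n \<le> (s + 1) * \<rho> * (v / \<sigma>\<^sup>2)"
    using s \<rho> by (simp add: mult_left_mono)
  then have "C * (sqrt (E * L) / n + D * sqrt (L / n) / n) \<le> C * ((s + 1) * \<rho> * (v / \<sigma>\<^sup>2))"
    using pos by (intro mult_left_mono) auto
  also have "\<dots> = C * (s + 1) / \<sigma>\<^sup>2 * (\<rho> * v)" by simp
  finally show ?thesis unfolding s_def .
qed

lemma two_sided_of_abs:
  fixes t v C' \<rho> g :: real
  assumes "\<bar>t - g\<bar> \<le> C * \<rho> * g" "\<bar>g - v\<bar> \<le> C' * (\<rho> * v)" "0 \<le> \<rho>" "\<rho> \<le> 1" "0 \<le> v" "0 \<le> C" "0 \<le> C'"
  shows "\<bar>t - v\<bar> \<le> (C * (1 + C') + C') * \<rho> * v"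
proof -
  have "\<rho> * v \<le> 1 * v" using assms by (intro mult_right_mono) auto
  then have "C' * (\<rho> * v) \<le> C' * v" using assms by (intro mult_left_mono) auto
  then have "g \<le> (1 + C') * v" using assms(2) by (simp add: algebra_simps)
  then have "C * \<rho> * g \<le> C * \<rho> * ((1 + C') * v)" using assms by (intro mult_left_mono) auto
  then show ?thesis using assms(1,2) by (simp add: algebra_simps)
qed

lemma (in prob_space) prob_ge_of_bad:
  assumes "{\<xi> \<in> space M. Q \<xi>} \<in> sets M" "Bad \<in> sets M" "prob Bad \<le> p"
    and "\<And>\<xi>. \<xi> \<in> space M - Bad \<Longrightarrow> Q \<xi>"
  shows "\<P>(\<xi> in M. Q \<xi>) \<ge> 1 - p"
proof -
  have "1 - prob Bad = prob (space M - Bad)" using assms by (simp add: prob_compl)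
  also have "\<dots> \<le> \<P>(\<xi> in M. Q \<xi>)" using assms by (intro finite_measure_mono) auto
  finally show ?thesis using assms(3) by linarith
qed

lemma (in prob_space) prob_le_of_bad:
  assumes "Bad \<in> sets M" "prob Bad \<le> p" and "\<And>\<xi>. \<xi> \<in> space M - Bad \<Longrightarrow> \<not> Q \<xi>"
  shows "\<P>(\<xi> in M. Q \<xi>) \<le> p"
proof -
  have "\<P>(\<xi> in M. Q \<xi>) \<le> prob Bad" using assms by (intro finite_measure_mono) auto
  then show ?thesis using assms(2) by linarith
qed

abbreviation two_sided ::
  "real \<Rightarrow> real \<Rightarrow> nat \<Rightarrow> (real \<times> real) measure \<Rightarrow> real set set \<Rightarrow> nat \<Rightarrow> (real \<Rightarrow> real) \<Rightarrow>
    ((nat \<Rightarrow> real \<times> real) \<Rightarrow> real \<Rightarrow> real) \<Rightarrow> (nat \<Rightarrow> real \<Rightarrow> real) \<Rightarrow> bool"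
  where "two_sided A0 \<alpha> n P \<I> r s_M s_n \<phi> \<equiv>
    (let D = model_dim \<I> r; \<epsilon> = eps_n A0 D n; v = 1 / 4 * (real D / real n) * K1_sq P s_M D \<phi> in
      \<P>(\<xi> in sample n P. (1 + \<epsilon>) * v \<ge> true_excess P (s_n \<xi>) s_M \<and>
          true_excess P (s_n \<xi>) s_M \<ge> (1 - \<epsilon>) * v) \<ge> 1 - 10 * real n powr (- \<alpha>) \<and>
      \<P>(\<xi> in sample n P. (1 + \<epsilon>\<^sup>2) * v \<ge> empirical_excess n \<xi> (s_n \<xi>) s_M \<and>
          empirical_excess n \<xi> (s_n \<xi>) s_M \<ge> (1 - \<epsilon>\<^sup>2) * v) \<ge> 1 - 5 * real n powr (- \<alpha>))"

lemma excess_two_sided: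
  fixes \<alpha> A \<sigma>_min Am Ap c_M c_min :: real and r :: nat
  assumes pos: "0 < \<alpha>" "0 < A" "0 < \<sigma>_min" "0 < Am" "0 < Ap" "0 < c_M" "0 < c_min"
  shows "\<exists>A0>0. \<forall>\<^sub>F n in sequentially. \<forall>c_max P s \<sigma> \<I> s_M s_n \<phi>.
    common_hyps A c_M c_min c_max r n P s \<sigma> \<I> s_M s_n \<and>
    (AE x in law_X P. \<sigma>_min \<le> \<sigma> x) \<and>
    orthonormal_basis (law_X P) (piecewise_poly \<I> r) (model_dim \<I> r) \<phi> \<and>
    Am * (ln (real n))\<^sup>2 \<le> real (model_dim \<I> r) \<and>
    real (model_dim \<I> r) \<le> Ap * (real n / (ln (real n))\<^sup>2) \<longrightarrow>
    two_sided A0 \<alpha> n P \<I> r s_M s_n \<phi>"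
proof -
  obtain C where C: "0 < C" and ev: "\<forall>\<^sub>F n in sequentially. regime_controlled C \<alpha> A Ap c_M c_min r n"
    using excess_controlled_eventually[OF pos(1,2,5,6,7), of r] by blast
  define C' where "C' = C * (sqrt (max 1 (1 / Am)) + 1) / \<sigma>_min\<^sup>2"
  \<comment> \<open>The second entry is the constant of \<open>two_sided_of_abs\<close>; A0 \<ge> 1
    is needed for A0 \<le> A0^2, since squaring \<open>\<epsilon>\<close> squares A0 as
    well.\<close>
  define A0 where "A0 = max 1 (C * (1 + C') + C')"
  have C': "0 \<le> C'" using C by (simp add: C'_def)
  have A0: "1 \<le> A0" "C * (1 + C') + C' \<le> A0" by (auto simp: A0_def)
  \<comment> \<open>These make \<open>\<rho>\<close> at most 1: with ln n \<ge> 1/Am the lower bound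
    on D gives ln n \<le> D, and with ln n \<ge> Ap the upper bound gives D ln n \<le> n.\<close>
  have evL: "\<forall>\<^sub>F n :: nat in sequentially. 1 / Am \<le> ln (real n)" "\<forall>\<^sub>F n :: nat in sequentially. Ap \<le> ln (real n)"
    by real_asymp+
  show ?thesis
  proof (intro exI[of _ A0] conjI, use A0 in simp, use ev evL in eventually_elim, intro allI impI, elim conjE)
    fix n c_max P s \<sigma> \<I> s_M s_n \<phi>
    assume L_Am: "1 / Am \<le> ln (real n)" and L_Ap: "Ap \<le> ln (real n)"
      and common: "common_hyps A c_M c_min c_max r n P s \<sigma> \<I> s_M s_n"
      and \<sigma>: "AE x in law_X P. \<sigma>_min \<le> \<sigma> x"
      and \<phi>: "orthonormal_basis (law_X P) (piecewise_poly \<I> r) (model_dim \<I> r) \<phi>"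
      and D_ge: "Am * (ln (real n))\<^sup>2 \<le> real (model_dim \<I> r)"
      and D_le: "real (model_dim \<I> r) \<le> Ap * (real n / (ln (real n))\<^sup>2)"
      and all: "regime_controlled C \<alpha> A Ap c_M c_min r n"
    define D where "D = model_dim \<I> r"
    define L where "L = ln (real n)"
    define v where "v = 1 / 4 * (real D / real n) * K1_sq P s_M D \<phi>"
    define \<epsilon> where "\<epsilon> = eps_n A0 D n"
    have ctrl: "excess_controlled C \<alpha> n D P s_M s_n v"
      and v_ge: "\<sigma>_min\<^sup>2 * (real D / real n) \<le> v"
      using all[unfolded regime_controlled_def, rule_format, of c_max P s \<sigma> \<I> s_M s_n] common D_le \<phi> \<sigma> pos
      unfolding D_def v_def by blast+
    then have D1: "1 \<le> real D" and L1: "1 \<le> L" and n0: "0 < n" and Pprob: "prob_space P"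
      and meas[measurable]: "(\<lambda>\<xi>. true_excess P (s_n \<xi>) s_M) \<in> borel_measurable (sample n P)"
        "(\<lambda>\<xi>. empirical_excess n \<xi> (s_n \<xi>) s_M) \<in> borel_measurable (sample n P)"
      by (auto simp: excess_controlled_def L_def)
    interpret S: prob_space "sample n P"
      unfolding sample_def by (intro prob_space_PiM Pprob)
    define \<rho> where "\<rho> = max (sqrt (L / real D)) (sqrt (real D * L / real n))"
    have \<rho>0: "0 \<le> \<rho>" using D1 L1 by (simp add: \<rho>_def le_max_iff_disj)
    have AmD: "Am * L\<^sup>2 \<le> real D" using D_ge by (simp add: D_def L_def)
    have "Am * (L * 1) \<le> Am * (L * L)" using L1 pos by (intro mult_left_mono) auto
    then have AmL: "Am * L \<le> real D" using AmD by (simp add: power2_eq_square)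
    have \<rho>1: "\<rho> \<le> 1"
    proof -
      have "1 \<le> Am * L" using L_Am pos by (simp add: L_def field_simps)
      then have "1 * L \<le> (Am * L) * L" using L1 by (intro mult_right_mono) auto
      then have "L \<le> real D" using AmD by (simp add: power2_eq_square)
      then have "L / real D \<le> 1" using D1 by simp
      moreover have "real D * L / real n \<le> 1"
      proof -
        have "real D * L \<le> (Ap * (real n / L\<^sup>2)) * L" using D_le L1 by (intro mult_right_mono) (auto simp: D_def L_def)
        also have "\<dots> = real n * (Ap / L)" using L1 by (simp add: power2_eq_square)
        also have "\<dots> \<le> real n * 1" using L_Ap L1 by (intro mult_left_mono) (auto simp: L_def)
        finally show ?thesis using n0 by simp
      qed
      ultimately show ?thesis by (simp add: \<rho>_def)
    qed
    have v0: "0 \<le> v" by (rule order_trans[OF _ v_ge]) simp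
    \<comment> \<open>Squaring turns the fourth roots of \<open>eps_n\<close> into the square roots
      of \<open>\<rho>\<close>. As \<open>\<rho>\<close> is at most 1, A0 \<open>\<rho>\<close> lies
      below both \<open>\<epsilon>\<close> and its square.\<close>
    have eps: "\<epsilon>\<^sup>2 = A0\<^sup>2 * \<rho>" "0 \<le> \<epsilon>"
    proof -
      define m where "m = max ((L / real D) powr (1 / 4)) ((real D * L / real n) powr (1 / 4))"
      have e: "\<epsilon> = A0 * m" by (simp add: \<epsilon>_def eps_n_def m_def L_def)
      have m0: "0 \<le> m" by (simp add: m_def le_max_iff_disj)
      show "0 \<le> \<epsilon>" unfolding e using A0 m0 by simp
      have "m\<^sup>2 = \<rho>"
      proof -
        have "m\<^sup>2 = max (((L / real D) powr (1 / 4))\<^sup>2) (((real D * L / real n) powr (1 / 4))\<^sup>2)"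
          unfolding m_def by (auto simp: max_def dest: power_mono[where n = 2] intro!: antisym power_mono)
        then show ?thesis using D1 L1 by (simp add: powr_quarter_squared \<rho>_def)
      qed
      then show "\<epsilon>\<^sup>2 = A0\<^sup>2 * \<rho>" by (simp add: e power_mult_distrib)
    qed
    have "A0 * 1 \<le> A0 * A0" using A0 by (intro mult_left_mono) auto
    then have \<rho>_eps2: "A0 * \<rho> \<le> \<epsilon>\<^sup>2"
      unfolding eps(1) unfolding power2_eq_square using \<rho>0 by (intro mult_right_mono) auto
    have \<rho>_eps: "A0 * \<rho> \<le> \<epsilon>"
    proof (rule power2_le_imp_le)
      have "(A0 * \<rho>)\<^sup>2 = A0\<^sup>2 * (\<rho> * \<rho>)" by (simp add: power2_eq_square)
      also have "\<dots> \<le> A0\<^sup>2 * (\<rho> * 1)" using \<rho>0 \<rho>1 by (intro mult_left_mono) auto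
      finally show "(A0 * \<rho>)\<^sup>2 \<le> \<epsilon>\<^sup>2" by (simp add: eps(1))
    qed (rule eps(2))
    obtain Bad \<gamma> where Bad: "Bad \<in> sets (sample n P)" "S.prob Bad \<le> real n powr (- \<alpha>)"
      and c: "\<And>\<xi>. \<xi> \<in> space (sample n P) - Bad \<Longrightarrow>
        0 \<le> \<gamma> \<xi> \<and>
        \<bar>true_excess P (s_n \<xi>) s_M - \<gamma> \<xi>\<bar> \<le> C * sqrt (real D * L / real n) * \<gamma> \<xi> \<and>
        \<bar>empirical_excess n \<xi> (s_n \<xi>) s_M - \<gamma> \<xi>\<bar> \<le> C * sqrt (real D * L / real n) * \<gamma> \<xi> \<and>
        \<bar>\<gamma> \<xi> - v\<bar> \<le> C * (sqrt (max (real D) L * L) / real n + real D * sqrt (L / real n) / real n)"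
      using ctrl unfolding excess_controlled_def L_def by blast
    have n0': "0 < real n" using n0 by simp
    have rel: "C * (sqrt (max (real D) L * L) / real n + real D * sqrt (L / real n) / real n) \<le> C' * (\<rho> * v)"
      unfolding C'_def \<rho>_def
      by (rule relative_error_le[OF C pos(3,4) n0' D1 L1 AmL v_ge refl])
    \<comment> \<open>t stands for either excess risk: both lie within the same relative distance of
      \<open>\<gamma> \<xi>\<close>.\<close>
    have near: "(1 + \<epsilon>) * v \<ge> t \<and> t \<ge> (1 - \<epsilon>) * v \<and> (1 + \<epsilon>\<^sup>2) * v \<ge> t \<and> t \<ge> (1 - \<epsilon>\<^sup>2) * v"
      if \<xi>: "\<xi> \<in> space (sample n P) - Bad" and t: "\<bar>t - \<gamma> \<xi>\<bar> \<le> C * sqrt (real D * L / real n) * \<gamma> \<xi>" for \<xi> t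
    proof -
      have g: "\<bar>\<gamma> \<xi> - v\<bar> \<le> C' * (\<rho> * v)" using c[OF \<xi>] rel by linarith
      have "C * sqrt (real D * L / real n) * \<gamma> \<xi> \<le> C * \<rho> * \<gamma> \<xi>"
        using c[OF \<xi>] C by (intro mult_right_mono mult_left_mono) (auto simp: \<rho>_def)
      then have "\<bar>t - \<gamma> \<xi>\<bar> \<le> C * \<rho> * \<gamma> \<xi>" using t by linarith
      then have "\<bar>t - v\<bar> \<le> (C * (1 + C') + C') * \<rho> * v"
        by (rule two_sided_of_abs[OF _ g \<rho>0 \<rho>1 v0 less_imp_le[OF C] C'])
      also have "\<dots> \<le> A0 * \<rho> * v" using A0 \<rho>0 v0 by (intro mult_right_mono) auto
      finally have "\<bar>t - v\<bar> \<le> \<epsilon> * v" "\<bar>t - v\<bar> \<le> \<epsilon>\<^sup>2 * v"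
        using mult_right_mono[OF \<rho>_eps v0] mult_right_mono[OF \<rho>_eps2 v0] by linarith+
      then show ?thesis by (auto simp: algebra_simps abs_le_iff)
    qed
    have Bad_le: "S.prob Bad \<le> 10 * real n powr (- \<alpha>)" "S.prob Bad \<le> 5 * real n powr (- \<alpha>)"
      using Bad(2) powr_ge_zero[of "real n" "- \<alpha>"] by linarith+
    have sets: "{\<xi> \<in> space (sample n P). (1 + \<epsilon>) * v \<ge> true_excess P (s_n \<xi>) s_M \<and>
        true_excess P (s_n \<xi>) s_M \<ge> (1 - \<epsilon>) * v} \<in> sets (sample n P)"
      "{\<xi> \<in> space (sample n P). (1 + \<epsilon>\<^sup>2) * v \<ge> empirical_excess n \<xi> (s_n \<xi>) s_M \<and>
        empirical_excess n \<xi> (s_n \<xi>) s_M \<ge> (1 - \<epsilon>\<^sup>2) * v} \<in> sets (sample n P)"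
      using meas by measurable
    show "two_sided A0 \<alpha> n P \<I> r s_M s_n \<phi>"
      unfolding Let_def D_def[symmetric] unfolding \<epsilon>_def[symmetric] v_def[symmetric]
      by (intro conjI S.prob_ge_of_bad[OF sets(1) Bad(1) Bad_le(1)] S.prob_ge_of_bad[OF sets(2) Bad(1) Bad_le(2)])
        (use near c in blast)+
  qed
qed

lemma excess_upper:
  fixes \<alpha> A Ap c_M c_min :: real and r :: nat
  assumes pos: "0 < \<alpha>" "0 < A" "0 < Ap" "0 < c_M" "0 < c_min"
  shows "\<exists>A_u>0. \<forall>\<^sub>F n in sequentially. \<forall>c_max P s \<sigma> \<I> s_M s_n.
    common_hyps A c_M c_min c_max r n P s \<sigma> \<I> s_M s_n \<and>
    real (model_dim \<I> r) \<le> Ap * (real n / (ln (real n))\<^sup>2) \<longrightarrow>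
    (let b = A_u * (max (real (model_dim \<I> r)) (ln (real n)) / real n) in
      \<P>(\<xi> in sample n P. true_excess P (s_n \<xi>) s_M \<ge> b) \<le> 3 * real n powr (- \<alpha>) \<and>
      \<P>(\<xi> in sample n P. empirical_excess n \<xi> (s_n \<xi>) s_M \<ge> b) \<le> 3 * real n powr (- \<alpha>))"
proof -
  obtain C where C: "0 < C" and ev: "\<forall>\<^sub>F n in sequentially. regime_controlled C \<alpha> A Ap c_M c_min r n"
    using excess_controlled_eventually[OF pos, of r] by blast
  show ?thesis
  \<comment> \<open>Outside the exceptional set an excess risk is at most twice
    \<open>\<gamma>\<close>, hence at most 2 C E. The additional 1 makes the inequality strict, as
    the event includes equality.\<close>
  proof (intro exI[of _ "2 * C + 1"] conjI, use C in simp, use ev in eventually_elim, intro allI impI, elim conjE)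
    fix n c_max P s \<sigma> \<I> s_M s_n
    assume common: "common_hyps A c_M c_min c_max r n P s \<sigma> \<I> s_M s_n"
      and D_le: "real (model_dim \<I> r) \<le> Ap * (real n / (ln (real n))\<^sup>2)"
      and all: "regime_controlled C \<alpha> A Ap c_M c_min r n"
    define D where "D = model_dim \<I> r"
    define E where "E = max (real D) (ln (real n)) / real n"
    have "\<exists>v. excess_controlled C \<alpha> n D P s_M s_n v"
      using all common D_le unfolding D_def regime_controlled_def by blast
    then obtain v Bad \<gamma> where "1 \<le> D" and n0: "0 < n" and Pprob: "prob_space P"
      and small: "C * sqrt (real D * ln (real n) / real n) \<le> 1"
      and Bad: "Bad \<in> sets (sample n P)" "measure (sample n P) Bad \<le> real n powr (- \<alpha>)"
      and c: "\<And>\<xi>. \<xi> \<in> space (sample n P) - Bad \<Longrightarrow>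
        0 \<le> \<gamma> \<xi> \<and> \<gamma> \<xi> \<le> C * E \<and>
        \<bar>true_excess P (s_n \<xi>) s_M - \<gamma> \<xi>\<bar> \<le> C * sqrt (real D * ln (real n) / real n) * \<gamma> \<xi> \<and>
        \<bar>empirical_excess n \<xi> (s_n \<xi>) s_M - \<gamma> \<xi>\<bar> \<le> C * sqrt (real D * ln (real n) / real n) * \<gamma> \<xi>"
      unfolding excess_controlled_def E_def by blast
    interpret S: prob_space "sample n P"
      unfolding sample_def by (intro prob_space_PiM Pprob)
    have E0: "0 < E" using \<open>1 \<le> D\<close> n0 by (auto simp: E_def less_max_iff_disj)
    have below: "\<not> (2 * C + 1) * E \<le> t"
      if "\<xi> \<in> space (sample n P) - Bad" "\<bar>t - \<gamma> \<xi>\<bar> \<le> C * sqrt (real D * ln (real n) / real n) * \<gamma> \<xi>" for \<xi> t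
    proof -
      have "C * sqrt (real D * ln (real n) / real n) * \<gamma> \<xi> \<le> 1 * \<gamma> \<xi>"
        using small c[OF that(1)] by (intro mult_right_mono) auto
      moreover have "(2 * C + 1) * E = 2 * (C * E) + E" by (simp add: algebra_simps)
      ultimately show ?thesis using c[OF that(1)] that(2) E0 by linarith
    qed
    have Bad_le: "S.prob Bad \<le> 3 * real n powr (- \<alpha>)"
      using Bad(2) powr_ge_zero[of "real n" "- \<alpha>"] by linarith
    show "let b = (2 * C + 1) * (max (real (model_dim \<I> r)) (ln (real n)) / real n) in
      \<P>(\<xi> in sample n P. true_excess P (s_n \<xi>) s_M \<ge> b) \<le> 3 * real n powr (- \<alpha>) \<and>
      \<P>(\<xi> in sample n P. empirical_excess n \<xi> (s_n \<xi>) s_M \<ge> b) \<le> 3 * real n powr (- \<alpha>)"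
      unfolding Let_def D_def[symmetric] E_def[symmetric]
      by (intro conjI S.prob_le_of_bad[OF Bad(1) Bad_le]) (use below c in blast)+
  qed
qed

section \<open>Explicit thresholds and the order of the quantifiers\<close>

lemma ex_threshold_of_eventually:
  assumes "\<exists>A>0. \<forall>\<^sub>F n in sequentially. Q A n" and "\<And>A n. Q A n \<Longrightarrow> R A n"
  shows "\<exists>A>(0 :: real). \<exists>n0>(0 :: nat). \<forall>n\<ge>n0. R A n"
proof -
  obtain A N where "A > 0" "\<And>n. n \<ge> N \<Longrightarrow> Q A n"
    using assms(1) unfolding eventually_sequentially by blast
  then show ?thesis using assms(2) by (intro exI[of _ A] conjI exI[of _ "Suc N"]) auto
qed

text \<open>Here c plays the role of the upper density bound. One threshold serves every c, because
  the eventual statement is already uniform in it; \<open>Suc N\<close> makes the threshold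
  positive.\<close>

lemma ex_uniform_threshold_of_eventually:
  assumes "\<exists>A>0. \<forall>\<^sub>F n in sequentially. Q A n" and "\<And>A n c. Q A n \<Longrightarrow> R A c n"
  shows "\<exists>A>(0 :: real). \<forall>c>(0 :: real). \<exists>n0>(0 :: nat). \<forall>n\<ge>n0. R A c n"
proof -
  obtain A N where "A > 0" "\<And>n. n \<ge> N \<Longrightarrow> Q A n"
    using assms(1) unfolding eventually_sequentially by blast
  then show ?thesis
    using assms(2) by (intro exI[of _ A] conjI allI impI exI[of _ "Suc N"]) auto
qed

text \<open>Dependence of constants is expressed by quantifier order: the law, the partition and the
  estimator are chosen after n, so the model may change with n, while in the second part the
  constant precedes the upper density bound and the threshold follows it.\<close>

theorem corollary9:
  fixes \<alpha> :: real
  assumes "\<alpha> > 0"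
  shows "(\<forall>(A::real) (\<sigma>_min::real) (A_minus::real) (A_plus::real) (r::nat) (c_M::real) (c_min::real) (c_max::real).
      A > 0 \<and> \<sigma>_min > 0 \<and> A_minus > 0 \<and> A_plus > 0 \<and> c_M > 0 \<and> c_min > 0 \<and> c_max > 0 \<longrightarrow>
      (\<exists>A\<^sub>0>0. \<exists>n\<^sub>0>0. \<forall>n\<ge>n\<^sub>0. \<forall>P s \<sigma> \<I> s_M s_n \<phi>.
         common_hyps A c_M c_min c_max r n P s \<sigma> \<I> s_M s_n \<and>
         (AE x in law_X P. \<sigma>_min \<le> \<sigma> x) \<and>
         orthonormal_basis (law_X P) (piecewise_poly \<I> r) (model_dim \<I> r) \<phi> \<and>
         A_minus * (ln (real n))\<^sup>2 \<le> real (model_dim \<I> r) \<and>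
         real (model_dim \<I> r) \<le> A_plus * (real n / (ln (real n))\<^sup>2) \<longrightarrow>
         (let D = model_dim \<I> r; \<epsilon> = eps_n A\<^sub>0 D n; v = 1 / 4 * (real D / real n) * K1_sq P s_M D \<phi> in
           \<P>(\<xi> in sample n P.
               (1 + \<epsilon>) * v \<ge> true_excess P (s_n \<xi>) s_M \<and>
               true_excess P (s_n \<xi>) s_M \<ge> (1 - \<epsilon>) * v)
             \<ge> 1 - 10 * real n powr (- \<alpha>) \<and>
           \<P>(\<xi> in sample n P.
               (1 + \<epsilon>\<^sup>2) * v \<ge> empirical_excess n \<xi> (s_n \<xi>) s_M \<and>
               empirical_excess n \<xi> (s_n \<xi>) s_M \<ge> (1 - \<epsilon>\<^sup>2) * v)
             \<ge> 1 - 5 * real n powr (- \<alpha>))))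
    \<and> (\<forall>(A::real) (A_plus::real) (r::nat) (c_M::real) (c_min::real).
      A > 0 \<and> A_plus > 0 \<and> c_M > 0 \<and> c_min > 0 \<longrightarrow>
      (\<exists>A_u>0. \<forall>c_max>0. \<exists>n\<^sub>0>0. \<forall>n\<ge>n\<^sub>0. \<forall>P s \<sigma> \<I> s_M s_n.
         common_hyps A c_M c_min c_max r n P s \<sigma> \<I> s_M s_n \<and>
         1 \<le> model_dim \<I> r \<and>
         real (model_dim \<I> r) \<le> A_plus * (real n / (ln (real n))\<^sup>2) \<longrightarrow>
         (let b = A_u * (max (real (model_dim \<I> r)) (ln (real n)) / real n) in
           \<P>(\<xi> in sample n P. true_excess P (s_n \<xi>) s_M \<ge> b) \<le> 3 * real n powr (- \<alpha>) \<and>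
           \<P>(\<xi> in sample n P. empirical_excess n \<xi> (s_n \<xi>) s_M \<ge> b) \<le> 3 * real n powr (- \<alpha>))))"
proof (intro conjI allI impI, goal_cases)
  case (1 A \<sigma>_min A_minus A_plus r c_M c_min c_max)
  then have pos: "0 < A" "0 < \<sigma>_min" "0 < A_minus" "0 < A_plus" "0 < c_M" "0 < c_min" by auto
  show ?case
    by (rule ex_threshold_of_eventually[OF excess_two_sided[OF assms pos]]) blast
next
  case (2 A A_plus r c_M c_min)
  then have pos: "0 < A" "0 < A_plus" "0 < c_M" "0 < c_min" by auto
  show ?case
    by (rule ex_uniform_threshold_of_eventually[OF excess_upper[OF assms pos]]) blast
qed

end
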